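(* There exists a boundedly acyclic group $\Gamma$ with a normal subgroup $H$ such that $\Gamma/H$ is boundedly acyclic, but $\operatorname{H}^n_b(H;\mathbb{R})$ has dimension equal to the cardinality of the continuum for every $n \geq 2$.
   Context: $\operatorname{H}^*_b(\cdot;\mathbb{R})$ denotes bounded cohomology of groups with trivial real coefficients. A group $G$ is boundedly acyclic if $\operatorname{H}^n_b(G;\mathbb{R}) \cong 0$ for all $n\geq 1$. *)

theory Defs
  imports "HOL-Algebra.Algebra" "HOL-Library.Equipollence"
begin

text \<open>Bounded cohomology of a group G with trivial real coefficients, via the
inhomogeneous bounded cochain complex. An n-cochain is a bounded real function on
n-tuples (lists of length n) of group elements, extended by 0 elsewhere.\<close>

definition bcochain :: "('a, 'b) monoid_scheme \<Rightarrow> nat \<Rightarrow> ('a list \<Rightarrow> real) set" where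
  "bcochain G n = {f. (\<forall>xs. f xs \<noteq> 0 \<longrightarrow> length xs = n \<and> set xs \<subseteq> carrier G)
                      \<and> (\<exists>C. \<forall>xs. \<bar>f xs\<bar> \<le> C)}"

definition bcobound :: "('a, 'b) monoid_scheme \<Rightarrow> nat \<Rightarrow> ('a list \<Rightarrow> real) \<Rightarrow> ('a list \<Rightarrow> real)" where
  "bcobound G n f = (\<lambda>xs. if length xs = Suc n \<and> set xs \<subseteq> carrier G then
      f (tl xs)
      + (\<Sum>i=1..n. (-1)^i * f (take (i - 1) xs @ [xs ! (i - 1) \<otimes>\<^bsub>G\<^esub> xs ! i] @ drop (i + 1) xs))
      + (-1)^(Suc n) * f (butlast xs)
    else 0)"

definition bcocycles :: "('a, 'b) monoid_scheme \<Rightarrow> nat \<Rightarrow> ('a list \<Rightarrow> real) set" where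
  "bcocycles G n = {f \<in> bcochain G n. bcobound G n f = (\<lambda>_. 0)}"

definition bcoboundaries :: "('a, 'b) monoid_scheme \<Rightarrow> nat \<Rightarrow> ('a list \<Rightarrow> real) set" where
  "bcoboundaries G n = (case n of 0 \<Rightarrow> {\<lambda>_. 0} | Suc m \<Rightarrow> bcobound G m ` bcochain G m)"

definition bcoh_vanishes :: "('a, 'b) monoid_scheme \<Rightarrow> nat \<Rightarrow> bool" where
  "bcoh_vanishes G n \<longleftrightarrow> bcocycles G n \<subseteq> bcoboundaries G n"

definition boundedly_acyclic :: "('a, 'b) monoid_scheme \<Rightarrow> bool" where
  "boundedly_acyclic G \<longleftrightarrow> group G \<and> (\<forall>n\<ge>1. bcoh_vanishes G n)"

definition lincomb :: "(('a list \<Rightarrow> real) \<Rightarrow> real) \<Rightarrow> ('a list \<Rightarrow> real) set \<Rightarrow> ('a list \<Rightarrow> real)" where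
  "lincomb c T = (\<lambda>xs. \<Sum>t\<in>T. c t * t xs)"

text \<open>The real vector space H^n_b(G;R) = Z^n/B^n has a basis (the classes of a set
S of cocycles) equipollent to A, i.e. its dimension is the cardinality of A.\<close>
definition bcoh_dim_eqpoll :: "('a, 'b) monoid_scheme \<Rightarrow> nat \<Rightarrow> 'c set \<Rightarrow> bool" where
  "bcoh_dim_eqpoll G n A \<longleftrightarrow> (\<exists>S \<subseteq> bcocycles G n. S \<approx> A
     \<and> (\<forall>T c. finite T \<and> T \<subseteq> S \<and> lincomb c T \<in> bcoboundaries G n \<longrightarrow> (\<forall>t\<in>T. c t = 0))
     \<and> (\<forall>z \<in> bcocycles G n. \<exists>T c b. finite T \<and> T \<subseteq> S \<and> b \<in> bcoboundaries G n
            \<and> z = (\<lambda>xs. lincomb c T xs + b xs)))"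

end

theory Submission
  imports Defs "HOL-Combinatorics.Perm" "HOL-Complex_Analysis.Complex_Analysis"
begin

text \<open>
  \<open>\<Gamma>\<close> is the restricted wreath product of a countable group \<open>G\<close> with the group of finitary permutations
  of the natural numbers, and \<open>H\<close> is its base group, the direct sum of countably many copies of \<open>G\<close>.

  Bounded acyclicity of \<open>\<Gamma>\<close> (for every countable \<open>G\<close>): a homogeneous cocycle \<open>F(g\<^sub>0, \<dots>, g\<^sub>n)\<close> is cohomologous
  to the average of \<open>F(g\<^sub>0X\<^sub>0, \<dots>, g\<^sub>nX\<^sub>n)\<close> over independent random elements \<open>X\<^sub>i\<close>. Take \<open>X\<^sub>i\<close> to consist of
  independent random words on many lamps and a uniform permutation of these lamps. Translating one lamp
  by an element of \<open>G\<close> amounts to inserting a bounded density at that lamp; by invariance under permutations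
  the density can be moved to any other lamp, hence be replaced by its average over all lamps, which is close to
  1 by the law of large numbers. So the averaged cocycle is constant.

  Nontrivial classes of \<open>H\<close>: choose \<open>G = GL\<^sub>2\<^sup>+(Q) \<times> GL\<^sub>2(Q(i))\<close>. On the projective line these groups have
  amenable point stabilisers, so a bounded primitive of an invariant cocycle may be averaged to an invariant
  function on tuples of points. The orientation cocycle of \<open>P\<^sup>1(Q)\<close> and the volume cocycle (Bloch-Wigner
  dilogarithm of the cross ratio) of \<open>P\<^sup>1(Q(i))\<close> are then nontrivial because the actions are 2- and 3-transitive,
  respectively. Cup products with the orientation class give all degrees at least 2, and the averages
  \<open>(1 - t) \<Sum>\<^sub>i t\<^sup>i r\<^sub>i\<^sup>*F\<close> over countably many retractions \<open>r\<^sub>i\<close> of \<open>H\<close> onto itself, for \<open>0 < t < 1\<close>, give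
  continuum many independent classes.
\<close>

section \<open>Bounded functions and means\<close>

definition bounded_fun :: "('x \<Rightarrow> real) \<Rightarrow> bool" where
  "bounded_fun f \<longleftrightarrow> bounded (range f)"

lemma bounded_fun_iff: "bounded_fun f \<longleftrightarrow> (\<exists>C. \<forall>x. \<bar>f x\<bar> \<le> C)"
  by (simp add: bounded_fun_def bounded_iff)

lemma bounded_funI: "(\<And>x. \<bar>f x\<bar> \<le> C) \<Longrightarrow> bounded_fun f"
  by (auto simp: bounded_fun_iff)

lemma bounded_fun_const [simp]: "bounded_fun (\<lambda>_. c)"
  by (auto simp: bounded_fun_iff)

lemma bounded_fun_compose: "bounded_fun f \<Longrightarrow> bounded_fun (\<lambda>x. f (h x))"
  by (auto simp: bounded_fun_iff)

lemma bounded_fun_add: "bounded_fun f \<Longrightarrow> bounded_fun g \<Longrightarrow> bounded_fun (\<lambda>x. f x + g x)"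
  unfolding bounded_fun_def by (rule bounded_plus_comp)

lemma bounded_fun_cmult: "bounded_fun f \<Longrightarrow> bounded_fun (\<lambda>x. c * f x)"
  unfolding bounded_fun_def using bounded_scaleR_comp[of f UNIV c] by simp

locale linear_functional =
  fixes V :: "('x \<Rightarrow> real) \<Rightarrow> bool" and \<mu> :: "('x \<Rightarrow> real) \<Rightarrow> real"
  assumes zero_mem: "V (\<lambda>_. 0)"
    and add_mem: "V f \<Longrightarrow> V g \<Longrightarrow> V (\<lambda>x. f x + g x)"
    and cmult_mem: "V f \<Longrightarrow> V (\<lambda>x. c * f x)"
    and add: "V f \<Longrightarrow> V g \<Longrightarrow> \<mu> (\<lambda>x. f x + g x) = \<mu> f + \<mu> g"
    and cmult: "V f \<Longrightarrow> \<mu> (\<lambda>x. c * f x) = c * \<mu> f"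
begin

lemma zero: "\<mu> (\<lambda>_. 0) = 0"
  using cmult[OF zero_mem, of 0] by simp

lemma diff_mem: "V f \<Longrightarrow> V g \<Longrightarrow> V (\<lambda>x. f x - g x)"
  using add_mem[of f "\<lambda>x. -1 * g x"] cmult_mem[of g "-1"] by simp

lemma diff: "V f \<Longrightarrow> V g \<Longrightarrow> \<mu> (\<lambda>x. f x - g x) = \<mu> f - \<mu> g"
  using add[of f "\<lambda>x. -1 * g x"] cmult_mem[of g "-1"] cmult[of g "-1"] by simp

end

locale mean = linear_functional bounded_fun m for m :: "('x \<Rightarrow> real) \<Rightarrow> real" +
  assumes abs_le: "(\<And>x. \<bar>f x\<bar> \<le> C) \<Longrightarrow> \<bar>m f\<bar> \<le> C"
    and const: "m (\<lambda>_. c) = c"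

lemma meanI:
  assumes "\<And>f g. bounded_fun f \<Longrightarrow> bounded_fun g \<Longrightarrow> m (\<lambda>x. f x + g x) = m f + m g"
    and "\<And>f c. bounded_fun f \<Longrightarrow> m (\<lambda>x. c * f x) = c * m f"
    and "\<And>f C. (\<And>x. \<bar>f x\<bar> \<le> C) \<Longrightarrow> \<bar>m f\<bar> \<le> C"
    and "\<And>c. m (\<lambda>_. c) = c"
  shows "mean m"
  using assms by unfold_locales (auto intro: bounded_fun_add bounded_fun_cmult)

lemma mean_compose:
  fixes h :: "'q \<Rightarrow> 'u \<Rightarrow> 'x"
  assumes M: "mean M" and m: "\<And>q. mean (m q)"
  shows "mean (\<lambda>f. M (\<lambda>q. m q (\<lambda>u. f (h q u))))"
proof -
  have m_le: "\<bar>m q (\<lambda>u. f (h q u))\<bar> \<le> C" if "\<And>x. \<bar>f x\<bar> \<le> C" for f :: "'x \<Rightarrow> real" and C q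
    using that by (rule mean.abs_le[OF m])
  have bounded: "bounded_fun (\<lambda>q. m q (\<lambda>u. f (h q u)))" if "bounded_fun f" for f :: "'x \<Rightarrow> real"
  proof -
    obtain C where "\<And>x. \<bar>f x\<bar> \<le> C" using \<open>bounded_fun f\<close> by (auto simp: bounded_fun_iff)
    then show ?thesis by (intro bounded_funI[of _ C] m_le)
  qed
  show ?thesis
  proof (rule meanI)
    fix f g :: "'x \<Rightarrow> real" assume f: "bounded_fun f" and g: "bounded_fun g"
    have "m q (\<lambda>u. f (h q u) + g (h q u)) = m q (\<lambda>u. f (h q u)) + m q (\<lambda>u. g (h q u))" for q
      by (rule linear_functional.add[OF mean.axioms(1)[OF m]])
         (rule bounded_fun_compose[OF f], rule bounded_fun_compose[OF g])
    then show "M (\<lambda>q. m q (\<lambda>u. f (h q u) + g (h q u)))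
        = M (\<lambda>q. m q (\<lambda>u. f (h q u))) + M (\<lambda>q. m q (\<lambda>u. g (h q u)))"
      using mean.axioms(1)[OF M, THEN linear_functional.add, OF bounded[OF f] bounded[OF g]] by simp
  next
    fix f :: "'x \<Rightarrow> real" and c assume f: "bounded_fun f"
    have "m q (\<lambda>u. c * f (h q u)) = c * m q (\<lambda>u. f (h q u))" for q
      by (rule linear_functional.cmult[OF mean.axioms(1)[OF m]]) (rule bounded_fun_compose[OF f])
    then show "M (\<lambda>q. m q (\<lambda>u. c * f (h q u))) = c * M (\<lambda>q. m q (\<lambda>u. f (h q u)))"
      using mean.axioms(1)[OF M, THEN linear_functional.cmult, OF bounded[OF f]] by simp
  next
    fix f :: "'x \<Rightarrow> real" and C assume "\<And>x. \<bar>f x\<bar> \<le> C"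
    then show "\<bar>M (\<lambda>q. m q (\<lambda>u. f (h q u)))\<bar> \<le> C" by (intro mean.abs_le[OF M] m_le)
  qed (simp add: mean.const[OF M] mean.const[OF m])
qed

lemma closed_mem_cluster_point:
  assumes "closed S" "eventually (\<lambda>x. x \<in> S) F" "inf (nhds a) F \<noteq> bot"
  shows "a \<in> S"
proof (rule ccontr)
  assume "a \<notin> S"
  then have "eventually (\<lambda>x. x \<notin> S) (nhds a)"
    using assms(1) eventually_nhds_in_open[of "- S" a] by auto
  then have "eventually (\<lambda>_. False) (inf (nhds a) F)"
    using assms(2) unfolding eventually_inf by (metis (mono_tags, lifting))
  then show False using assms(3) by (simp add: eventually_False)
qed

lemma compact_PiE_UNIV:
  fixes S :: "'i \<Rightarrow> 'a::topological_space set"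
  assumes "\<And>i. compact (S i)" shows "compact (PiE UNIV S)"
  using compactin_PiE[of "\<lambda>_. euclidean" UNIV S] assms
  by (simp add: euclidean_product_topology)

definition bounded_evaluation :: "'x \<Rightarrow> ('x \<Rightarrow> real) \<Rightarrow> real" where
  "bounded_evaluation x f = (if bounded_fun f then f x else 0)"

lemma ex_cluster_point_bounded_evaluation:
  fixes F :: "'x filter"
  assumes "F \<noteq> bot" shows "\<exists>m. inf (nhds m) (filtermap bounded_evaluation F) \<noteq> bot"
proof -
  define bound where "bound f = (SOME C. bounded_fun f \<longrightarrow> (\<forall>x. \<bar>f x\<bar> \<le> C))" for f :: "'x \<Rightarrow> real"
  define K where "K = PiE UNIV (\<lambda>f. {- \<bar>bound f\<bar>..\<bar>bound f\<bar>})"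
  have "\<bar>f x\<bar> \<le> \<bar>bound f\<bar>" if "bounded_fun f" for f x
  proof -
    have "\<exists>C. bounded_fun f \<longrightarrow> (\<forall>x. \<bar>f x\<bar> \<le> C)" by (simp add: bounded_fun_iff)
    from someI_ex[OF this] have "\<bar>f x\<bar> \<le> bound f" using that unfolding bound_def by blast
    then show ?thesis by linarith
  qed
  then have "bounded_evaluation x \<in> K" for x
    by (auto simp: K_def bounded_evaluation_def abs_le_iff minus_le_iff)
  then have "eventually (\<lambda>g. g \<in> K) (filtermap bounded_evaluation F)" by (simp add: eventually_filtermap)
  moreover have "compact K" unfolding K_def by (rule compact_PiE_UNIV) simp
  moreover have "filtermap bounded_evaluation F \<noteq> bot" using assms by (simp add: filtermap_bot_iff)
  ultimately show ?thesis unfolding compact_filter by blast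
qed

lemma cluster_point_bounded_evaluation_mem:
  assumes "inf (nhds m) (filtermap bounded_evaluation F) \<noteq> bot"
    and "closed {g. P g}" "eventually (\<lambda>x. P (bounded_evaluation x)) F"
  shows "P m"
  using closed_mem_cluster_point[OF assms(2) _ assms(1)] assms(3) by (simp add: eventually_filtermap)

lemma mean_cluster_point_bounded_evaluation:
  fixes F :: "'x filter"
  assumes cluster: "inf (nhds m) (filtermap bounded_evaluation F) \<noteq> bot"
  shows "mean m"
proof (rule meanI)
  note mem = cluster_point_bounded_evaluation_mem[OF cluster]
  note coord = continuous_on_product_coordinates
  fix f :: "'x \<Rightarrow> real"
  show "m (\<lambda>x. f x + g x) = m f + m g" if "bounded_fun f" "bounded_fun g" for g
    by (rule mem[where P = "\<lambda>m. m (\<lambda>x. f x + g x) = m f + m g"],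
        intro closed_Collect_eq continuous_intros coord)
       (use that in \<open>simp add: bounded_evaluation_def bounded_fun_add\<close>)
  show "m (\<lambda>x. c * f x) = c * m f" if "bounded_fun f" for c
    by (rule mem[where P = "\<lambda>m. m (\<lambda>x. c * f x) = c * m f"],
        intro closed_Collect_eq continuous_intros coord)
       (use that in \<open>simp add: bounded_evaluation_def bounded_fun_cmult\<close>)
  show "\<bar>m f\<bar> \<le> C" if f_le: "\<And>x. \<bar>f x\<bar> \<le> C" for C
    by (rule mem[where P = "\<lambda>m. \<bar>m f\<bar> \<le> C"], intro closed_Collect_le continuous_intros coord)
       (simp add: bounded_evaluation_def f_le bounded_funI[OF f_le])
  show "m (\<lambda>_. c) = c" for c
    by (rule mem[where P = "\<lambda>m. m (\<lambda>_. c) = c"], intro closed_Collect_eq continuous_intros coord)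
       (simp add: bounded_evaluation_def)
qed

lemma ex_mean_extending_limit:
  fixes F :: "'x filter"
  assumes "F \<noteq> bot"
  shows "\<exists>m. mean m \<and> (\<forall>f l. bounded_fun f \<longrightarrow> (f \<longlongrightarrow> l) F \<longrightarrow> m f = l)"
proof -
  obtain m where cluster: "inf (nhds m) (filtermap bounded_evaluation F) \<noteq> bot"
    using ex_cluster_point_bounded_evaluation[OF assms] by blast
  have "m f = l" if f: "bounded_fun f" and lim: "(f \<longlongrightarrow> l) F" for f l
  proof -
    have "\<bar>m f - l\<bar> \<le> 0 + e" if "e > 0" for e
    proof (rule cluster_point_bounded_evaluation_mem[OF cluster])
      show "closed {M :: ('x \<Rightarrow> real) \<Rightarrow> real. \<bar>M f - l\<bar> \<le> 0 + e}"
        by (intro closed_Collect_le continuous_intros continuous_on_product_coordinates)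
      show "eventually (\<lambda>x. \<bar>bounded_evaluation x f - l\<bar> \<le> 0 + e) F"
        using tendstoD[OF lim that] f
        by (auto simp: bounded_evaluation_def dist_real_def elim!: eventually_mono)
    qed
    then have "\<bar>m f - l\<bar> \<le> 0" by (rule field_le_epsilon)
    then show ?thesis by simp
  qed
  then show ?thesis using mean_cluster_point_bounded_evaluation[OF cluster] by blast
qed

definition generalized_limit :: "(nat \<Rightarrow> real) \<Rightarrow> real" where
  "generalized_limit = (SOME m. mean m \<and> (\<forall>s l. bounded_fun s \<longrightarrow> s \<longlonglongrightarrow> l \<longrightarrow> m s = l))"

lemma mean_generalized_limit: "mean generalized_limit"
  and generalized_limit_eq: "s \<longlonglongrightarrow> l \<Longrightarrow> generalized_limit s = l"
proof -
  have spec: "mean generalized_limit \<and> (\<forall>s l. bounded_fun s \<longrightarrow> s \<longlonglongrightarrow> l \<longrightarrow> generalized_limit s = l)"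
    unfolding generalized_limit_def
    by (rule someI_ex[OF ex_mean_extending_limit[OF sequentially_bot]])
  then show "mean generalized_limit" by blast
  have "bounded_fun s" if "s \<longlonglongrightarrow> l"
    using convergent_imp_bounded[OF that] by (simp add: bounded_fun_def)
  then show "s \<longlonglongrightarrow> l \<Longrightarrow> generalized_limit s = l" using spec by blast
qed

interpretation generalized_limit: mean generalized_limit
  by (rule mean_generalized_limit)

section \<open>Averages over finite sets\<close>

definition avg :: "'s set \<Rightarrow> ('s \<Rightarrow> real) \<Rightarrow> real" where
  "avg S f = (\<Sum>s\<in>S. f s) / card S"

lemma avg_add: "avg S (\<lambda>s. f s + g s) = avg S f + avg S g"
  by (simp add: avg_def sum.distrib add_divide_distrib)

lemma avg_diff: "avg S (\<lambda>s. f s - g s) = avg S f - avg S g"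
  by (simp add: avg_def sum_subtractf diff_divide_distrib)

lemma avg_cmult: "avg S (\<lambda>s. c * f s) = c * avg S f"
  by (simp add: avg_def sum_distrib_left)

lemma avg_cmult_right: "avg S (\<lambda>s. f s * c) = avg S f * c"
  by (simp add: avg_def sum_distrib_right)

lemma avg_cong: "(\<And>s. s \<in> S \<Longrightarrow> f s = g s) \<Longrightarrow> avg S f = avg S g"
  by (simp add: avg_def)

lemma avg_const: "finite S \<Longrightarrow> S \<noteq> {} \<Longrightarrow> avg S (\<lambda>_. c) = c"
  by (simp add: avg_def)

lemma avg_mono: "(\<And>s. s \<in> S \<Longrightarrow> f s \<le> g s) \<Longrightarrow> avg S f \<le> avg S g"
  by (simp add: avg_def divide_right_mono sum_mono)

lemma avg_abs_le_avg: "\<bar>avg S f\<bar> \<le> avg S (\<lambda>s. \<bar>f s\<bar>)"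
  by (simp add: avg_def divide_right_mono)

lemma avg_abs_le: "finite S \<Longrightarrow> S \<noteq> {} \<Longrightarrow> (\<And>s. s \<in> S \<Longrightarrow> \<bar>f s\<bar> \<le> C) \<Longrightarrow> \<bar>avg S f\<bar> \<le> C"
  using avg_abs_le_avg[of S f] avg_mono[of S "\<lambda>s. \<bar>f s\<bar>" "\<lambda>_. C"] by (simp add: avg_const)

lemma avg_sum: "avg S (\<lambda>s. \<Sum>j\<in>J. f j s) = (\<Sum>j\<in>J. avg S (f j))"
  by (simp add: avg_def sum.swap[of _ S] sum_divide_distrib)

lemma avg_swap: "avg A (\<lambda>a. avg B (f a)) = avg B (\<lambda>b. avg A (\<lambda>a. f a b))"
  by (simp add: avg_def sum.swap[of _ A] sum_divide_distrib[symmetric] mult.commute)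

lemma avg_Times: "avg (A \<times> B) f = avg A (\<lambda>a. avg B (\<lambda>b. f (a, b)))"
  by (simp add: avg_def sum.cartesian_product card_cartesian_product sum_divide_distrib[symmetric]
      mult.commute)

lemma avg_reindex: "bij_betw h A B \<Longrightarrow> avg A (\<lambda>s. f (h s)) = avg B f"
  by (simp add: avg_def sum.reindex_bij_betw bij_betw_same_card)

lemma avg_square_le: "(avg S f)\<^sup>2 \<le> avg S (\<lambda>s. (f s)\<^sup>2)"
proof (cases "card S = 0")
  case False
  have "(avg S f)\<^sup>2 = (\<Sum>s\<in>S. f s)\<^sup>2 / (real (card S))\<^sup>2" by (simp add: avg_def power_divide)
  also have "\<dots> \<le> ((\<Sum>s\<in>S. (f s)\<^sup>2) * card S) / (real (card S))\<^sup>2"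
    by (intro divide_right_mono sum_squared_le_sum_of_squares) simp
  also have "\<dots> = avg S (\<lambda>s. (f s)\<^sup>2)" using False by (simp add: avg_def power2_eq_square)
  finally show ?thesis .
qed (simp add: avg_def)

lemma mean_avg: "finite S \<Longrightarrow> S \<noteq> {} \<Longrightarrow> mean (\<lambda>f. avg S (\<lambda>s. f (h s)))"
  by (rule meanI) (simp_all add: avg_add avg_cmult avg_const avg_abs_le)

lemma avg_PiE_resample:
  assumes "finite B" "B \<noteq> {}" "j \<in> A"
  shows "avg (A \<rightarrow>\<^sub>E B) f = avg (A \<rightarrow>\<^sub>E B) (\<lambda>x. avg B (\<lambda>b. f (x(j := b))))"
proof -
  let ?P = "A \<rightarrow>\<^sub>E B"
  have "(\<Sum>x\<in>?P. \<Sum>b\<in>B. f (x(j := b))) = (\<Sum>(x, b)\<in>?P \<times> B. f (x(j := b)))"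
    by (rule sum.cartesian_product)
  also have "\<dots> = (\<Sum>(x, b)\<in>?P \<times> B. f x)"
    by (rule sum.reindex_bij_witness[of _ "\<lambda>(x, b). (x(j := b), x j)" "\<lambda>(x, b). (x(j := b), x j)"])
       (use assms in \<open>auto simp: PiE_iff extensional_def\<close>)
  also have "\<dots> = card B * (\<Sum>x\<in>?P. f x)"
    by (simp add: sum.cartesian_product[symmetric] sum_distrib_left)
  finally have total: "(\<Sum>x\<in>?P. \<Sum>b\<in>B. f (x(j := b))) = card B * (\<Sum>x\<in>?P. f x)" .
  have "card B \<noteq> 0" using assms by simp
  then show ?thesis unfolding avg_def using total by (simp add: sum_divide_distrib[symmetric])
qed

definition tuples :: "'s set \<Rightarrow> nat \<Rightarrow> 's list set" where
  "tuples S n = {ss. set ss \<subseteq> S \<and> length ss = n}"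

lemma tuples_0: "tuples S 0 = {[]}"
  by (auto simp: tuples_def)

lemma finite_tuples: "finite S \<Longrightarrow> finite (tuples S n)"
  by (simp add: tuples_def finite_lists_length_eq)

lemma tuples_nonempty: "S \<noteq> {} \<Longrightarrow> tuples S n \<noteq> {}"
proof -
  assume "S \<noteq> {}"
  then obtain s where "s \<in> S" by blast
  then have "replicate n s \<in> tuples S n" by (auto simp: tuples_def)
  then show ?thesis by blast
qed

lemma avg_tuples_0: "avg (tuples S 0) f = f []"
  by (simp add: avg_def tuples_0)

lemma avg_tuples_Suc: "avg (tuples S (Suc n)) f = avg S (\<lambda>s. avg (tuples S n) (\<lambda>ss. f (s # ss)))"
proof -
  have "bij_betw (\<lambda>(s, ss). s # ss) (S \<times> tuples S n) (tuples S (Suc n))"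
    by (auto simp: bij_betw_def inj_on_def tuples_def length_Suc_conv image_iff)
  then show ?thesis using avg_reindex[of "\<lambda>(s, ss). s # ss" "S \<times> tuples S n" _ f]
    by (simp add: avg_Times)
qed

lemma avg_tuples_prod_list:
  "avg (tuples S (length is)) (\<lambda>ss. prod_list (map2 \<phi> is ss)) = (\<Prod>i\<leftarrow>is. avg S (\<phi> i))"
  by (induction "is") (simp_all add: avg_tuples_0 avg_tuples_Suc avg_cmult avg_cmult_right)

text \<open>The second moment of the total weight \<open>\<Sum>j\<in>J. w j\<close> around its mean is the sum of the variances,
  since the cross terms cancel.\<close>

lemma avg_weak_law_square:
  fixes w :: "'j \<Rightarrow> 's \<Rightarrow> real" and r V :: real
  assumes "finite S" "S \<noteq> {}" "finite J"
    and expectation: "\<And>j. j \<in> J \<Longrightarrow> avg S (w j) = r"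
    and uncorrelated: "\<And>j k. j \<in> J \<Longrightarrow> k \<in> J \<Longrightarrow> j \<noteq> k \<Longrightarrow> avg S (\<lambda>s. w j s * w k s) = r\<^sup>2"
    and second_moment: "\<And>j. j \<in> J \<Longrightarrow> avg S (\<lambda>s. (w j s)\<^sup>2) \<le> V"
  shows "avg S (\<lambda>s. ((\<Sum>j\<in>J. w j s) - card J * r)\<^sup>2) \<le> card J * V"
proof -
  let ?K = "real (card J)"
  have cross: "(\<Sum>k\<in>J. avg S (\<lambda>s. w j s * w k s)) \<le> V + ?K * r\<^sup>2" if j: "j \<in> J" for j
  proof -
    have "(\<Sum>k\<in>J. avg S (\<lambda>s. w j s * w k s))
        = avg S (\<lambda>s. (w j s)\<^sup>2) + (\<Sum>k\<in>J - {j}. avg S (\<lambda>s. w j s * w k s))"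
      using sum.remove[OF assms(3) j] by (simp add: power2_eq_square)
    also have "(\<Sum>k\<in>J - {j}. avg S (\<lambda>s. w j s * w k s)) = (\<Sum>k\<in>J - {j}. r\<^sup>2)"
      by (rule sum.cong) (use uncorrelated[OF j] in auto)
    also have "(\<Sum>k\<in>J - {j}. r\<^sup>2) \<le> ?K * r\<^sup>2" by (simp add: mult_right_mono card_mono assms(3))
    finally show ?thesis using second_moment[OF j] by linarith
  qed
  have "((\<Sum>j\<in>J. w j s) - ?K * r)\<^sup>2
      = (\<Sum>j\<in>J. \<Sum>k\<in>J. w j s * w k s) + ((- 2 * ?K * r) * (\<Sum>j\<in>J. w j s) + (?K * r)\<^sup>2)" for s
    by (simp add: power2_eq_square sum_product algebra_simps)
  then have "avg S (\<lambda>s. ((\<Sum>j\<in>J. w j s) - ?K * r)\<^sup>2)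
      = (\<Sum>j\<in>J. \<Sum>k\<in>J. avg S (\<lambda>s. w j s * w k s)) + ((- 2 * ?K * r) * (?K * r) + (?K * r)\<^sup>2)"
    by (simp only: avg_add avg_cmult avg_sum avg_const[OF assms(1,2)] expectation sum_constant of_nat_id
        cong: sum.cong)
  also have "\<dots> \<le> ?K * (V + ?K * r\<^sup>2) + ((- 2 * ?K * r) * (?K * r) + (?K * r)\<^sup>2)"
    by (intro add_right_mono) (use sum_bounded_above[of J, OF cross] in simp)
  also have "\<dots> = ?K * V" by (simp add: power2_eq_square algebra_simps)
  finally show ?thesis .
qed

lemma avg_weak_law:
  fixes w :: "'j \<Rightarrow> 's \<Rightarrow> real" and r V C :: real
  assumes S: "finite S" "S \<noteq> {}" and J: "finite J" "J \<noteq> {}"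
    and expectation: "\<And>j. j \<in> J \<Longrightarrow> avg S (w j) = r"
    and uncorrelated: "\<And>j k. j \<in> J \<Longrightarrow> k \<in> J \<Longrightarrow> j \<noteq> k \<Longrightarrow> avg S (\<lambda>s. w j s * w k s) = r\<^sup>2"
    and second_moment: "\<And>j. j \<in> J \<Longrightarrow> avg S (\<lambda>s. (w j s)\<^sup>2) \<le> V"
    and bound: "\<And>s. s \<in> S \<Longrightarrow> \<bar>f s\<bar> \<le> C" "0 \<le> C"
    and weighted: "\<And>j. j \<in> J \<Longrightarrow> avg S (\<lambda>s. w j s * f s) = a"
  shows "\<bar>a - r * avg S f\<bar> \<le> C * sqrt (V / card J)"
proof -
  let ?K = "real (card J)" and ?D = "\<lambda>s. (\<Sum>j\<in>J. w j s) - card J * r"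
  have K: "?K > 0" using J by (simp add: card_gt_0_iff)
  have "(avg S (\<lambda>s. \<bar>?D s\<bar>))\<^sup>2 \<le> avg S (\<lambda>s. \<bar>?D s\<bar>\<^sup>2)" by (rule avg_square_le)
  also have "\<dots> \<le> ?K * V"
    using avg_weak_law_square[OF S J(1) expectation uncorrelated second_moment] by simp
  finally have deviation: "avg S (\<lambda>s. \<bar>?D s\<bar>) \<le> sqrt (?K * V)" by (rule real_le_rsqrt)
  have "avg S (\<lambda>s. ?D s * f s) = ?K * a - ?K * r * avg S f"
    unfolding left_diff_distrib avg_diff sum_distrib_right avg_sum avg_cmult using weighted by simp
  also have "\<dots> = ?K * (a - r * avg S f)" by (simp add: right_diff_distrib)
  finally have "?K * \<bar>a - r * avg S f\<bar> = \<bar>avg S (\<lambda>s. ?D s * f s)\<bar>" by (simp add: abs_mult)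
  also have "\<dots> \<le> avg S (\<lambda>s. \<bar>?D s * f s\<bar>)" by (rule avg_abs_le_avg)
  also have "\<dots> \<le> avg S (\<lambda>s. C * \<bar>?D s\<bar>)"
    by (rule avg_mono) (simp add: abs_mult mult.commute[of C] mult_left_mono bound)
  also have "\<dots> \<le> C * sqrt (?K * V)"
    unfolding avg_cmult by (rule mult_left_mono[OF deviation bound(2)])
  also have "sqrt (?K * V) = ?K * sqrt (V / ?K)"
  proof -
    have "?K * V = ?K\<^sup>2 * (V / ?K)" using K by (simp add: power2_eq_square)
    then have "sqrt (?K * V) = sqrt (?K\<^sup>2) * sqrt (V / ?K)" by (metis real_sqrt_mult)
    then show ?thesis by simp
  qed
  also have "C * (?K * sqrt (V / ?K)) = ?K * (C * sqrt (V / ?K))" by (rule mult.left_commute)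
  finally show ?thesis using K by (rule mult_left_le_imp_le)
qed

section \<open>Homogeneous cochains\<close>

text \<open>Groups are elements of \<open>group_add\<close>, the type class of groups that need not be commutative.\<close>

fun cobound :: "('g list \<Rightarrow> real) \<Rightarrow> 'g list \<Rightarrow> real" where
  "cobound F [] = 0"
| "cobound F (x # xs) = F xs - cobound (\<lambda>l. F (x # l)) xs"

definition bounded_cochain :: "('g list \<Rightarrow> real) \<Rightarrow> bool" where
  "bounded_cochain F \<longleftrightarrow> (\<forall>n. \<exists>C. \<forall>xs. length xs = n \<longrightarrow> \<bar>F xs\<bar> \<le> C)"

definition translation_invariant :: "('g::group_add list \<Rightarrow> real) \<Rightarrow> bool" where
  "translation_invariant F \<longleftrightarrow> (\<forall>g xs. F (map ((+) g) xs) = F xs)"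

definition invariant_cochain :: "('g::group_add list \<Rightarrow> real) \<Rightarrow> bool" where
  "invariant_cochain F \<longleftrightarrow> translation_invariant F \<and> bounded_cochain F"

definition bounded_cocycle :: "nat \<Rightarrow> ('g::group_add list \<Rightarrow> real) \<Rightarrow> bool" where
  "bounded_cocycle n F \<longleftrightarrow> invariant_cochain F \<and> (\<forall>xs. length xs = n + 2 \<longrightarrow> cobound F xs = 0)"

definition bounded_coboundary :: "nat \<Rightarrow> ('g::group_add list \<Rightarrow> real) \<Rightarrow> bool" where
  "bounded_coboundary n F \<longleftrightarrow>
     (\<exists>B. invariant_cochain B \<and> (\<forall>xs. length xs = n + 1 \<longrightarrow> F xs = cobound B xs))"

lemma cobound_add: "cobound (\<lambda>l. F l + G l) xs = cobound F xs + cobound G xs"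
  by (induction xs arbitrary: F G) auto

lemma cobound_cmult: "cobound (\<lambda>l. c * F l) xs = c * cobound F xs"
  by (induction xs arbitrary: F) (auto simp: algebra_simps)

lemma cobound_minus: "cobound (\<lambda>l. - F l) xs = - cobound F xs"
  using cobound_cmult[of "-1" F xs] by simp

lemma cobound_diff: "cobound (\<lambda>l. F l - G l) xs = cobound F xs - cobound G xs"
  using cobound_add[of F "\<lambda>l. - G l" xs] cobound_minus[of G xs] by simp

lemma cobound_const: "cobound (\<lambda>_. c) xs = (if even (length xs) then 0 else c)"
  by (induction xs) auto

lemma cobound_map: "cobound F (map h xs) = cobound (\<lambda>l. F (map h l)) xs"
  by (induction xs arbitrary: F) auto

lemma cobound_cong:
  "(\<And>l. Suc (length l) = length xs \<Longrightarrow> F l = G l) \<Longrightarrow> cobound F xs = cobound G xs"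
proof (induction xs arbitrary: F G)
  case (Cons x xs)
  have "cobound (\<lambda>l. F (x # l)) xs = cobound (\<lambda>l. G (x # l)) xs"
    by (rule Cons.IH) (use Cons.prems in auto)
  then show ?case using Cons.prems[of xs] by simp
qed simp

lemma cobound_abs_le:
  fixes C :: real
  shows "(\<And>l. Suc (length l) = length xs \<Longrightarrow> \<bar>F l\<bar> \<le> C) \<Longrightarrow> \<bar>cobound F xs\<bar> \<le> length xs * C"
proof (induction xs arbitrary: F)
  case (Cons x xs)
  have "\<bar>cobound (\<lambda>l. F (x # l)) xs\<bar> \<le> length xs * C"
    by (rule Cons.IH) (use Cons.prems in auto)
  then show ?case using Cons.prems[of xs] by (simp add: algebra_simps)
qed simp

definition delete_nth :: "nat \<Rightarrow> 'a list \<Rightarrow> 'a list" where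
  "delete_nth i xs = take i xs @ drop (Suc i) xs"

lemma delete_nth_0 [simp]: "delete_nth 0 (x # xs) = xs"
  and delete_nth_Suc [simp]: "delete_nth (Suc i) (x # xs) = x # delete_nth i xs"
  by (simp_all add: delete_nth_def)

lemma cobound_eq_sum: "cobound F xs = (\<Sum>i<length xs. (-1) ^ i * F (delete_nth i xs))"
proof (induction xs arbitrary: F)
  case (Cons x xs)
  show ?case by (simp add: Cons.IH sum.lessThan_Suc_shift sum_negf del: sum.lessThan_Suc)
qed simp

lemma (in linear_functional) cobound_commute:
  assumes "\<And>l. Suc (length l) = length gs \<Longrightarrow> V (\<lambda>x. F x l)"
  shows "cobound (\<lambda>l. \<mu> (\<lambda>x. F x l)) gs = \<mu> (\<lambda>x. cobound (F x) gs) \<and> V (\<lambda>x. cobound (F x) gs)"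
  using assms
proof (induction gs arbitrary: F)
  case Nil
  then show ?case by (simp add: zero zero_mem)
next
  case (Cons g gs)
  have "cobound (\<lambda>l. \<mu> (\<lambda>x. F x (g # l))) gs = \<mu> (\<lambda>x. cobound (\<lambda>l. F x (g # l)) gs)
      \<and> V (\<lambda>x. cobound (\<lambda>l. F x (g # l)) gs)"
    by (rule Cons.IH) (use Cons.prems in auto)
  then show ?case using Cons.prems[of gs] by (simp add: diff diff_mem)
qed

lemma bounded_cochainE:
  assumes "bounded_cochain F"
  obtains C where "C \<ge> 0" "\<And>xs. length xs = n \<Longrightarrow> \<bar>F xs\<bar> \<le> C"
proof -
  obtain C where "\<And>xs. length xs = n \<Longrightarrow> \<bar>F xs\<bar> \<le> C"
    using assms unfolding bounded_cochain_def by blast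
  then show ?thesis using that[of "\<bar>C\<bar>"] by (meson abs_ge_self abs_ge_zero order_trans)
qed

lemma bounded_cochainI: "(\<And>xs. \<bar>F xs\<bar> \<le> C (length xs)) \<Longrightarrow> bounded_cochain F"
  unfolding bounded_cochain_def by (metis (full_types))

lemma bounded_cochain_const: "bounded_cochain (\<lambda>_. c)"
  by (rule bounded_cochainI[of _ "\<lambda>_. \<bar>c\<bar>"]) simp

lemma bounded_cochain_add:
  assumes "bounded_cochain F" "bounded_cochain G" shows "bounded_cochain (\<lambda>l. F l + G l)"
  unfolding bounded_cochain_def
proof
  fix n
  obtain C where C: "\<And>xs. length xs = n \<Longrightarrow> \<bar>F xs\<bar> \<le> C"
    using assms(1) by (rule bounded_cochainE[where n = n]) blast
  obtain D where D: "\<And>xs. length xs = n \<Longrightarrow> \<bar>G xs\<bar> \<le> D"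
    using assms(2) by (rule bounded_cochainE[where n = n]) blast
  show "\<exists>C. \<forall>xs. length xs = n \<longrightarrow> \<bar>F xs + G xs\<bar> \<le> C"
    using C D by (meson abs_triangle_ineq add_mono order_trans)
qed

lemma bounded_cochain_cmult:
  assumes "bounded_cochain F" shows "bounded_cochain (\<lambda>l. c * F l)"
  unfolding bounded_cochain_def
proof
  fix n
  obtain C where "\<And>xs. length xs = n \<Longrightarrow> \<bar>F xs\<bar> \<le> C"
    using assms by (rule bounded_cochainE[where n = n]) blast
  then show "\<exists>C. \<forall>xs. length xs = n \<longrightarrow> \<bar>c * F xs\<bar> \<le> C"
    by (intro exI[of _ "\<bar>c\<bar> * C"]) (simp add: abs_mult mult_left_mono)
qed

lemma bounded_cochain_compose:
  assumes "bounded_cochain F" "\<And>xs. length (h xs) = f (length xs)"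
  shows "bounded_cochain (\<lambda>xs. F (h xs))"
  using assms unfolding bounded_cochain_def by metis

lemma bounded_cochain_Cons: "bounded_cochain F \<Longrightarrow> bounded_cochain (\<lambda>l. F (x # l))"
  by (rule bounded_cochain_compose) auto

lemma bounded_cochain_cobound:
  assumes "bounded_cochain F" shows "bounded_cochain (cobound F)"
  unfolding bounded_cochain_def
proof
  fix n
  obtain C where C: "\<And>xs. length xs = n - 1 \<Longrightarrow> \<bar>F xs\<bar> \<le> C"
    using assms by (rule bounded_cochainE[where n = "n - 1"]) blast
  then have "\<bar>cobound F xs\<bar> \<le> n * C" if "length xs = n" for xs
    using cobound_abs_le[of xs F C] that by (metis diff_Suc_1)
  then show "\<exists>C. \<forall>xs. length xs = n \<longrightarrow> \<bar>cobound F xs\<bar> \<le> C" by blast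
qed

lemma invariant_cochain_const: "invariant_cochain (\<lambda>_. c)"
  by (simp add: invariant_cochain_def translation_invariant_def bounded_cochain_const)

lemma invariant_cochain_add:
  "invariant_cochain F \<Longrightarrow> invariant_cochain G \<Longrightarrow> invariant_cochain (\<lambda>l. F l + G l)"
  by (simp add: invariant_cochain_def translation_invariant_def bounded_cochain_add)

lemma invariant_cochain_cmult: "invariant_cochain F \<Longrightarrow> invariant_cochain (\<lambda>l. c * F l)"
  by (simp add: invariant_cochain_def translation_invariant_def bounded_cochain_cmult)

lemma bounded_coboundary_cobound: "invariant_cochain B \<Longrightarrow> bounded_coboundary n (cobound B)"
  by (auto simp: bounded_coboundary_def)

lemma bounded_coboundary_cmult:
  assumes "bounded_coboundary n F" shows "bounded_coboundary n (\<lambda>xs. c * F xs)"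
proof -
  obtain B where "invariant_cochain B" "\<And>xs. length xs = n + 1 \<Longrightarrow> F xs = cobound B xs"
    using assms by (auto simp: bounded_coboundary_def)
  then show ?thesis unfolding bounded_coboundary_def
    by (intro exI[of _ "\<lambda>xs. c * B xs"]) (simp add: invariant_cochain_cmult cobound_cmult)
qed

lemma bounded_coboundary_add:
  assumes "bounded_coboundary n F" "bounded_coboundary n G"
  shows "bounded_coboundary n (\<lambda>xs. F xs + G xs)"
proof -
  obtain B where "invariant_cochain B" "\<And>xs. length xs = n + 1 \<Longrightarrow> F xs = cobound B xs"
    using assms(1) by (auto simp: bounded_coboundary_def)
  moreover obtain B' where "invariant_cochain B'" "\<And>xs. length xs = n + 1 \<Longrightarrow> G xs = cobound B' xs"
    using assms(2) by (auto simp: bounded_coboundary_def)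
  ultimately show ?thesis unfolding bounded_coboundary_def
    by (intro exI[of _ "\<lambda>xs. B xs + B' xs"]) (simp add: invariant_cochain_add cobound_add)
qed

lemma bounded_coboundary_cong:
  "(\<And>xs. length xs = n + 1 \<Longrightarrow> F xs = G xs) \<Longrightarrow> bounded_coboundary n F \<longleftrightarrow> bounded_coboundary n G"
  by (auto simp: bounded_coboundary_def)

lemma bounded_coboundary_const:
  assumes "odd n \<Longrightarrow> c = 0" shows "bounded_coboundary n (\<lambda>_. c)"
proof -
  have "c = cobound (\<lambda>_. c) xs" if "length xs = n + 1" for xs :: "'g list"
    using assms that by (simp add: cobound_const)
  then show ?thesis unfolding bounded_coboundary_def using invariant_cochain_const by blast
qed

definition additive :: "('g::group_add \<Rightarrow> 'h::group_add) \<Rightarrow> bool" where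
  "additive r \<longleftrightarrow> (\<forall>x y. r (x + y) = r x + r y)"

lemma invariant_cochain_pullback:
  assumes "additive r" "invariant_cochain F" shows "invariant_cochain (\<lambda>xs. F (map r xs))"
proof -
  have "map r (map ((+) g) xs) = map ((+) (r g)) (map r xs)" for g xs
    using assms(1) by (simp add: additive_def)
  then have "translation_invariant (\<lambda>xs. F (map r xs))"
    using assms(2) unfolding translation_invariant_def invariant_cochain_def by metis
  moreover have "bounded_cochain (\<lambda>xs. F (map r xs))"
    by (rule bounded_cochain_compose[of F]) (use assms(2) in \<open>auto simp: invariant_cochain_def\<close>)
  ultimately show ?thesis by (simp add: invariant_cochain_def)
qed

lemma bounded_cocycle_pullback:
  "additive r \<Longrightarrow> bounded_cocycle n F \<Longrightarrow> bounded_cocycle n (\<lambda>xs. F (map r xs))"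
  unfolding bounded_cocycle_def
  by (metis invariant_cochain_pullback cobound_map length_map)

lemma bounded_coboundary_pullback:
  assumes "additive r" "bounded_coboundary n F" shows "bounded_coboundary n (\<lambda>xs. F (map r xs))"
proof -
  obtain B where "invariant_cochain B" "\<And>xs. length xs = n + 1 \<Longrightarrow> F xs = cobound B xs"
    using assms(2) by (auto simp: bounded_coboundary_def)
  then show ?thesis unfolding bounded_coboundary_def
    using invariant_cochain_pullback[OF assms(1)]
    by (intro exI[of _ "\<lambda>xs. B (map r xs)"]) (auto simp flip: cobound_map)
qed

lemma not_bounded_coboundary_retract:
  assumes "additive s" "\<And>a. r (s a) = a" "\<not> bounded_coboundary n F"
  shows "\<not> bounded_coboundary n (\<lambda>xs. F (map r xs))"
proof -
  have "map r (map s xs) = xs" for xs using assms(2) by (simp add: comp_def)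
  then show ?thesis
    using bounded_coboundary_pullback[OF assms(1), of n "\<lambda>xs. F (map r xs)"] assms(3) by auto
qed

section \<open>Comparison with the inhomogeneous complex\<close>

definition additive_group :: "'g::group_add monoid" where
  "additive_group = \<lparr>carrier = UNIV, monoid.mult = (+), one = 0\<rparr>"

lemma additive_group_simps [simp]:
  "carrier additive_group = UNIV" "x \<otimes>\<^bsub>additive_group\<^esub> y = x + y" "\<one>\<^bsub>additive_group\<^esub> = 0"
  by (simp_all add: additive_group_def)

lemma group_additive_group: "group additive_group"
proof (rule groupI)
  fix x :: 'a
  show "\<exists>y\<in>carrier additive_group. y \<otimes>\<^bsub>additive_group\<^esub> x = \<one>\<^bsub>additive_group\<^esub>"
    by (rule bexI[of _ "- x"]) simp_all
qed (simp_all add: add.assoc)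

fun increments :: "'g::group_add list \<Rightarrow> 'g list" where
  "increments (x # y # l) = (- x + y) # increments (y # l)"
| "increments _ = []"

fun partial_sums :: "'g::group_add \<Rightarrow> 'g list \<Rightarrow> 'g list" where
  "partial_sums s [] = [s]"
| "partial_sums s (y # l) = s # partial_sums (s + y) l"

lemma length_increments [simp]: "length (increments xs) = length xs - 1"
  by (induction xs rule: increments.induct) auto

lemma length_partial_sums [simp]: "length (partial_sums s ys) = Suc (length ys)"
  by (induction ys arbitrary: s) auto

lemma increments_partial_sums [simp]: "increments (partial_sums s ys) = ys"
proof (induction ys arbitrary: s)
  case (Cons y l)
  obtain zs where "partial_sums (s + y) l = (s + y) # zs" by (cases l) auto
  then show ?case using Cons.IH[of "s + y"] by (simp add: add.assoc[symmetric])
qed simp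

lemma partial_sums_increments: "xs \<noteq> [] \<Longrightarrow> partial_sums (hd xs) (increments xs) = xs"
  by (induction xs rule: increments.induct) (auto simp: add.assoc[symmetric])

lemma partial_sums_translate: "partial_sums (g + s) ys = map ((+) g) (partial_sums s ys)"
  by (induction ys arbitrary: s) (auto simp: add.assoc)

lemma increments_translate: "increments (map ((+) g) xs) = increments xs"
proof (induction xs rule: increments.induct)
  case (1 x y l)
  have "- (g + x) + (g + y) = - x + y"
    by (simp only: minus_add add.assoc minus_add_cancel)
  then show ?case using 1 by simp
qed auto

lemma translation_invariant_partial_sums_increments:
  assumes "translation_invariant F" "xs \<noteq> []"
  shows "F (partial_sums 0 (increments xs)) = F xs"
proof -
  have "xs = map ((+) (hd xs)) (partial_sums 0 (increments xs))"
    using partial_sums_translate[of "hd xs" 0] partial_sums_increments[OF assms(2)] by simp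
  then show ?thesis using assms(1) unfolding translation_invariant_def by metis
qed

lemma increments_delete_last:
  "xs \<noteq> [] \<Longrightarrow> increments (delete_nth (length xs - 1) xs) = butlast (increments xs)"
proof (induction xs rule: increments.induct)
  case (1 x y l)
  then show ?case by (cases l) (auto simp: delete_nth_def)
qed (auto simp: delete_nth_def)

lemma increments_delete_middle:
  assumes "1 \<le> i" "Suc i < length xs"
  shows "increments (delete_nth i xs) = take (i - 1) (increments xs)
    @ [increments xs ! (i - 1) + increments xs ! i] @ drop (i + 1) (increments xs)"
  using assms
proof (induction xs arbitrary: i rule: increments.induct)
  case (1 x y l)
  show ?case
  proof (cases "i = 1")
    case True
    then obtain z zs where "l = z # zs" using 1 by (cases l) auto
    moreover have "- x + z = - x + y + (- y + z)" by (metis add.assoc add.right_inverse add_0)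
    ultimately show ?thesis using True by simp
  next
    case False
    then obtain k where i: "i = Suc (Suc k)" using 1 by (cases i rule: nat.exhaust; cases "i - 1") auto
    have "increments (delete_nth (Suc k) (y # l)) = take k (increments (y # l))
        @ [increments (y # l) ! k + increments (y # l) ! Suc k] @ drop (Suc (Suc k)) (increments (y # l))"
      using 1(1)[of "Suc k"] 1(3) i by simp
    then show ?thesis using i by simp
  qed
qed auto

definition homogeneous :: "('g::group_add \<Rightarrow> 'a) \<Rightarrow> ('a list \<Rightarrow> real) \<Rightarrow> 'g list \<Rightarrow> real" where
  "homogeneous \<theta> f xs = f (map \<theta> (increments xs))"

definition inhomogeneous ::
    "('g::group_add \<Rightarrow> 'a) \<Rightarrow> ('a, 'b) monoid_scheme \<Rightarrow> nat \<Rightarrow> ('g list \<Rightarrow> real) \<Rightarrow> 'a list \<Rightarrow> real" where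
  "inhomogeneous \<theta> G n F ys = (if length ys = n \<and> set ys \<subseteq> carrier G
     then F (partial_sums 0 (map (the_inv_into UNIV \<theta>) ys)) else 0)"

locale additive_iso =
  fixes \<theta> :: "'g::group_add \<Rightarrow> 'a" and G :: "('a, 'b) monoid_scheme"
  assumes iso: "\<theta> \<in> iso additive_group G"
begin

lemma bij: "bij_betw \<theta> UNIV (carrier G)"
  and add: "\<theta> (x + y) = \<theta> x \<otimes>\<^bsub>G\<^esub> \<theta> y"
  and inj: "inj \<theta>"
  using iso by (auto simp: iso_def hom_def bij_betw_def)

lemma the_inv_into_eq [simp]: "the_inv_into UNIV \<theta> (\<theta> x) = x"
  by (rule the_inv_into_f_f[OF inj]) simp

lemma map_in_carrier: "set (map \<theta> xs) \<subseteq> carrier G"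
  using bij by (auto simp: bij_betw_def)

lemma carrier_list_eq_increments:
  assumes "set ys \<subseteq> carrier G"
  obtains xs where "ys = map \<theta> (increments xs)" "length xs = length ys + 1"
proof -
  have "map \<theta> (map (the_inv_into UNIV \<theta>) ys) = ys"
    using bij assms by (auto simp: bij_betw_def f_the_inv_into_f intro!: map_idI)
  then show ?thesis using that[of "partial_sums 0 (map (the_inv_into UNIV \<theta>) ys)"] by simp
qed

lemma bcobound_increments:
  assumes len: "length xs = n + 2"
  shows "bcobound G n f (map \<theta> (increments xs)) = cobound (homogeneous \<theta> f) xs"
proof -
  let ?ys = "map \<theta> (increments xs)" and ?F = "homogeneous \<theta> f"
  obtain x y l where "xs = x # y # l" using len by (metis Suc_length_conv add_2_eq_Suc')
  then have first: "f (tl ?ys) = ?F (delete_nth 0 xs)" by (simp add: homogeneous_def)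
  have last: "f (butlast ?ys) = ?F (delete_nth (Suc n) xs)"
    using increments_delete_last[of xs] len by (cases "xs = []") (simp_all add: homogeneous_def map_butlast)
  have middle: "f (take (i - 1) ?ys @ [?ys ! (i - 1) \<otimes>\<^bsub>G\<^esub> ?ys ! i] @ drop (i + 1) ?ys)
      = ?F (delete_nth i xs)" if "i \<in> {1..n}" for i
  proof -
    have "1 \<le> i" "Suc i < length xs" using that len by auto
    then show ?thesis
      unfolding homogeneous_def increments_delete_middle[OF \<open>1 \<le> i\<close> \<open>Suc i < length xs\<close>]
      by (simp add: take_map drop_map add)
  qed
  have "{..<n + 2} = insert 0 (insert (Suc n) {1..n})" by auto
  then have "cobound ?F xs = ?F (delete_nth 0 xs) + (\<Sum>i=1..n. (-1) ^ i * ?F (delete_nth i xs))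
      + (-1) ^ Suc n * ?F (delete_nth (Suc n) xs)"
    using len by (simp add: cobound_eq_sum)
  then show ?thesis
    unfolding bcobound_def using len map_in_carrier first last middle by (auto intro!: sum.cong)
qed

lemma invariant_cochain_homogeneous:
  assumes "f \<in> bcochain G n" shows "invariant_cochain (homogeneous \<theta> f)"
proof -
  obtain C where "\<And>ys. \<bar>f ys\<bar> \<le> C" using assms by (auto simp: bcochain_def)
  then have "bounded_cochain (homogeneous \<theta> f)"
    by (intro bounded_cochainI[of _ "\<lambda>_. C"]) (simp add: homogeneous_def)
  then show ?thesis
    by (simp add: invariant_cochain_def translation_invariant_def homogeneous_def increments_translate)
qed

lemma inhomogeneous_in_bcochain:
  assumes "bounded_cochain F" shows "inhomogeneous \<theta> G n F \<in> bcochain G n"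
proof -
  obtain C where "C \<ge> 0" "\<And>xs. length xs = Suc n \<Longrightarrow> \<bar>F xs\<bar> \<le> C"
    using assms by (rule bounded_cochainE[where n = "Suc n"]) blast
  then show ?thesis by (auto simp: bcochain_def inhomogeneous_def intro!: exI[of _ C])
qed

lemma homogeneous_inhomogeneous:
  assumes "translation_invariant F" "length xs = n + 1"
  shows "homogeneous \<theta> (inhomogeneous \<theta> G n F) xs = F xs"
proof -
  have "xs \<noteq> []" using assms(2) by auto
  then show ?thesis
    using translation_invariant_partial_sums_increments[OF assms(1)] assms(2) map_in_carrier
    by (simp add: homogeneous_def inhomogeneous_def comp_def)
qed

lemma bcobound_inhomogeneous:
  assumes "translation_invariant F" "length xs = n + 2"
  shows "bcobound G n (inhomogeneous \<theta> G n F) (map \<theta> (increments xs)) = cobound F xs"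
  unfolding bcobound_increments[OF assms(2)]
  by (rule cobound_cong) (use assms homogeneous_inhomogeneous in auto)

lemma bounded_cocycle_homogeneous:
  assumes "f \<in> bcocycles G n" shows "bounded_cocycle n (homogeneous \<theta> f)"
  using assms invariant_cochain_homogeneous bcobound_increments[of _ n f]
  by (auto simp: bcocycles_def bounded_cocycle_def)

lemma inhomogeneous_in_bcocycles:
  assumes F: "bounded_cocycle n F" shows "inhomogeneous \<theta> G n F \<in> bcocycles G n"
proof -
  have inv: "translation_invariant F" "bounded_cochain F"
    using F by (auto simp: bounded_cocycle_def invariant_cochain_def)
  have "bcobound G n (inhomogeneous \<theta> G n F) ys = 0" for ys
  proof (cases "length ys = Suc n \<and> set ys \<subseteq> carrier G")
    case True
    then obtain xs where "ys = map \<theta> (increments xs)" "length xs = n + 2"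
      using carrier_list_eq_increments[of ys] by (metis Suc_eq_plus1 add_2_eq_Suc')
    then show ?thesis using bcobound_inhomogeneous[OF inv(1)] F by (simp add: bounded_cocycle_def)
  qed (auto simp: bcobound_def)
  then show ?thesis using inhomogeneous_in_bcochain[OF inv(2)] by (auto simp: bcocycles_def)
qed

lemma bcoboundaries_iff_homogeneous:
  assumes f: "f \<in> bcochain G (Suc m)"
  shows "f \<in> bcoboundaries G (Suc m) \<longleftrightarrow> bounded_coboundary (Suc m) (homogeneous \<theta> f)"
proof
  assume "f \<in> bcoboundaries G (Suc m)"
  then obtain b where b: "b \<in> bcochain G m" "f = bcobound G m b" by (auto simp: bcoboundaries_def)
  then have "homogeneous \<theta> f xs = cobound (homogeneous \<theta> b) xs" if "length xs = Suc m + 1" for xs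
    using bcobound_increments[of xs m b] that by (simp add: homogeneous_def)
  then show "bounded_coboundary (Suc m) (homogeneous \<theta> f)"
    unfolding bounded_coboundary_def using invariant_cochain_homogeneous[OF b(1)] by blast
next
  assume "bounded_coboundary (Suc m) (homogeneous \<theta> f)"
  then obtain B where B: "translation_invariant B" "bounded_cochain B"
    "\<And>xs. length xs = Suc m + 1 \<Longrightarrow> homogeneous \<theta> f xs = cobound B xs"
    by (auto simp: bounded_coboundary_def invariant_cochain_def)
  have "f ys = bcobound G m (inhomogeneous \<theta> G m B) ys" for ys
  proof (cases "length ys = Suc m \<and> set ys \<subseteq> carrier G")
    case True
    then obtain xs where "ys = map \<theta> (increments xs)" "length xs = m + 2"
      using carrier_list_eq_increments[of ys] by (metis Suc_eq_plus1 add_2_eq_Suc')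
    then show ?thesis using bcobound_inhomogeneous[OF B(1)] B(3)[of xs] by (simp add: homogeneous_def)
  next
    case False
    then have "f ys = 0" using f by (auto simp: bcochain_def)
    then show ?thesis using False by (auto simp: bcobound_def)
  qed
  then have "f = bcobound G m (inhomogeneous \<theta> G m B)" by auto
  then show "f \<in> bcoboundaries G (Suc m)"
    using inhomogeneous_in_bcochain[OF B(2)] by (auto simp: bcoboundaries_def)
qed

lemma boundedly_acyclicI:
  assumes "group G" and acyclic: "\<And>n F. n \<ge> 1 \<Longrightarrow> bounded_cocycle n F
    \<Longrightarrow> bounded_coboundary n (F :: 'g list \<Rightarrow> real)"
  shows "boundedly_acyclic G"
  unfolding boundedly_acyclic_def bcoh_vanishes_def
proof (intro conjI allI impI subsetI)
  fix n f assume n: "1 \<le> n" and f: "f \<in> bcocycles G n"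
  then obtain m where m: "n = Suc m" by (cases n) auto
  have "f \<in> bcochain G (Suc m)" using f m by (auto simp: bcocycles_def)
  then show "f \<in> bcoboundaries G n"
    using bcoboundaries_iff_homogeneous acyclic[OF n bounded_cocycle_homogeneous[OF f]] m by blast
qed fact

end

section \<open>Iterated means\<close>

primrec imean :: "(('g::group_add \<Rightarrow> real) \<Rightarrow> real) \<Rightarrow> 'g list \<Rightarrow> ('g list \<Rightarrow> real) \<Rightarrow> real" where
  "imean m [] F = F []"
| "imean m (g # gs) F = m (\<lambda>x. imean m gs (\<lambda>l. F ((g + x) # l)))"

lemma imean_cong:
  "(\<And>l. length l = length gs \<Longrightarrow> F l = G l) \<Longrightarrow> imean m gs F = imean m gs G"
proof (induction gs arbitrary: F G)
  case (Cons g gs)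
  have "imean m gs (\<lambda>l. F ((g + x) # l)) = imean m gs (\<lambda>l. G ((g + x) # l))" for x
    by (rule Cons.IH) (use Cons.prems in auto)
  then show ?case by simp
qed simp

lemma imean_translate: "imean m (map ((+) g) gs) F = imean m gs (\<lambda>l. F (map ((+) g) l))"
  by (induction gs arbitrary: F) (auto simp: add.assoc)

lemma imean_invariant: "translation_invariant F \<Longrightarrow> imean m (map ((+) g) gs) F = imean m gs F"
  by (simp add: imean_translate translation_invariant_def)

locale group_mean = mean m for m :: "('g::group_add \<Rightarrow> real) \<Rightarrow> real"
begin

lemma imean_abs_le:
  "(\<And>l. length l = length gs \<Longrightarrow> \<bar>F l\<bar> \<le> C) \<Longrightarrow> \<bar>imean m gs F\<bar> \<le> C"
proof (induction gs arbitrary: F)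
  case (Cons g gs)
  have "\<bar>imean m gs (\<lambda>l. F ((g + x) # l))\<bar> \<le> C" for x
    by (rule Cons.IH) (use Cons.prems in auto)
  then show ?case by (simp add: abs_le)
qed simp

lemma imean_const: "imean m gs (\<lambda>_. c) = c"
  by (induction gs) (auto simp: const)

lemma bounded_fun_imean:
  assumes "bounded_cochain F" shows "bounded_fun (\<lambda>x. imean m gs (\<lambda>l. F (h x # l)))"
proof -
  obtain C where C: "\<And>l. length l = Suc (length gs) \<Longrightarrow> \<bar>F l\<bar> \<le> C"
    using assms by (rule bounded_cochainE[where n = "Suc (length gs)"]) blast
  show ?thesis by (intro bounded_funI[of _ C] imean_abs_le) (simp add: C)
qed

sublocale imean: linear_functional bounded_cochain "imean m gs" for gs
proof
  show "imean m gs (\<lambda>l. F l + G l) = imean m gs F + imean m gs G"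
    if "bounded_cochain F" "bounded_cochain G" for F G
    using that
  proof (induction gs arbitrary: F G)
    case (Cons g gs)
    then show ?case by (simp add: bounded_cochain_Cons add bounded_fun_imean)
  qed simp
  show "imean m gs (\<lambda>l. c * F l) = c * imean m gs F" if "bounded_cochain F" for F c
    using that
  proof (induction gs arbitrary: F)
    case (Cons g gs)
    then show ?case by (simp add: bounded_cochain_Cons cmult bounded_fun_imean)
  qed simp
qed (simp_all add: bounded_cochain_const bounded_cochain_add bounded_cochain_cmult)

lemma imean_right_translate:
  assumes "\<And>b f. b \<in> B \<Longrightarrow> bounded_fun f \<Longrightarrow> m (\<lambda>x. f (b + x)) = m f"
    and "length gs = length bs" "set bs \<subseteq> B" "bounded_cochain F"
  shows "imean m (map2 (+) gs bs) F = imean m gs F"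
  using assms(2-4)
proof (induction gs bs arbitrary: F rule: list_induct2)
  case (Cons g gs b bs)
  have "imean m (map2 (+) gs bs) (\<lambda>l. F (z # l)) = imean m gs (\<lambda>l. F (z # l))" for z
    by (rule Cons.IH) (use Cons.prems bounded_cochain_Cons in auto)
  moreover have "m (\<lambda>x. imean m gs (\<lambda>l. F ((g + (b + x)) # l))) = m (\<lambda>x. imean m gs (\<lambda>l. F ((g + x) # l)))"
    by (rule assms(1)[of b]) (use Cons.prems bounded_fun_imean in auto)
  ultimately show ?case by (simp add: add.assoc)
qed simp

lemma imean_cobound:
  assumes "bounded_cochain F"
  shows "imean m gs (cobound F) = cobound (\<lambda>l. imean m l F) gs"
  using assms
proof (induction gs arbitrary: F)
  case (Cons g gs)
  let ?F = "\<lambda>x l. F ((g + x) # l)"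
  have F: "bounded_cochain (?F x)" for x by (rule bounded_cochain_Cons[OF Cons.prems])
  have "bounded_fun (\<lambda>x. imean m l (?F x))" for l by (rule bounded_fun_imean[OF Cons.prems])
  then have swap: "cobound (\<lambda>l. m (\<lambda>x. imean m l (?F x))) gs = m (\<lambda>x. cobound (\<lambda>l. imean m l (?F x)) gs)"
    and bounded: "bounded_fun (\<lambda>x. cobound (\<lambda>l. imean m l (?F x)) gs)"
    using cobound_commute[of gs "\<lambda>x l. imean m l (?F x)"] by auto
  have "imean m gs (\<lambda>l. F l - cobound (?F x) l) = imean m gs F - cobound (\<lambda>l. imean m l (?F x)) gs" for x
    using imean.diff[OF Cons.prems bounded_cochain_cobound[OF F]] Cons.IH[OF F] by simp
  then have "imean m (g # gs) (cobound F) = m (\<lambda>x. imean m gs F - cobound (\<lambda>l. imean m l (?F x)) gs)"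
    by simp
  also have "\<dots> = imean m gs F - m (\<lambda>x. cobound (\<lambda>l. imean m l (?F x)) gs)"
    using diff[OF bounded_fun_const bounded] by (simp add: const)
  finally show ?case by (simp add: swap)
qed simp

end

section \<open>Asymptotically invariant means kill bounded cohomology\<close>

text \<open>The prism operator is the chain homotopy between the identity and the iterated mean: its summands
  average \<open>F(g\<^sub>0, \<dots>, g\<^sub>i, g\<^sub>ix\<^sub>i, \<dots>, g\<^sub>nx\<^sub>n)\<close> over \<open>x\<^sub>i, \<dots>, x\<^sub>n\<close>.\<close>

fun prism :: "(('g::group_add \<Rightarrow> real) \<Rightarrow> real) \<Rightarrow> ('g list \<Rightarrow> real) \<Rightarrow> 'g list \<Rightarrow> real" where
  "prism m F [] = 0"
| "prism m F (g # gs) = imean m (g # gs) (\<lambda>l. F (g # l)) - prism m (\<lambda>l. F (g # l)) gs"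

lemma prism_cong:
  "(\<And>l. length l = Suc (length gs) \<Longrightarrow> F l = G l) \<Longrightarrow> prism m F gs = prism m G gs"
proof (induction gs arbitrary: F G)
  case (Cons g gs)
  have "imean m (g # gs) (\<lambda>l. F (g # l)) = imean m (g # gs) (\<lambda>l. G (g # l))"
    by (rule imean_cong) (use Cons.prems in auto)
  moreover have "prism m (\<lambda>l. F (g # l)) gs = prism m (\<lambda>l. G (g # l)) gs"
    by (rule Cons.IH) (use Cons.prems in auto)
  ultimately show ?case by simp
qed simp

lemma prism_translate: "prism m F (map ((+) g) gs) = prism m (\<lambda>l. F (map ((+) g) l)) gs"
proof (induction gs arbitrary: F)
  case (Cons h gs)
  have "imean m (map ((+) g) (h # gs)) (\<lambda>l. F ((g + h) # l))
      = imean m (h # gs) (\<lambda>l. F ((g + h) # map ((+) g) l))"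
    by (rule imean_translate)
  then show ?case using Cons.IH by simp
qed simp

context group_mean
begin

lemma prism_abs_le:
  "(\<And>l. length l = Suc (length gs) \<Longrightarrow> \<bar>F l\<bar> \<le> C) \<Longrightarrow> \<bar>prism m F gs\<bar> \<le> real (length gs) * C"
proof (induction gs arbitrary: F)
  case (Cons g gs)
  have "\<bar>prism m (\<lambda>l. F (g # l)) gs\<bar> \<le> length gs * C"
    by (rule Cons.IH) (use Cons.prems in auto)
  moreover have "\<bar>imean m (g # gs) (\<lambda>l. F (g # l))\<bar> \<le> C"
    by (rule imean_abs_le) (use Cons.prems in auto)
  ultimately show ?case by (simp add: algebra_simps)
qed simp

lemma prism_diff:
  "bounded_cochain F \<Longrightarrow> bounded_cochain G \<Longrightarrow> prism m (\<lambda>l. F l - G l) gs = prism m F gs - prism m G gs"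
proof (induction gs arbitrary: F G)
  case (Cons g gs)
  then show ?case
    using imean.diff[of "\<lambda>l. F (g # l)" "\<lambda>l. G (g # l)" "g # gs"] by (simp add: bounded_cochain_Cons)
qed simp

lemma prism_homotopy:
  "bounded_cochain F \<Longrightarrow> prism m (cobound F) gs + cobound (prism m F) gs = imean m gs F - F gs"
proof (induction gs arbitrary: F)
  case (Cons g gs)
  let ?F = "\<lambda>l. F (g # l)"
  have F: "bounded_cochain ?F" "bounded_cochain (cobound ?F)"
    by (intro bounded_cochain_cobound bounded_cochain_Cons Cons.prems)+
  have "prism m (cobound F) (g # gs)
      = imean m (g # gs) (\<lambda>l. F l - cobound ?F l) - prism m (\<lambda>l. F l - cobound ?F l) gs"
    by simp
  also have "\<dots> = (imean m (g # gs) F - imean m (g # gs) (cobound ?F))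
    - (prism m F gs - prism m (cobound ?F) gs)"
    by (simp only: imean.diff[OF Cons.prems F(2)] prism_diff[OF Cons.prems F(2)])
  finally have prism_part: "prism m (cobound F) (g # gs) = \<dots>" .
  have "cobound (prism m F) (g # gs)
      = prism m F gs - cobound (\<lambda>l. imean m (g # l) ?F) gs + cobound (prism m ?F) gs"
    by (simp add: cobound_diff)
  moreover have "imean m (g # gs) (cobound ?F) = imean m gs ?F - cobound (\<lambda>l. imean m (g # l) ?F) gs"
    using imean_cobound[OF F(1), of "g # gs"] by simp
  moreover have "prism m (cobound ?F) gs + cobound (prism m ?F) gs = imean m gs ?F - F (g # gs)"
    by (rule Cons.IH[OF F(1)])
  ultimately show ?case using prism_part by linarith
qed simp

end

text \<open>Asymptotic invariance is only required on invariant cochains, hence is weaker than amenability.\<close>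

locale asymptotically_invariant_means =
  fixes E :: "nat \<Rightarrow> ('g::group_add \<Rightarrow> real) \<Rightarrow> real"
  assumes mean: "group_mean (E k)"
    and asymptotically_invariant: "\<And>F gs. invariant_cochain F \<Longrightarrow>
      (\<lambda>k. imean (E k) gs F - imean (E k) (replicate (length gs) 0) F) \<longlonglongrightarrow> 0"
begin

interpretation E: group_mean "E k" for k
  by (rule mean)

definition limit_mean :: "'g list \<Rightarrow> ('g list \<Rightarrow> real) \<Rightarrow> real" where
  "limit_mean gs F = generalized_limit (\<lambda>k. imean (E k) gs F)"

lemma bounded_fun_imean: assumes "bounded_cochain F" shows "bounded_fun (\<lambda>k. imean (E k) gs F)"
proof -
  obtain C where "\<And>l. length l = length gs \<Longrightarrow> \<bar>F l\<bar> \<le> C"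
    using assms by (rule bounded_cochainE[where n = "length gs"]) blast
  then show ?thesis by (intro bounded_funI[of _ C] E.imean_abs_le)
qed

lemma limit_mean_eq_replicate:
  assumes "invariant_cochain F" shows "limit_mean gs F = limit_mean (replicate (length gs) 0) F"
proof -
  have "bounded_fun (\<lambda>k. imean (E k) hs F)" for hs
    using assms bounded_fun_imean by (simp add: invariant_cochain_def)
  then have "limit_mean gs F - limit_mean (replicate (length gs) 0) F
      = generalized_limit (\<lambda>k. imean (E k) gs F - imean (E k) (replicate (length gs) 0) F)"
    by (simp add: limit_mean_def generalized_limit.diff)
  also have "\<dots> = 0" by (rule generalized_limit_eq[OF asymptotically_invariant[OF assms]])
  finally show ?thesis by simp
qed

lemma limit_mean_cocycle_odd:
  assumes F: "bounded_cocycle n F" and "odd n"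
  shows "limit_mean (replicate (n + 1) 0) F = 0"
proof -
  have inv: "invariant_cochain F" and bounded: "bounded_cochain F"
    using F by (auto simp: bounded_cocycle_def invariant_cochain_def)
  obtain zs :: "'g list" where zs: "length zs = n + 2" by (rule that[of "replicate (n + 2) 0"]) simp
  have "imean (E k) zs (cobound F) = 0" for k
    using imean_cong[of zs "cobound F" "\<lambda>_. 0" "E k"] F zs
    by (simp add: bounded_cocycle_def E.imean_const)
  then have "cobound (\<lambda>l. imean (E k) l F) zs = 0" for k
    by (simp only: E.imean_cobound[OF bounded])
  then have "cobound (\<lambda>l. limit_mean l F) zs = 0"
    using generalized_limit.cobound_commute[of zs "\<lambda>k l. imean (E k) l F"] bounded_fun_imean[OF bounded]
    by (simp add: limit_mean_def generalized_limit.const)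
  moreover have "cobound (\<lambda>l. limit_mean l F) zs = cobound (\<lambda>_. limit_mean (replicate (n + 1) 0) F) zs"
  proof (rule cobound_cong)
    fix l :: "'g list" assume "Suc (length l) = length zs"
    then show "limit_mean l F = limit_mean (replicate (n + 1) 0) F"
      using limit_mean_eq_replicate[OF inv, of l] zs by simp
  qed
  ultimately show ?thesis using \<open>odd n\<close> zs by (simp add: cobound_const)
qed

definition limit_prism :: "('g list \<Rightarrow> real) \<Rightarrow> 'g list \<Rightarrow> real" where
  "limit_prism F gs = generalized_limit (\<lambda>k. prism (E k) F gs)"

lemma bounded_fun_prism: assumes "bounded_cochain F" shows "bounded_fun (\<lambda>k. prism (E k) F gs)"
proof -
  obtain C where "\<And>l. length l = Suc (length gs) \<Longrightarrow> \<bar>F l\<bar> \<le> C"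
    using assms by (rule bounded_cochainE[where n = "Suc (length gs)"]) blast
  then show ?thesis by (intro bounded_funI[of _ "length gs * C"] E.prism_abs_le)
qed

lemma invariant_cochain_limit_prism:
  assumes "invariant_cochain F" shows "invariant_cochain (limit_prism F)"
  unfolding invariant_cochain_def bounded_cochain_def
proof (intro conjI allI)
  show "translation_invariant (limit_prism F)"
    using assms
    by (simp add: invariant_cochain_def translation_invariant_def limit_prism_def prism_translate)
  fix n
  have "bounded_cochain F" using assms by (simp add: invariant_cochain_def)
  then obtain C where C: "\<And>l. length l = Suc n \<Longrightarrow> \<bar>F l\<bar> \<le> C"
    by (rule bounded_cochainE[where n = "Suc n"]) blast
  have "\<bar>limit_prism F gs\<bar> \<le> n * C" if "length gs = n" for gs
    unfolding limit_prism_def using E.prism_abs_le[of gs F C] C that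
    by (intro generalized_limit.abs_le) simp
  then show "\<exists>C. \<forall>gs. length gs = n \<longrightarrow> \<bar>limit_prism F gs\<bar> \<le> C" by blast
qed

lemma cobound_limit_prism:
  assumes F: "bounded_cocycle n F" and len: "length gs = n + 1"
  shows "cobound (limit_prism F) gs = limit_mean (replicate (n + 1) 0) F - F gs"
proof -
  have inv: "invariant_cochain F" and bounded: "bounded_cochain F"
    using F by (auto simp: bounded_cocycle_def invariant_cochain_def)
  have "cobound (prism (E k) F) gs = imean (E k) gs F - F gs" for k
  proof -
    have "prism (E k) (cobound F) gs = prism (E k) (\<lambda>_. 0) gs"
      by (rule prism_cong) (use len F in \<open>auto simp: bounded_cocycle_def\<close>)
    moreover have "prism (E k) (\<lambda>_. 0) gs = 0" using E.prism_abs_le[of gs "\<lambda>_. 0" 0] by simp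
    ultimately show ?thesis using E.prism_homotopy[OF bounded, of k gs] by simp
  qed
  moreover have "cobound (limit_prism F) gs = generalized_limit (\<lambda>k. cobound (prism (E k) F) gs)"
    unfolding limit_prism_def
    using generalized_limit.cobound_commute[of gs "\<lambda>k. prism (E k) F"] bounded_fun_prism[OF bounded]
    by simp
  ultimately have "cobound (limit_prism F) gs = limit_mean gs F - F gs"
    using generalized_limit.diff[OF bounded_fun_imean[OF bounded] bounded_fun_const]
    by (simp add: limit_mean_def generalized_limit.const)
  then show ?thesis using limit_mean_eq_replicate[OF inv, of gs] len by (simp only:)
qed

theorem bounded_coboundary_of_cocycle:
  fixes F :: "'g list \<Rightarrow> real"
  assumes F: "bounded_cocycle n F" shows "bounded_coboundary n F"
proof -
  let ?\<kappa> = "limit_mean (replicate (n + 1) 0) F"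
  have inv: "invariant_cochain F" using F by (simp add: bounded_cocycle_def)
  have "bounded_coboundary n (\<lambda>gs. ?\<kappa> + -1 * cobound (limit_prism F) gs)"
    by (intro bounded_coboundary_add bounded_coboundary_const bounded_coboundary_cmult
        bounded_coboundary_cobound invariant_cochain_limit_prism[OF inv] limit_mean_cocycle_odd[OF F])
  then show ?thesis
    by (rule bounded_coboundary_cong[THEN iffD1, rotated]) (simp only: cobound_limit_prism[OF F], simp)
qed

end

section \<open>Finitary permutations, finitely supported functions and their wreath product\<close>

text \<open>The library writes the group of finitary permutations multiplicatively.\<close>

instantiation Perm.perm :: (type) group_add
begin

definition zero_perm :: "'a perm" where "zero_perm = 1"
definition plus_perm :: "'a perm \<Rightarrow> 'a perm \<Rightarrow> 'a perm" where "plus_perm = (*)"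
definition uminus_perm :: "'a perm \<Rightarrow> 'a perm" where "uminus_perm = inverse"
definition minus_perm :: "'a perm \<Rightarrow> 'a perm \<Rightarrow> 'a perm" where "minus_perm s t = s * inverse t"

instance
  by standard
    (simp_all add: zero_perm_def plus_perm_def uminus_perm_def minus_perm_def mult.assoc)

end

lemma apply_zero [simp]: "apply 0 x = x"
  and apply_plus [simp]: "apply (s + t) x = apply s (apply t x)"
  by (simp_all add: zero_perm_def plus_perm_def apply_times)

lemma apply_minus_cancel [simp]: "apply (- s) (apply s x) = x" "apply s (apply (- s) x) = x"
  by (metis apply_plus apply_zero left_minus, metis apply_plus apply_zero right_minus)

lemma apply_minus_plus: "apply (- (s + t)) x = apply (- t) (apply (- s) x)"
  by (metis minus_add apply_plus)

lemma minus_swap [simp]: "- Perm.swap i j = Perm.swap i j"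
  by (simp add: uminus_perm_def)

definition perms_below :: "nat \<Rightarrow> nat perm set" where
  "perms_below k = {s. affected s \<subseteq> {..<k}}"

lemma perms_below_permutes: "s \<in> perms_below k \<Longrightarrow> apply s permutes {..<k}"
  unfolding permutes_def perms_below_def using bij_apply[of s] by (auto simp: in_affected bij_iff)

lemma apply_perms_below_less: "s \<in> perms_below k \<Longrightarrow> apply s j < k \<longleftrightarrow> j < k"
  using permutes_in_image[OF perms_below_permutes, of s k j] by simp

lemma zero_in_perms_below: "0 \<in> perms_below k"
  by (simp add: perms_below_def zero_perm_def)

lemma plus_in_perms_below: "s \<in> perms_below k \<Longrightarrow> t \<in> perms_below k \<Longrightarrow> s + t \<in> perms_below k"
  unfolding perms_below_def plus_perm_def using affected_times[of s t] by blast

lemma uminus_in_perms_below: "s \<in> perms_below k \<Longrightarrow> - s \<in> perms_below k"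
  by (simp add: perms_below_def uminus_perm_def)

lemma swap_in_perms_below: "i < k \<Longrightarrow> j < k \<Longrightarrow> Perm.swap i j \<in> perms_below k"
  by (cases "i = j") (auto simp: perms_below_def affected_swap)

lemma finite_perms_below: "finite (perms_below k)"
proof (rule finite_imageD)
  show "finite (apply ` perms_below k)"
    by (rule finite_subset[OF _ finite_permutations[of "{..<k}"]]) (auto intro: perms_below_permutes)
  show "inj_on apply (perms_below k)" by (simp add: inj_on_def apply_inject)
qed

lemma eventually_in_perms_below: "eventually (\<lambda>k. s \<in> perms_below k) sequentially"
proof -
  obtain k where "affected s \<subseteq> {..<k}" using finite_nat_bounded[OF finite_affected] by blast
  then have "s \<in> perms_below k'" if "k' \<ge> k" for k' using that by (force simp: perms_below_def)
  then show ?thesis unfolding eventually_sequentially by blast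
qed

typedef (overloaded) 'g lamps = "{x :: nat \<Rightarrow> 'g::group_add. finite {j. x j \<noteq> 0}}"
  morphisms lamp Abs_lamps
  by (rule exI[of _ "\<lambda>_. 0"]) simp

setup_lifting type_definition_lamps

instantiation lamps :: (group_add) group_add
begin

lift_definition zero_lamps :: "'a lamps" is "\<lambda>_. 0" by simp

lift_definition plus_lamps :: "'a lamps \<Rightarrow> 'a lamps \<Rightarrow> 'a lamps" is "\<lambda>x y j. x j + y j"
proof -
  fix x y :: "nat \<Rightarrow> 'a" assume "finite {j. x j \<noteq> 0}" "finite {j. y j \<noteq> 0}"
  moreover have "{j. x j + y j \<noteq> 0} \<subseteq> {j. x j \<noteq> 0} \<union> {j. y j \<noteq> 0}" by auto
  ultimately show "finite {j. x j + y j \<noteq> 0}" by (meson finite_UnI finite_subset)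
qed

lift_definition uminus_lamps :: "'a lamps \<Rightarrow> 'a lamps" is "\<lambda>x j. - x j" by simp

definition minus_lamps :: "'a lamps \<Rightarrow> 'a lamps \<Rightarrow> 'a lamps" where "minus_lamps x y = x + (- y)"

instance
proof
  fix x y z :: "'a lamps"
  show "x + y + z = x + (y + z)" by transfer (simp add: add.assoc)
  show "0 + x = x" "x + 0 = x" "- x + x = 0" by (transfer, simp)+
  show "x + - y = x - y" by (simp add: minus_lamps_def)
qed

end

lemma lamp_0 [simp]: "lamp 0 j = 0"
  and lamp_plus [simp]: "lamp (x + y) j = lamp x j + lamp y j"
  and lamp_uminus [simp]: "lamp (- x) j = - lamp x j"
  by (transfer, simp)+

lemma lamps_eqI: "(\<And>j. lamp x j = lamp y j) \<Longrightarrow> x = y"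
  by (metis ext lamp_inject)

lemma finite_lamp: "finite {j. lamp x j \<noteq> 0}"
  using lamp[of x] by simp

lemma lamp_Abs_lamps: "finite {j. x j \<noteq> 0} \<Longrightarrow> lamp (Abs_lamps x) = x"
  by (simp add: Abs_lamps_inverse)

lift_definition single :: "nat \<Rightarrow> 'g::group_add \<Rightarrow> 'g lamps" is "\<lambda>i h j. if j = i then h else 0"
  by simp

lemma lamp_single: "lamp (single i h) j = (if j = i then h else 0)"
  by transfer simp

lift_definition permute :: "nat perm \<Rightarrow> 'g::group_add lamps \<Rightarrow> 'g lamps" is "\<lambda>s x j. x (apply (- s) j)"
proof -
  fix s and x :: "nat \<Rightarrow> 'g" assume "finite {j. x j \<noteq> 0}"
  moreover have "{j. x (apply (- s) j) \<noteq> 0} \<subseteq> apply s ` {j. x j \<noteq> 0}"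
  proof
    fix j assume "j \<in> {j. x (apply (- s) j) \<noteq> 0}"
    then show "j \<in> apply s ` {j. x j \<noteq> 0}" by (intro image_eqI[of _ _ "apply (- s) j"]) simp_all
  qed
  ultimately show "finite {j. x (apply (- s) j) \<noteq> 0}" by (meson finite_imageI finite_subset)
qed

lemma lamp_permute [simp]: "lamp (permute s x) j = lamp x (apply (- s) j)"
  by transfer simp

lemma permute_simps [simp]: "permute 0 x = x" "permute s 0 = 0"
  by (auto intro: lamps_eqI)

context notes [[typedef_overloaded]]
begin

datatype (dead 'g::group_add) wreath = Wreath (lamps_of: "'g lamps") (perm_of: "nat perm")

end

instantiation wreath :: (group_add) group_add
begin

definition zero_wreath :: "'a wreath" where "zero_wreath = Wreath 0 0"

definition plus_wreath :: "'a wreath \<Rightarrow> 'a wreath \<Rightarrow> 'a wreath" where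
  "plus_wreath v w = Wreath (lamps_of v + permute (perm_of v) (lamps_of w)) (perm_of v + perm_of w)"

definition uminus_wreath :: "'a wreath \<Rightarrow> 'a wreath" where
  "uminus_wreath v = Wreath (permute (- perm_of v) (- lamps_of v)) (- perm_of v)"

definition minus_wreath :: "'a wreath \<Rightarrow> 'a wreath \<Rightarrow> 'a wreath" where "minus_wreath v w = v + (- w)"

instance
proof
  fix u v w :: "'a wreath"
  have "permute (s + t) x = permute s (permute t x)" "permute s (x + y) = permute s x + permute s y"
    for s t and x y :: "'a lamps"
    by (auto intro: lamps_eqI simp: apply_minus_plus)
  then show "u + v + w = u + (v + w)" by (simp add: plus_wreath_def add.assoc)
  show "0 + u = u" "u + 0 = u" by (simp_all add: plus_wreath_def zero_wreath_def)
  have "permute (- perm_of u) (- lamps_of u) + permute (- perm_of u) (lamps_of u) = 0"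
    by (rule lamps_eqI) simp
  then show "- u + u = 0" by (simp add: plus_wreath_def zero_wreath_def uminus_wreath_def)
  show "u + - v = u - v" by (simp add: minus_wreath_def)
qed

end

lemma Wreath_plus: "Wreath x s + Wreath y t = Wreath (x + permute s y) (s + t)"
  by (simp add: plus_wreath_def)

abbreviation base :: "'g::group_add lamps \<Rightarrow> 'g wreath" where
  "base x \<equiv> Wreath x 0"

lemma additive_base: "additive base"
  by (simp add: additive_def Wreath_plus)

lemma additive_perm_of: "additive perm_of"
  by (simp add: additive_def plus_wreath_def)

lemma wreath_eq_base_plus: "w = base (lamps_of w) + Wreath 0 (perm_of w)"
  by (simp add: Wreath_plus)

section \<open>Random elements of the wreath product\<close>

text \<open>A word is a length together with a sequence of letters, of which only the first few are read.\<close>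

type_synonym word = "nat \<times> (nat \<Rightarrow> nat)"

primrec eval_letters :: "(nat \<Rightarrow> 'g::group_add) \<Rightarrow> (nat \<Rightarrow> nat) \<Rightarrow> nat \<Rightarrow> 'g" where
  "eval_letters \<nu> c 0 = 0"
| "eval_letters \<nu> c (Suc r) = \<nu> (c r) + eval_letters \<nu> c r"

definition eval_word :: "(nat \<Rightarrow> 'g::group_add) \<Rightarrow> word \<Rightarrow> 'g" where
  "eval_word \<nu> w = eval_letters \<nu> (snd w) (fst w)"

definition letters :: "nat \<Rightarrow> (nat \<Rightarrow> nat) set" where
  "letters l = {..<l} \<rightarrow>\<^sub>E {..<l}"

definition words :: "nat \<Rightarrow> word set" where
  "words l = {..<l} \<times> letters l"

text \<open>Prepending the letter \<open>i\<close> to a uniformly random word of length less than \<open>l\<close> amounts, up to an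
  error \<open>1/l\<close>, to weighting the random word with this density.\<close>

definition letter_density :: "nat \<Rightarrow> nat \<Rightarrow> word \<Rightarrow> real" where
  "letter_density l i w = (if fst w \<ge> 1 \<and> snd w (fst w - 1) = i then real l else 0)"

lemma eval_letters_upd: "r \<le> i \<Longrightarrow> eval_letters \<nu> (c(i := a)) r = eval_letters \<nu> c r"
  by (induction r) auto

lemma letters_finite_nonempty [simp]: "finite (letters l)" "letters l \<noteq> {}"
  by (auto simp: letters_def intro: finite_PiE) (auto simp: PiE_eq_empty_iff)

lemma words_finite_nonempty: assumes "l \<ge> 1" shows "finite (words l)" "words l \<noteq> {}"
  using assms by (auto simp: words_def lessThan_empty_iff)

lemma avg_words: "avg (words l) f = (\<Sum>r<l. avg (letters l) (\<lambda>c. f (r, c))) / l"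
  by (simp add: words_def avg_Times avg_def[of "{..<l}"])

lemma letter_density_nonneg: "0 \<le> letter_density l i w"
  by (simp add: letter_density_def)

lemma avg_letter_density_step:
  assumes "i < l" "r < l"
  shows "avg (letters l) (\<lambda>c. letter_density l i (Suc r, c) * f c) = avg (letters l) (\<lambda>c. f (c(r := i)))"
proof -
  have "avg (letters l) (\<lambda>c. letter_density l i (Suc r, c) * f c)
      = avg (letters l) (\<lambda>c. avg {..<l} (\<lambda>a. letter_density l i (Suc r, c(r := a)) * f (c(r := a))))"
    unfolding letters_def by (rule avg_PiE_resample) (use assms in \<open>auto simp: lessThan_empty_iff\<close>)
  also have "\<dots> = avg (letters l) (\<lambda>c. f (c(r := i)))"
  proof (rule avg_cong)
    fix c
    have "(\<Sum>a<l. letter_density l i (Suc r, c(r := a)) * f (c(r := a)))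
        = (\<Sum>a<l. if a = i then l * f (c(r := i)) else 0)"
      by (rule sum.cong) (auto simp: letter_density_def)
    then show "avg {..<l} (\<lambda>a. letter_density l i (Suc r, c(r := a)) * f (c(r := a))) = f (c(r := i))"
      using assms by (simp add: avg_def)
  qed
  finally show ?thesis .
qed

lemma avg_letter_density_mult:
  assumes "i < l"
  shows "avg (words l) (\<lambda>w. letter_density l i w * f w)
    = (\<Sum>r<l - 1. avg (letters l) (\<lambda>c. f (Suc r, c(r := i)))) / l"
proof -
  let ?A = "\<lambda>r. avg (letters l) (\<lambda>c. letter_density l i (r, c) * f (r, c))"
  obtain k where k: "l = Suc k" using assms by (cases l) auto
  have "?A 0 = 0" by (simp add: letter_density_def avg_def)
  then have "(\<Sum>r<l. ?A r) = (\<Sum>r<k. ?A (Suc r))"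
    unfolding k by (simp only: sum.lessThan_Suc_shift add_0)
  also have "\<dots> = (\<Sum>r<k. avg (letters l) (\<lambda>c. f (Suc r, c(r := i))))"
    by (rule sum.cong) (use avg_letter_density_step[OF assms, of _ "\<lambda>c. f (Suc _, c)"] k in auto)
  finally show ?thesis unfolding avg_words using k by simp
qed

lemma avg_letter_density: assumes "i < l" shows "avg (words l) (letter_density l i) = 1 - 1 / l"
  using avg_letter_density_mult[OF assms, of "\<lambda>_. 1"] assms
  by (simp add: avg_const field_simps of_nat_diff)

lemma avg_letter_density_square:
  assumes "i < l" shows "avg (words l) (\<lambda>w. (letter_density l i w)\<^sup>2) \<le> l"
proof -
  have "avg (words l) (\<lambda>w. (letter_density l i w)\<^sup>2) = avg (words l) (\<lambda>w. letter_density l i w * l)"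
    by (rule avg_cong) (simp add: letter_density_def power2_eq_square)
  also have "\<dots> = (1 - 1 / l) * l" by (simp add: avg_cmult_right avg_letter_density[OF assms])
  also have "\<dots> \<le> l" using assms by (simp add: field_simps)
  finally show ?thesis .
qed

lemma avg_eval_word_shift:
  assumes i: "i < l" and C: "\<And>u. \<bar>f u\<bar> \<le> C"
  shows "\<bar>avg (words l) (\<lambda>w. f (\<nu> i + eval_word \<nu> w))
    - avg (words l) (\<lambda>w. letter_density l i w * f (eval_word \<nu> w))\<bar> \<le> C / l"
proof -
  let ?A = "\<lambda>r. avg (letters l) (\<lambda>c. f (\<nu> i + eval_letters \<nu> c r))"
  obtain k where k: "l = Suc k" using i by (cases l) auto
  have "avg (words l) (\<lambda>w. letter_density l i w * f (eval_word \<nu> w)) = (\<Sum>r<k. ?A r) / l"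
    unfolding avg_letter_density_mult[OF i] using k by (simp add: eval_word_def eval_letters_upd)
  moreover have "avg (words l) (\<lambda>w. f (\<nu> i + eval_word \<nu> w)) = (\<Sum>r<l. ?A r) / l"
    by (simp add: avg_words eval_word_def)
  ultimately have "avg (words l) (\<lambda>w. f (\<nu> i + eval_word \<nu> w))
      - avg (words l) (\<lambda>w. letter_density l i w * f (eval_word \<nu> w)) = ?A k / l"
    using k by (simp add: add_divide_distrib)
  moreover have "\<bar>?A k\<bar> \<le> C" by (rule avg_abs_le) (use C in auto)
  ultimately show ?thesis by (simp add: divide_right_mono)
qed

text \<open>With \<open>l ^ l\<close> lamps the law of large numbers beats every power of \<open>l\<close>.\<close>

definition num_lamps :: "nat \<Rightarrow> nat" where
  "num_lamps l = l ^ l"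

lemma le_num_lamps: "l \<le> num_lamps l"
  by (cases "l = 0") (simp_all add: num_lamps_def self_le_power)

type_synonym sample = "(nat \<Rightarrow> word) \<times> nat perm"

definition samples :: "nat \<Rightarrow> sample set" where
  "samples l = ({..<num_lamps l} \<rightarrow>\<^sub>E words l) \<times> perms_below (num_lamps l)"

definition random_lamps :: "(nat \<Rightarrow> 'g::group_add) \<Rightarrow> nat \<Rightarrow> (nat \<Rightarrow> word) \<Rightarrow> 'g lamps" where
  "random_lamps \<nu> l x = Abs_lamps (\<lambda>j. if j < num_lamps l then eval_word \<nu> (x j) else 0)"

definition random_element :: "(nat \<Rightarrow> 'g::group_add) \<Rightarrow> nat \<Rightarrow> sample \<Rightarrow> 'g wreath" where
  "random_element \<nu> l s = Wreath (random_lamps \<nu> l (fst s)) (snd s)"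

lemma samples_finite_nonempty: assumes "l \<ge> 1" shows "finite (samples l)" "samples l \<noteq> {}"
  using words_finite_nonempty[OF assms] zero_in_perms_below[of "num_lamps l"] finite_perms_below
  by (auto simp: samples_def PiE_eq_empty_iff intro!: finite_PiE)

lemma lamp_random_lamps:
  "lamp (random_lamps \<nu> l x) j = (if j < num_lamps l then eval_word \<nu> (x j) else 0)"
proof -
  have "finite {j. (if j < num_lamps l then eval_word \<nu> (x j) else 0) \<noteq> 0}"
    by (rule finite_subset[of _ "{..<num_lamps l}"]) auto
  then show ?thesis by (simp add: random_lamps_def lamp_Abs_lamps)
qed

lemma avg_samples_resample:
  assumes "l \<ge> 1" "j < num_lamps l"
  shows "avg (samples l) f = avg (samples l) (\<lambda>s. avg (words l) (\<lambda>w. f ((fst s)(j := w), snd s)))"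
proof -
  have "avg ({..<num_lamps l} \<rightarrow>\<^sub>E words l) (\<lambda>x. avg (perms_below (num_lamps l)) (\<lambda>t. f (x, t)))
      = avg ({..<num_lamps l} \<rightarrow>\<^sub>E words l)
          (\<lambda>x. avg (words l) (\<lambda>w. avg (perms_below (num_lamps l)) (\<lambda>t. f (x(j := w), t))))"
    by (rule avg_PiE_resample) (use assms words_finite_nonempty in auto)
  then show ?thesis by (simp add: samples_def avg_Times avg_swap[of "words l"])
qed

lemma avg_samples_lamp:
  assumes "l \<ge> 1" "j < num_lamps l"
  shows "avg (samples l) (\<lambda>s. f (fst s j)) = avg (words l) f"
  using avg_samples_resample[OF assms, of "\<lambda>s. f (fst s j)"] samples_finite_nonempty[OF assms(1)]
  by (simp add: avg_const)

lemma avg_samples_independent: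
  assumes "l \<ge> 1" "j < num_lamps l" "k < num_lamps l" "j \<noteq> k"
  shows "avg (samples l) (\<lambda>s. f (fst s j) * g (fst s k)) = avg (words l) f * avg (words l) g"
  using avg_samples_resample[OF assms(1,2), of "\<lambda>s. f (fst s j) * g (fst s k)"] assms
  by (simp add: avg_cmult_right avg_cmult avg_samples_lamp)

lemma avg_samples_shift:
  assumes l: "l \<ge> 1" "j < num_lamps l" "i < l" and y: "lamp y j = 0" and C: "\<And>u. \<bar>f u\<bar> \<le> C"
  shows "\<bar>avg (samples l) (\<lambda>s. f (base (single j (\<nu> i) + y) + random_element \<nu> l s))
    - avg (samples l) (\<lambda>s. letter_density l i (fst s j) * f (base y + random_element \<nu> l s))\<bar> \<le> C / l"
proof -
  define set_lamp where
    "set_lamp s u = Wreath (y + single j u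
      + (single j (- lamp (random_lamps \<nu> l (fst s)) j) + random_lamps \<nu> l (fst s))) (snd s)"
    for s u
  let ?upd = "\<lambda>s w. ((fst s)(j := w), snd s)"
  have shifted: "base (single j (\<nu> i) + y) + random_element \<nu> l (?upd s w)
    = set_lamp s (\<nu> i + eval_word \<nu> w)"
    and unshifted: "base y + random_element \<nu> l (?upd s w) = set_lamp s (eval_word \<nu> w)" for s w
    using l y
    by (auto simp: set_lamp_def random_element_def Wreath_plus lamp_single lamp_random_lamps
        intro!: lamps_eqI)
  have "avg (samples l) (\<lambda>s. f (base (single j (\<nu> i) + y) + random_element \<nu> l s))
      - avg (samples l) (\<lambda>s. letter_density l i (fst s j) * f (base y + random_element \<nu> l s))
    = avg (samples l) (\<lambda>s. avg (words l) (\<lambda>w. f (set_lamp s (\<nu> i + eval_word \<nu> w)))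
        - avg (words l) (\<lambda>w. letter_density l i w * f (set_lamp s (eval_word \<nu> w))))"
    unfolding avg_diff avg_samples_resample[OF l(1,2),
        of "\<lambda>s. f (base (single j (\<nu> i) + y) + random_element \<nu> l s)"]
      avg_samples_resample[OF l(1,2),
        of "\<lambda>s. letter_density l i (fst s j) * f (base y + random_element \<nu> l s)"]
      shifted unshifted by simp
  moreover have "\<bar>\<dots>\<bar> \<le> C / l"
    by (rule avg_abs_le[OF samples_finite_nonempty[OF l(1)]], rule avg_eval_word_shift[OF l(3)]) (rule C)
  ultimately show ?thesis by simp
qed

definition permute_sample :: "nat perm \<Rightarrow> sample \<Rightarrow> sample" where
  "permute_sample t s = (\<lambda>i. fst s (apply (- t) i), t + snd s)"

lemma permute_sample_in_samples:
  assumes t: "t \<in> perms_below (num_lamps l)" and s: "s \<in> samples l"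
  shows "permute_sample t s \<in> samples l"
proof -
  obtain x u where xu: "s = (x, u)" "x \<in> {..<num_lamps l} \<rightarrow>\<^sub>E words l" "u \<in> perms_below (num_lamps l)"
    using s by (auto simp: samples_def)
  have "apply (- t) i < num_lamps l \<longleftrightarrow> i < num_lamps l" for i
    by (rule apply_perms_below_less[OF uminus_in_perms_below[OF t]])
  then have "(\<lambda>i. x (apply (- t) i)) \<in> {..<num_lamps l} \<rightarrow>\<^sub>E words l"
    using xu(2) by (auto simp: PiE_iff extensional_def)
  then show ?thesis
    using plus_in_perms_below[OF t xu(3)] xu(1) by (simp add: permute_sample_def samples_def)
qed

lemma avg_samples_permute:
  assumes t: "t \<in> perms_below (num_lamps l)"
  shows "avg (samples l) (\<lambda>s. f (fst s j) (Wreath 0 t + random_element \<nu> l s))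
    = avg (samples l) (\<lambda>s. f (fst s (apply t j)) (random_element \<nu> l s))"
proof -
  have "bij_betw (permute_sample t) (samples l) (samples l)"
    by (rule bij_betw_byWitness[of _ "permute_sample (- t)"])
       (use permute_sample_in_samples[OF t] permute_sample_in_samples[OF uminus_in_perms_below[OF t]]
        in \<open>auto simp: permute_sample_def\<close>)
  then have "avg (samples l) (\<lambda>s. f (fst (permute_sample t s) (apply t j))
    (random_element \<nu> l (permute_sample t s)))
      = avg (samples l) (\<lambda>s. f (fst s (apply t j)) (random_element \<nu> l s))"
    by (rule avg_reindex)
  moreover have "Wreath 0 t + random_element \<nu> l s = random_element \<nu> l (permute_sample t s)" for s
  proof -
    have "permute t (random_lamps \<nu> l (fst s)) = random_lamps \<nu> l (fst (permute_sample t s))"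
      by (rule lamps_eqI)
         (simp add: lamp_random_lamps permute_sample_def
            apply_perms_below_less[OF uminus_in_perms_below[OF t]])
    then show ?thesis by (simp add: random_element_def Wreath_plus) (simp add: permute_sample_def)
  qed
  ultimately show ?thesis by (simp add: permute_sample_def)
qed

section \<open>Bounded acyclicity of the wreath product and of the finitary permutations\<close>

definition wreath_mean :: "(nat \<Rightarrow> 'g::group_add) \<Rightarrow> nat \<Rightarrow> ('g wreath \<Rightarrow> real) \<Rightarrow> real" where
  "wreath_mean \<nu> l f = avg (samples l) (\<lambda>s. f (random_element \<nu> l s))"

lemma group_mean_wreath_mean: "l \<ge> 1 \<Longrightarrow> group_mean (wreath_mean \<nu> l)"
  using mean_avg[OF samples_finite_nonempty, of l "random_element \<nu> l"]
  by (simp add: group_mean_def wreath_mean_def[abs_def])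

definition translates :: "(nat \<Rightarrow> 'g::group_add) \<Rightarrow> nat \<Rightarrow> 'g wreath list \<Rightarrow> sample list \<Rightarrow> 'g wreath list" where
  "translates \<nu> l gs ss = map2 (\<lambda>g s. g + random_element \<nu> l s) gs ss"

definition weight :: "nat \<Rightarrow> nat list \<Rightarrow> nat \<Rightarrow> sample list \<Rightarrow> real" where
  "weight l is j ss = prod_list (map2 (\<lambda>i s. letter_density l i (fst s j)) is ss)"

text \<open>By \<open>avg_samples_shift\<close> this is nearly the iterated mean over the tuple obtained from \<open>gs\<close> by
  multiplying the \<open>j\<close>-th lamps by the letters \<open>is\<close>.\<close>

definition weighted_mean ::
    "(nat \<Rightarrow> 'g::group_add) \<Rightarrow> nat \<Rightarrow> nat list \<Rightarrow> nat \<Rightarrow> 'g wreath list \<Rightarrow> ('g wreath list \<Rightarrow> real) \<Rightarrow> real" where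
  "weighted_mean \<nu> l is j gs F
    = avg (tuples (samples l) (length gs)) (\<lambda>ss. weight l is j ss * F (translates \<nu> l gs ss))"

lemma translates_Cons [simp]:
  "translates \<nu> l (g # gs) (s # ss) = (g + random_element \<nu> l s) # translates \<nu> l gs ss"
  and translates_Nil [simp]: "translates \<nu> l [] ss = []"
  by (simp_all add: translates_def)

lemma weighted_mean_Nil: "weighted_mean \<nu> l [] j [] F = F []"
  by (simp add: weighted_mean_def weight_def avg_tuples_0)

lemma weighted_mean_Cons:
  "weighted_mean \<nu> l (i # is) j (g # gs) F = avg (samples l) (\<lambda>s. letter_density l i (fst s j)
     * weighted_mean \<nu> l is j gs (\<lambda>h. F ((g + random_element \<nu> l s) # h)))"
  by (simp add: weighted_mean_def weight_def avg_tuples_Suc avg_cmult mult.assoc)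

lemma imean_wreath_mean:
  "imean (wreath_mean \<nu> l) gs F = avg (tuples (samples l) (length gs)) (\<lambda>ss. F (translates \<nu> l gs ss))"
  by (induction gs arbitrary: F) (simp_all add: wreath_mean_def avg_tuples_0 avg_tuples_Suc)

lemma avg_letter_density_dist_le:
  fixes f g :: "'g::group_add wreath \<Rightarrow> real" and D :: real
  assumes l: "l \<ge> 1" "j < num_lamps l" "i < l" and close: "\<And>z. \<bar>f z - g z\<bar> \<le> D"
  defines "w \<equiv> \<lambda>s :: sample. letter_density l i (fst s j)"
  shows "\<bar>avg (samples l) (\<lambda>s. w s * f (h s)) - avg (samples l) (\<lambda>s. w s * g (h s))\<bar> \<le> D"
proof -
  have "\<bar>avg (samples l) (\<lambda>s. w s * f (h s)) - avg (samples l) (\<lambda>s. w s * g (h s))\<bar>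
    \<le> avg (samples l) (\<lambda>s. \<bar>w s * (f (h s) - g (h s))\<bar>)"
    unfolding avg_diff[symmetric] right_diff_distrib by (rule avg_abs_le_avg)
  also have "\<dots> \<le> avg (samples l) (\<lambda>s. w s * D)"
    unfolding w_def abs_mult abs_of_nonneg[OF letter_density_nonneg]
    by (intro avg_mono mult_left_mono close letter_density_nonneg)
  also have "\<dots> = (1 - 1 / l) * D"
    by (simp only: w_def avg_cmult_right avg_samples_lamp[OF l(1,2)] avg_letter_density[OF l(3)])
  also have "\<dots> \<le> 1 * D" by (rule mult_right_mono) (use close[of undefined] in auto)
  finally show ?thesis by simp
qed

lemma imean_shift_weighted_mean:
  fixes C :: real
  assumes "length is = length ys" and l: "l \<ge> 1" "j < num_lamps l" and "\<forall>i\<in>set is. i < l"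
    and "\<forall>y\<in>set ys. lamp y j = 0" and "\<And>u. length u = length ys \<Longrightarrow> \<bar>F u\<bar> \<le> C"
  shows "\<bar>imean (wreath_mean \<nu> l) (map2 (\<lambda>i y. base (single j (\<nu> i) + y)) is ys) F
    - weighted_mean \<nu> l is j (map base ys) F\<bar> \<le> length ys * C / l"
  using assms(1,4-6)
proof (induction "is" ys arbitrary: F rule: list_induct2)
  case Nil
  then show ?case by (simp add: weighted_mean_Nil)
next
  case (Cons i "is" y ys)
  interpret group_mean "wreath_mean \<nu> l" by (rule group_mean_wreath_mean[OF l(1)])
  let ?shifted = "\<lambda>z. imean (wreath_mean \<nu> l) (map2 (\<lambda>i y. base (single j (\<nu> i) + y)) is ys)
    (\<lambda>h. F (z # h))"
  let ?weighted = "\<lambda>z. weighted_mean \<nu> l is j (map base ys) (\<lambda>h. F (z # h))"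
  let ?density = "\<lambda>s. letter_density l i (fst s j)" and ?X = "random_element \<nu> l"
  have i: "i < l" using Cons.prems(1) by simp
  have "\<bar>?shifted z\<bar> \<le> C" for z by (rule imean_abs_le) (use Cons in auto)
  then have first: "\<bar>avg (samples l) (\<lambda>s. ?shifted (base (single j (\<nu> i) + y) + ?X s))
      - avg (samples l) (\<lambda>s. ?density s * ?shifted (base y + ?X s))\<bar> \<le> C / l"
    by (intro avg_samples_shift l i) (use Cons.prems in auto)
  have rest: "\<bar>avg (samples l) (\<lambda>s. ?density s * ?shifted (base y + ?X s))
      - avg (samples l) (\<lambda>s. ?density s * ?weighted (base y + ?X s))\<bar> \<le> length ys * C / l"
    by (rule avg_letter_density_dist_le[OF l i]) (rule Cons.IH; use Cons.prems in auto)
  have "imean (wreath_mean \<nu> l) (map2 (\<lambda>i y. base (single j (\<nu> i) + y)) (i # is) (y # ys)) F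
      = avg (samples l) (\<lambda>s. ?shifted (base (single j (\<nu> i) + y) + ?X s))"
    by (simp add: wreath_mean_def)
  moreover have "length (y # ys) * C / l = C / l + length ys * C / l"
    by (simp add: algebra_simps add_divide_distrib)
  ultimately show ?case using first rest by (simp add: weighted_mean_Cons)
qed

lemma weighted_mean_left_permute:
  assumes "length is = length gs" and t: "t \<in> perms_below (num_lamps l)"
    and "\<forall>g\<in>set gs. Wreath 0 t + g = g + Wreath 0 t"
  shows "weighted_mean \<nu> l is j gs (\<lambda>h. F (map ((+) (Wreath 0 t)) h))
    = weighted_mean \<nu> l is (apply t j) gs F"
  using assms(1,3)
proof (induction "is" gs arbitrary: F rule: list_induct2)
  case Nil
  then show ?case by (simp add: weighted_mean_Nil)
next
  case (Cons i "is" g gs)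
  let ?rest = "\<lambda>z. weighted_mean \<nu> l is (apply t j) gs (\<lambda>h. F (z # h))"
  have "Wreath 0 t + (g + z) = g + (Wreath 0 t + z)" for z
    using Cons.prems by (simp add: add.assoc[symmetric])
  then have "weighted_mean \<nu> l (i # is) j (g # gs) (\<lambda>h. F (map ((+) (Wreath 0 t)) h))
      = avg (samples l) (\<lambda>s. letter_density l i (fst s j)
        * ?rest (g + (Wreath 0 t + random_element \<nu> l s)))"
    using Cons.IH[of "\<lambda>h. F (_ # h)"] Cons.prems by (simp add: weighted_mean_Cons)
  also have "\<dots> = avg (samples l) (\<lambda>s. letter_density l i (fst s (apply t j))
    * ?rest (g + random_element \<nu> l s))"
    by (rule avg_samples_permute[OF t, of "\<lambda>a u. letter_density l i a * ?rest (g + u)"])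
  finally show ?case by (simp add: weighted_mean_Cons)
qed

lemma weighted_mean_dark_lamps:
  assumes "length is = length ys" "translation_invariant F"
    and jk: "j < num_lamps l" "k < num_lamps l" and dark: "\<forall>y\<in>set ys. lamp y j = 0 \<and> lamp y k = 0"
  shows "weighted_mean \<nu> l is k (map base ys) F = weighted_mean \<nu> l is j (map base ys) F"
proof -
  let ?t = "Perm.swap j k"
  have "permute ?t y = y" if "y \<in> set ys" for y
  proof (rule lamps_eqI)
    fix i show "lamp (permute ?t y) i = lamp y i"
      using dark that by (cases "i = j \<or> i = k") (auto simp: apply_swap_eq_iff)
  qed
  then have "\<forall>g\<in>set (map base ys). Wreath 0 ?t + g = g + Wreath 0 ?t"
    by (auto simp: Wreath_plus)
  then have "weighted_mean \<nu> l is j (map base ys) (\<lambda>h. F (map ((+) (Wreath 0 ?t)) h))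
      = weighted_mean \<nu> l is (apply ?t j) (map base ys) F"
    by (intro weighted_mean_left_permute swap_in_perms_below jk) (simp add: assms(1))
  then show ?thesis using assms(2) by (simp add: translation_invariant_def)
qed

lemma weight_mult:
  "weight l is j ss * weight l is k ss
    = prod_list (map2 (\<lambda>i s. letter_density l i (fst s j) * letter_density l i (fst s k)) is ss)"
proof (induction "is" arbitrary: ss)
  case (Cons i "is")
  show ?case
  proof (cases ss)
    case (Cons s ss')
    then show ?thesis using Cons.IH[of ss'] by (simp add: weight_def mult_ac)
  qed (simp add: weight_def)
qed (simp add: weight_def)

lemma prod_list_map_eq_power: "(\<And>i. i \<in> set is \<Longrightarrow> f i = c) \<Longrightarrow> prod_list (map f is) = c ^ length is"
  for c :: "'a::comm_monoid_mult"
  by (induction "is") auto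

lemma prod_list_map_le_power:
  "(\<And>i. i \<in> set is \<Longrightarrow> 0 \<le> f i \<and> f i \<le> c) \<Longrightarrow> prod_list (map f is) \<le> c ^ length is"
  for c :: real
proof (induction "is")
  case (Cons i "is")
  have "0 \<le> prod_list (map f is)" by (rule prod_list_nonneg) (use Cons.prems in auto)
  moreover have "0 \<le> c" using Cons.prems[of i] by auto
  ultimately show ?case using Cons by (auto intro: mult_mono)
qed simp

lemma avg_weight:
  assumes "l \<ge> 1" "j < num_lamps l" "\<forall>i\<in>set is. i < l"
  shows "avg (tuples (samples l) (length is)) (weight l is j) = (1 - 1 / l) ^ length is"
  unfolding weight_def[abs_def] avg_tuples_prod_list
  by (rule prod_list_map_eq_power)
     (use assms in \<open>simp add: avg_samples_lamp[of l j] avg_letter_density\<close>)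

lemma avg_weight_mult:
  assumes "l \<ge> 1" "j < num_lamps l" "k < num_lamps l" "j \<noteq> k" "\<forall>i\<in>set is. i < l"
  shows "avg (tuples (samples l) (length is)) (\<lambda>ss. weight l is j ss * weight l is k ss)
    = ((1 - 1 / l) ^ length is)\<^sup>2"
proof -
  have "avg (tuples (samples l) (length is)) (\<lambda>ss. weight l is j ss * weight l is k ss)
      = ((1 - 1 / l)\<^sup>2) ^ length is"
    unfolding weight_mult avg_tuples_prod_list
    by (rule prod_list_map_eq_power)
       (use assms in \<open>simp add: avg_samples_independent[of l j k] avg_letter_density power2_eq_square\<close>)
  then show ?thesis by (simp add: mult.commute flip: power_mult)
qed

lemma avg_weight_square_le:
  assumes l: "l \<ge> 1" "j < num_lamps l" and "is": "\<forall>i\<in>set is. i < l"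
  shows "avg (tuples (samples l) (length is)) (\<lambda>ss. (weight l is j ss)\<^sup>2) \<le> real l ^ length is"
  unfolding power2_eq_square weight_mult avg_tuples_prod_list
proof (rule prod_list_map_le_power)
  fix i assume "i \<in> set is"
  then show "0 \<le> avg (samples l) (\<lambda>s. letter_density l i (fst s j) * letter_density l i (fst s j))
      \<and> avg (samples l) (\<lambda>s. letter_density l i (fst s j) * letter_density l i (fst s j)) \<le> real l"
    using avg_samples_lamp[OF l, of "\<lambda>w. (letter_density l i w)\<^sup>2"] avg_letter_density_square[of i l] "is"
    by (simp add: power2_eq_square avg_def sum_nonneg)
qed

lemma abs_power_mult_diff_le:
  fixes M C :: real
  assumes "l \<ge> 1" "\<bar>M\<bar> \<le> C" shows "\<bar>(1 - 1 / real l) ^ n * M - M\<bar> \<le> n / l * C"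
proof -
  let ?r = "(1 - 1 / real l) ^ n"
  have "1 + n * (- 1 / real l) \<le> (1 + (- 1 / real l)) ^ n"
    by (rule Bernoulli_inequality) (use assms(1) in \<open>simp add: field_simps\<close>)
  then have "1 - ?r \<le> n / l" by simp
  moreover have "?r \<le> 1" using assms(1) by (intro power_le_one) (auto simp: field_simps)
  ultimately have "(1 - ?r) * \<bar>M\<bar> \<le> n / l * C" using assms(2) by (intro mult_mono) auto
  moreover have "?r * M - M = - ((1 - ?r) * M)" by (simp add: algebra_simps)
  ultimately show ?thesis using \<open>?r \<le> 1\<close> by (simp add: abs_mult)
qed

lemma weighted_mean_near_imean:
  fixes C a :: real
  assumes l: "l \<ge> 1" and J: "J \<subseteq> {..<num_lamps l}" "J \<noteq> {}"
    and "is": "length is = length gs" "\<forall>i\<in>set is. i < l"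
    and C: "\<And>u. length u = length gs \<Longrightarrow> \<bar>F u\<bar> \<le> C" "0 \<le> C"
    and same_weighted: "\<And>k. k \<in> J \<Longrightarrow> weighted_mean \<nu> l is k gs F = a"
  shows "\<bar>a - imean (wreath_mean \<nu> l) gs F\<bar> \<le> C * (length gs / l + sqrt (real l ^ length gs / card J))"
proof -
  let ?n = "length gs" and ?r = "(1 - 1 / real l) ^ length gs" and ?M = "imean (wreath_mean \<nu> l) gs F"
  let ?S = "tuples (samples l) ?n"
  interpret group_mean "wreath_mean \<nu> l" by (rule group_mean_wreath_mean[OF l])
  have S: "finite ?S" "?S \<noteq> {}"
    using samples_finite_nonempty[OF l] by (simp_all add: finite_tuples tuples_nonempty)
  have finite_J: "finite J" using J(1) by (rule finite_subset) simp
  have "\<bar>a - ?r * avg ?S (\<lambda>ss. F (translates \<nu> l gs ss))\<bar> \<le> C * sqrt (real l ^ ?n / card J)"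
  proof (rule avg_weak_law[OF S finite_J J(2)])
    show "avg ?S (weight l is j) = ?r" if "j \<in> J" for j
      using avg_weight[OF l, of j "is"] that J(1) "is" by auto
    show "avg ?S (\<lambda>ss. weight l is j ss * weight l is k ss) = ?r\<^sup>2" if "j \<in> J" "k \<in> J" "j \<noteq> k" for j k
      using avg_weight_mult[OF l, of j k "is"] that J(1) "is" by auto
    show "avg ?S (\<lambda>ss. (weight l is j ss)\<^sup>2) \<le> real l ^ ?n" if "j \<in> J" for j
      using avg_weight_square_le[OF l, of j "is"] that J(1) "is" by auto
    show "\<bar>F (translates \<nu> l gs ss)\<bar> \<le> C" if "ss \<in> ?S" for ss
      by (rule C(1)) (use that in \<open>simp add: translates_def tuples_def\<close>)
    show "avg ?S (\<lambda>ss. weight l is k ss * F (translates \<nu> l gs ss)) = a" if "k \<in> J" for k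
      using same_weighted[OF that] by (simp add: weighted_mean_def)
  qed (rule C(2))
  then have weak_law: "\<bar>a - ?r * ?M\<bar> \<le> C * sqrt (real l ^ ?n / card J)"
    by (simp only: imean_wreath_mean)
  have "\<bar>?M\<bar> \<le> C" by (rule imean_abs_le) (rule C(1))
  then have "\<bar>?r * ?M - ?M\<bar> \<le> ?n / l * C" by (rule abs_power_mult_diff_le[OF l])
  moreover have "C * (?n / l + sqrt (real l ^ ?n / card J))
    = (?n / l) * C + C * sqrt (real l ^ ?n / card J)"
    by (simp add: algebra_simps)
  ultimately show ?thesis using weak_law by linarith
qed

definition clear_lamp :: "nat \<Rightarrow> 'g::group_add lamps \<Rightarrow> 'g lamps" where
  "clear_lamp j y = single j (- lamp y j) + y"

lemma lamp_clear_lamp: "lamp (clear_lamp j y) i = (if i = j then 0 else lamp y i)"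
  by (simp add: clear_lamp_def lamp_single)

lemma base_single_plus_clear_lamp:
  assumes letters: "map \<nu> is = map (\<lambda>y. lamp y j) ys"
  shows "map2 (\<lambda>i y. base (single j (\<nu> i) + y)) is (map (clear_lamp j) ys) = map base ys"
proof (rule nth_equalityI)
  have len: "length is = length ys" using letters by (metis length_map)
  then show "length (map2 (\<lambda>i y. base (single j (\<nu> i) + y)) is (map (clear_lamp j) ys))
    = length (map base ys)"
    by simp
  fix k assume "k < length (map2 (\<lambda>i y. base (single j (\<nu> i) + y)) is (map (clear_lamp j) ys))"
  then have k: "k < length ys" using len by simp
  then have "\<nu> (is ! k) = lamp (ys ! k) j" using letters len by (metis nth_map)
  then have "single j (\<nu> (is ! k)) + clear_lamp j (ys ! k) = ys ! k"
    by (intro lamps_eqI) (simp add: lamp_clear_lamp lamp_single)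
  then show "map2 (\<lambda>i y. base (single j (\<nu> i) + y)) is (map (clear_lamp j) ys) ! k = map base ys ! k"
    using k len by simp
qed

lemma imean_clear_lamp_bound:
  fixes \<nu> :: "nat \<Rightarrow> 'g::group_add" and C :: real
  assumes F: "translation_invariant F" "\<And>u. length u = length ys \<Longrightarrow> \<bar>F u\<bar> \<le> C" "0 \<le> C"
    and l: "l \<ge> 1" "j < num_lamps l"
    and "is": "map \<nu> is = map (\<lambda>y. lamp y j) ys" "\<forall>i\<in>set is. i < l"
    and S: "finite S" "\<forall>y\<in>set ys. \<forall>i. lamp y i \<noteq> 0 \<longrightarrow> i \<in> S" "card S < num_lamps l"
  shows "\<bar>imean (wreath_mean \<nu> l) (map base ys) F
      - imean (wreath_mean \<nu> l) (map base (map (clear_lamp j) ys)) F\<bar>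
    \<le> C * (2 * length ys / l + sqrt (real l ^ length ys / (real (num_lamps l) - card S)))"
proof -
  let ?zs = "map (clear_lamp j) ys" and ?n = "length ys"
  let ?a = "weighted_mean \<nu> l is j (map base ?zs) F"
  have len: "length is = ?n" using "is"(1) by (metis length_map)
  have shift: "\<bar>imean (wreath_mean \<nu> l) (map base ys) F - ?a\<bar> \<le> ?n * C / l"
    using imean_shift_weighted_mean[of "is" ?zs l j F C \<nu>] "is"(2) len l F(2)
    by (simp add: lamp_clear_lamp base_single_plus_clear_lamp[OF "is"(1)])
  define J where "J = insert j ({..<num_lamps l} - S)"
  have J: "J \<subseteq> {..<num_lamps l}" "J \<noteq> {}" using l by (auto simp: J_def)
  have weighted_mean_eq: "weighted_mean \<nu> l is k (map base ?zs) F = ?a" if "k \<in> J" for k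
  proof (rule weighted_mean_dark_lamps)
    have "k = j \<or> k \<notin> S" using that by (auto simp: J_def)
    then show "\<forall>z\<in>set ?zs. lamp z j = 0 \<and> lamp z k = 0" using S(2) by (auto simp: lamp_clear_lamp)
    show "k < num_lamps l" using that J(1) by blast
  qed (use F(1) l len in auto)
  have "\<bar>?a - imean (wreath_mean \<nu> l) (map base ?zs) F\<bar> \<le> C * (?n / l + sqrt (real l ^ ?n / card J))"
    using weighted_mean_near_imean[OF l(1) J, of "is" "map base ?zs" F C \<nu>] weighted_mean_eq F len "is"(2)
    by simp
  also have "\<dots> \<le> C * (?n / l + sqrt (real l ^ ?n / (real (num_lamps l) - card S)))"
  proof -
    have "card {..<num_lamps l} - card S \<le> card ({..<num_lamps l} - S)"
      by (rule diff_card_le_card_Diff[OF S(1)])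
    also have "\<dots> \<le> card J" by (rule card_mono) (auto simp: J_def)
    finally have "real (num_lamps l) - card S \<le> card J" using S(3) by simp
    then show ?thesis using S(3) F(3)
      by (intro mult_left_mono add_left_mono real_sqrt_le_mono divide_left_mono) auto
  qed
  finally have "\<bar>?a - imean (wreath_mean \<nu> l) (map base ?zs) F\<bar>
      \<le> C * (?n / l + sqrt (real l ^ ?n / (real (num_lamps l) - card S)))" .
  moreover have "C * (2 * ?n / l + sqrt (real l ^ ?n / (real (num_lamps l) - card S)))
      = ?n * C / l + C * (?n / l + sqrt (real l ^ ?n / (real (num_lamps l) - card S)))"
    by (simp add: algebra_simps)
  ultimately show ?thesis using shift by linarith
qed

lemma sqrt_power_div_num_lamps_le:
  assumes "n + 2 \<le> l" "2 * c \<le> l"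
  shows "sqrt (real l ^ n / (real (num_lamps l) - real c)) \<le> 2 / l"
proof -
  have l: "real l > 0" using assms(1) by simp
  have "l ^ (n + 2) \<le> num_lamps l"
    unfolding num_lamps_def using assms(1) by (intro power_increasing) auto
  then have "real l ^ (n + 2) \<le> real (num_lamps l)" by (metis of_nat_le_iff of_nat_power)
  moreover have "2 * real c \<le> real (num_lamps l)" using assms(2) le_num_lamps[of l] by linarith
  ultimately have "real l ^ (n + 2) / 2 \<le> real (num_lamps l) - real c" by linarith
  moreover have "0 < real l ^ (n + 2) / 2" using l by simp
  ultimately have "real l ^ n / (real (num_lamps l) - real c) \<le> real l ^ n / (real l ^ (n + 2) / 2)"
    by (intro divide_left_mono mult_pos_pos) auto
  also have "\<dots> = 2 / (real l)\<^sup>2" using l by (simp add: power_add field_simps power2_eq_square)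
  also have "\<dots> \<le> (2 / real l)\<^sup>2" by (simp add: power_divide divide_right_mono)
  finally show ?thesis by (intro real_le_lsqrt) auto
qed

lemma imean_clear_lamp_tendsto:
  fixes \<nu> :: "nat \<Rightarrow> 'g::group_add"
  assumes \<nu>: "surj \<nu>" and F: "invariant_cochain F"
  shows "(\<lambda>l. imean (wreath_mean \<nu> l) (map base ys) F
     - imean (wreath_mean \<nu> l) (map base (map (clear_lamp j) ys)) F) \<longlonglongrightarrow> 0"
proof -
  let ?n = "length ys"
  have inv: "translation_invariant F" "bounded_cochain F" using F by (auto simp: invariant_cochain_def)
  obtain C where C: "0 \<le> C" "\<And>u. length u = ?n \<Longrightarrow> \<bar>F u\<bar> \<le> C"
    using inv(2) by (rule bounded_cochainE[where n = ?n]) blast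
  define "is" where "is = map (\<lambda>y. SOME i. \<nu> i = lamp y j) ys"
  have "\<nu> (SOME i. \<nu> i = lamp y j) = lamp y j" for y
    using \<nu> by (intro someI_ex[of "\<lambda>i. \<nu> i = lamp y j"]) (metis surjD)
  then have is_eq: "map \<nu> is = map (\<lambda>y. lamp y j) ys" by (simp add: is_def)
  define S where "S = (\<Union>y\<in>set ys. {i. lamp y i \<noteq> 0})"
  have S: "finite S" "\<forall>y\<in>set ys. \<forall>i. lamp y i \<noteq> 0 \<longrightarrow> i \<in> S" by (auto simp: S_def finite_lamp)
  have bound: "\<bar>imean (wreath_mean \<nu> l) (map base ys) F
        - imean (wreath_mean \<nu> l) (map base (map (clear_lamp j) ys)) F\<bar>
      \<le> C * (2 * ?n + 2) * (1 / l)" if l: "l \<ge> ?n + 2 * card S + j + sum_list is + 2" for l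
  proof -
    have l_large: "l \<ge> 1" "j < num_lamps l" "card S < num_lamps l" using l le_num_lamps[of l] by linarith+
    have is_less: "\<forall>i\<in>set is. i < l" using l member_le_sum_list[of _ "is"] by fastforce
    have "\<bar>imean (wreath_mean \<nu> l) (map base ys) F
        - imean (wreath_mean \<nu> l) (map base (map (clear_lamp j) ys)) F\<bar>
      \<le> C * (2 * ?n / l + sqrt (real l ^ ?n / (real (num_lamps l) - card S)))"
      by (rule imean_clear_lamp_bound[OF inv(1) C(2,1) l_large(1,2) is_eq is_less S l_large(3)])
    also have "\<dots> \<le> C * (2 * ?n / l + 2 / l)"
      using l C(1) by (intro mult_left_mono add_left_mono sqrt_power_div_num_lamps_le) auto
    also have "\<dots> = C * (2 * ?n + 2) * (1 / l)" by (simp add: algebra_simps add_divide_distrib)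
    finally show ?thesis .
  qed
  have bound_tendsto: "(\<lambda>l::nat. C * (2 * ?n + 2) * (1 / l)) \<longlonglongrightarrow> 0"
    by (rule tendsto_mult_right_zero[OF lim_1_over_n])
  show ?thesis
    by (rule Lim_null_comparison[OF _ bound_tendsto]) (use bound in \<open>auto simp: eventually_sequentially\<close>)
qed

lemma imean_base_tendsto:
  fixes \<nu> :: "nat \<Rightarrow> 'g::group_add"
  assumes \<nu>: "surj \<nu>" and F: "invariant_cochain F"
    and "finite S" "\<forall>y\<in>set ys. \<forall>i. lamp y i \<noteq> 0 \<longrightarrow> i \<in> S"
  shows "(\<lambda>l. imean (wreath_mean \<nu> l) (map base ys) F
     - imean (wreath_mean \<nu> l) (replicate (length ys) 0) F) \<longlonglongrightarrow> 0"
  using assms(3,4)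
proof (induction S arbitrary: ys rule: finite_induct)
  case empty
  then have "y = 0" if "y \<in> set ys" for y using that by (intro lamps_eqI) auto
  then have "map base ys = replicate (length ys) 0"
    by (intro replicate_eqI) (auto simp: zero_wreath_def)
  then show ?case by simp
next
  case (insert j S)
  let ?zs = "map (clear_lamp j) ys"
  have "(\<lambda>l. imean (wreath_mean \<nu> l) (map base ?zs) F
      - imean (wreath_mean \<nu> l) (replicate (length ?zs) 0) F) \<longlonglongrightarrow> 0"
    by (rule insert.IH) (use insert.prems in \<open>auto simp: lamp_clear_lamp split: if_splits\<close>)
  from tendsto_add[OF imean_clear_lamp_tendsto[OF \<nu> F, of ys j] this]
  show ?case by simp
qed

lemma imean_wreath_mean_drop_perms:
  fixes \<nu> :: "nat \<Rightarrow> 'g::group_add"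
  assumes "l \<ge> 1" "\<forall>g\<in>set gs. perm_of g \<in> perms_below (num_lamps l)" "bounded_cochain F"
  shows "imean (wreath_mean \<nu> l) gs F = imean (wreath_mean \<nu> l) (map base (map lamps_of gs)) F"
proof -
  interpret group_mean "wreath_mean \<nu> l" by (rule group_mean_wreath_mean[OF assms(1)])
  let ?bs = "map (\<lambda>g. Wreath 0 (perm_of g)) gs"
  have "gs = map2 (+) (map base (map lamps_of gs)) ?bs"
    by (induction gs) (simp_all flip: wreath_eq_base_plus)
  moreover have "imean (wreath_mean \<nu> l) (map2 (+) (map base (map lamps_of gs)) ?bs) F
      = imean (wreath_mean \<nu> l) (map base (map lamps_of gs)) F"
  proof (rule imean_right_translate[where B = "Wreath (0 :: 'g lamps) ` perms_below (num_lamps l)"])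
    fix b and f :: "'g wreath \<Rightarrow> real" assume "b \<in> Wreath (0 :: 'g lamps) ` perms_below (num_lamps l)"
    then show "wreath_mean \<nu> l (\<lambda>x. f (b + x)) = wreath_mean \<nu> l f"
      unfolding wreath_mean_def using avg_samples_permute[of _ l "\<lambda>_. f" 0 \<nu>] by auto
  qed (use assms in auto)
  ultimately show ?thesis by simp
qed

theorem bounded_coboundary_wreath:
  fixes F :: "'g::group_add wreath list \<Rightarrow> real"
  assumes \<nu>: "surj (\<nu> :: nat \<Rightarrow> 'g)" and F: "bounded_cocycle n F"
  shows "bounded_coboundary n F"
proof -
  interpret asymptotically_invariant_means "\<lambda>k. wreath_mean \<nu> (Suc k)"
  proof (rule asymptotically_invariant_means.intro)
    show "group_mean (wreath_mean \<nu> (Suc k))" for k by (rule group_mean_wreath_mean) simp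
    fix F :: "'g wreath list \<Rightarrow> real" and gs assume F: "invariant_cochain F"
    let ?diff = "\<lambda>hs l. imean (wreath_mean \<nu> l) hs F - imean (wreath_mean \<nu> l) (replicate (length hs) 0) F"
    have limit: "?diff (map base (map lamps_of gs)) \<longlonglongrightarrow> 0"
      using imean_base_tendsto[OF \<nu> F, of "\<Union>y\<in>lamps_of ` set gs. {i. lamp y i \<noteq> 0}" "map lamps_of gs"]
      by (simp add: finite_lamp) blast
    have "filterlim num_lamps sequentially sequentially"
      by (rule filterlim_at_top_mono[OF filterlim_ident]) (simp add: le_num_lamps)
    then have "eventually (\<lambda>l. perm_of g \<in> perms_below (num_lamps l)) sequentially" for g :: "'g wreath"
      using eventually_compose_filterlim[OF eventually_in_perms_below] by blast
    then have "eventually (\<lambda>l. \<forall>g\<in>set gs. perm_of g \<in> perms_below (num_lamps l)) sequentially"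
      by (intro eventually_ball_finite) auto
    moreover have "eventually (\<lambda>l. l \<ge> 1) sequentially" by (rule eventually_ge_at_top)
    ultimately have "eventually (\<lambda>l. ?diff (map base (map lamps_of gs)) l = ?diff gs l) sequentially"
    proof eventually_elim
      case (elim l)
      then show ?case using imean_wreath_mean_drop_perms[of l gs F \<nu>] F
        by (simp add: invariant_cochain_def)
    qed
    with limit have "?diff gs \<longlonglongrightarrow> 0" by (rule Lim_transform_eventually)
    then show "(\<lambda>k. ?diff gs (Suc k)) \<longlonglongrightarrow> 0" by (rule LIMSEQ_Suc)
  qed
  show ?thesis by (rule bounded_coboundary_of_cocycle[OF F])
qed

theorem bounded_coboundary_perm:
  fixes F :: "nat perm list \<Rightarrow> real"
  assumes "bounded_cocycle n F" shows "bounded_coboundary n F"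
proof -
  have nonempty: "perms_below k \<noteq> {}" for k using zero_in_perms_below by blast
  interpret E: group_mean "avg (perms_below k)" for k
    using mean_avg[OF finite_perms_below nonempty, where h = "\<lambda>s. s"] by (simp add: group_mean_def)
  interpret asymptotically_invariant_means "\<lambda>k. avg (perms_below k)"
  proof (rule asymptotically_invariant_means.intro)
    fix F :: "nat perm list \<Rightarrow> real" and gs assume "invariant_cochain F"
    then have F: "bounded_cochain F" by (simp add: invariant_cochain_def)
    have translate: "avg (perms_below k) (\<lambda>x. f (s + x)) = avg (perms_below k) f"
      if s: "s \<in> perms_below k" for s f k
    proof -
      have "bij_betw ((+) s) (perms_below k) (perms_below k)"
        by (rule bij_betw_byWitness[of _ "(+) (- s)"])
           (use plus_in_perms_below[OF s] plus_in_perms_below[OF uminus_in_perms_below[OF s]] in auto)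
      then show ?thesis by (rule avg_reindex)
    qed
    have "imean (avg (perms_below k)) gs F = imean (avg (perms_below k)) (replicate (length gs) 0) F"
      if "\<forall>g\<in>set gs. g \<in> perms_below k" for k
    proof -
      have "gs = map2 (+) (replicate (length gs) 0) gs" by (induction gs) simp_all
      moreover have "imean (avg (perms_below k)) (map2 (+) (replicate (length gs) 0) gs) F
          = imean (avg (perms_below k)) (replicate (length gs) 0) F"
        by (rule E.imean_right_translate[where B = "perms_below k"]) (use that translate F in auto)
      ultimately show ?thesis by simp
    qed
    moreover have "eventually (\<lambda>k. \<forall>g\<in>set gs. g \<in> perms_below k) sequentially"
      by (intro eventually_ball_finite) (auto intro: eventually_in_perms_below)
    ultimately show "(\<lambda>k. imean (avg (perms_below k)) gs F
        - imean (avg (perms_below k)) (replicate (length gs) 0) F) \<longlonglongrightarrow> 0"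
      by (intro tendsto_eventually) (auto elim!: eventually_mono)
  qed (rule E.group_mean_axioms)
  show ?thesis by (rule bounded_coboundary_of_cocycle[OF assms])
qed

section \<open>Cup and slant products\<close>

text \<open>The Eilenberg-Zilber map: the signed sum of \<open>P\<close> over all monotone lattice paths from the first to the
  last corner of the grid \<open>xs \<times> ys\<close>, whose points are read through \<open>e\<close>.\<close>

fun shuffle :: "('a \<Rightarrow> 'b \<Rightarrow> 'h) \<Rightarrow> 'a list \<Rightarrow> 'b list \<Rightarrow> ('h list \<Rightarrow> real) \<Rightarrow> real" where
  "shuffle e [] ys P = 0"
| "shuffle e (x # xs) [] P = (if xs = [] then P [] else 0)"
| "shuffle e (x # xs) (y # ys) P = shuffle e xs (y # ys) (\<lambda>l. P (e x y # l))
     + (-1) ^ length xs * shuffle e (x # xs) ys (\<lambda>l. P (e x y # l))"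

lemma shuffle_diff: "shuffle e xs ys (\<lambda>l. P l - Q l) = shuffle e xs ys P - shuffle e xs ys Q"
  by (induction e xs ys P arbitrary: Q rule: shuffle.induct) (simp_all add: right_diff_distrib)

lemma shuffle_zero [simp]: "shuffle e xs ys (\<lambda>_. 0) = 0"
  using shuffle_diff[of e xs ys "\<lambda>_. 0" "\<lambda>_. 0"] by simp

lemma shuffle_cong:
  "(\<And>l. Suc (length l) = length xs + length ys \<Longrightarrow> P l = Q l) \<Longrightarrow> shuffle e xs ys P = shuffle e xs ys Q"
proof (induction e xs ys P arbitrary: Q rule: shuffle.induct)
  case (3 e x xs y ys P)
  have "shuffle e xs (y # ys) (\<lambda>l. P (e x y # l)) = shuffle e xs (y # ys) (\<lambda>l. Q (e x y # l))"
    by (rule "3.IH"(1)) (use "3.prems" in auto)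
  moreover have "shuffle e (x # xs) ys (\<lambda>l. P (e x y # l)) = shuffle e (x # xs) ys (\<lambda>l. Q (e x y # l))"
    by (rule "3.IH"(2)) (use "3.prems" in auto)
  ultimately show ?case by simp
qed auto

lemma shuffle_map: "shuffle e (map u xs) (map v ys) P = shuffle (\<lambda>x y. e (u x) (v y)) xs ys P"
  by (induction "\<lambda>x y. e (u x) (v y)" xs ys P rule: shuffle.induct) auto

lemma shuffle_compose: "shuffle (\<lambda>x y. h (e x y)) xs ys P = shuffle e xs ys (\<lambda>l. P (map h l))"
  by (induction "\<lambda>x y. h (e x y)" xs ys P rule: shuffle.induct) auto

lemma shuffle_single: "shuffle e [x] ys P = P (map (e x) ys)"
  by (induction ys arbitrary: P) auto

lemma shuffle_abs_le:
  fixes C :: real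
  assumes "\<And>l. Suc (length l) = length xs + length ys \<Longrightarrow> \<bar>P l\<bar> \<le> C" "0 \<le> C"
  shows "\<bar>shuffle e xs ys P\<bar> \<le> 2 ^ (length xs + length ys) * C"
  using assms
proof (induction e xs ys P rule: shuffle.induct)
  case (2 e x xs P)
  have "1 * C \<le> 2 ^ (length (x # xs) + length ([] :: 'b list)) * C"
    using "2.prems"(2) by (intro mult_right_mono one_le_power) auto
  then show ?case using "2.prems" by auto
next
  case (3 e x xs y ys P)
  have "\<bar>shuffle e xs (y # ys) (\<lambda>l. P (e x y # l))\<bar> \<le> 2 ^ (length xs + length (y # ys)) * C"
    by (rule "3.IH"(1)) (use "3.prems" in auto)
  moreover have "\<bar>shuffle e (x # xs) ys (\<lambda>l. P (e x y # l))\<bar> \<le> 2 ^ (length (x # xs) + length ys) * C"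
    by (rule "3.IH"(2)) (use "3.prems" in auto)
  moreover have "\<bar>(-1) ^ length xs * shuffle e (x # xs) ys (\<lambda>l. P (e x y # l))\<bar>
      = \<bar>shuffle e (x # xs) ys (\<lambda>l. P (e x y # l))\<bar>"
    by (simp add: abs_mult power_abs)
  ultimately show ?case by simp
qed simp

lemma shuffle_cobound:
  "shuffle e xs ys (cobound P)
    = cobound (\<lambda>xs. shuffle e xs ys P) xs - (-1) ^ length xs * cobound (\<lambda>ys. shuffle e xs ys P) ys"
proof (induction e xs ys P rule: shuffle.induct)
  case (1 e ys P)
  show ?case by (simp add: cobound_const)
next
  case (2 e x xs P)
  show ?case by (cases xs) (simp_all add: cobound_const)
next
  case (3 e x xs y ys P)
  let ?P = "\<lambda>l. P (e x y # l)" and ?sign = "(-1 :: real) ^ length xs"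
  have "cobound (\<lambda>xs'. shuffle e (x # xs') (y # ys) P) xs
      = cobound (\<lambda>xs'. shuffle e xs' (y # ys) ?P + (- ?sign) * shuffle e (x # xs') ys ?P) xs"
  proof (rule cobound_cong)
    fix l :: "'a list" assume "Suc (length l) = length xs"
    then have "?sign = - ((-1) ^ length l)" by (metis mult_minus1 power_Suc)
    then show "shuffle e (x # l) (y # ys) P = shuffle e l (y # ys) ?P + (- ?sign) * shuffle e (x # l) ys ?P"
      by simp
  qed
  then have cobound_left: "cobound (\<lambda>xs'. shuffle e (x # xs') (y # ys) P) xs
      = cobound (\<lambda>xs'. shuffle e xs' (y # ys) ?P) xs - ?sign * cobound (\<lambda>xs'. shuffle e (x # xs') ys ?P) xs"
    unfolding cobound_add cobound_cmult by simp
  have cobound_right: "cobound (\<lambda>ys'. shuffle e (x # xs) (y # ys') P) ys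
      = cobound (\<lambda>ys'. shuffle e xs (y # ys') ?P) ys + ?sign * cobound (\<lambda>ys'. shuffle e (x # xs) ys' ?P) ys"
    by (simp add: cobound_add cobound_cmult)
  have "shuffle e (x # xs) (y # ys) (cobound P)
      = (shuffle e xs (y # ys) P - shuffle e xs (y # ys) (cobound ?P))
        + ?sign * (shuffle e (x # xs) ys P - shuffle e (x # xs) ys (cobound ?P))"
    by (simp add: shuffle_diff)
  then show ?case
    unfolding "3.IH" cobound.simps cobound_left cobound_right
    by (simp add: algebra_simps)
qed

definition cup :: "nat \<Rightarrow> ('g list \<Rightarrow> real) \<Rightarrow> ('g list \<Rightarrow> real) \<Rightarrow> 'g list \<Rightarrow> real" where
  "cup m F G xs = F (take (Suc m) xs) * G (drop m xs)"

lemma cobound_cup: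
  assumes "length xs \<ge> m + 2"
  shows "cobound (cup m F G) xs = cobound F (take (m + 2) xs) * G (drop (m + 1) xs)
    + (-1) ^ m * F (take (m + 1) xs) * cobound G (drop m xs)"
  using assms
proof (induction m arbitrary: F xs)
  case 0
  then obtain x y l where xs: "xs = x # y # l" by (metis Suc_le_length_iff add_0 numeral_2_eq_2)
  have "cobound (\<lambda>l. cup 0 F G (x # l)) (y # l) = cobound (\<lambda>l. F [x] * G (x # l)) (y # l)"
    by (rule cobound_cong) (simp add: cup_def)
  also have "\<dots> = F [x] * (G (y # l) - cobound G (x # y # l))"
    unfolding cobound_cmult by simp
  finally show ?case
    unfolding xs cobound.simps(2)[of "cup 0 F G" x]
    by (simp add: cup_def algebra_simps numeral_2_eq_2)
next
  case (Suc m)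
  then obtain x l where xs: "xs = x # l" "length l \<ge> m + 2" by (cases xs) auto
  have "cobound (\<lambda>l. cup (Suc m) F G (x # l)) l = cobound (cup m (\<lambda>l. F (x # l)) G) l"
    by (rule cobound_cong) (simp add: cup_def)
  also have "\<dots> = cobound (\<lambda>l. F (x # l)) (take (m + 2) l) * G (drop (m + 1) l)
      + (-1) ^ m * F (x # take (m + 1) l) * cobound G (drop m l)"
    by (rule Suc.IH) (rule xs)
  finally show ?case using xs by (simp add: cup_def algebra_simps)
qed

lemma bounded_cochain_cup:
  assumes "bounded_cochain F" "bounded_cochain G" shows "bounded_cochain (cup m F G)"
  unfolding bounded_cochain_def
proof
  fix n
  obtain C where C: "C \<ge> 0" "\<And>xs. length xs = min n (Suc m) \<Longrightarrow> \<bar>F xs\<bar> \<le> C"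
    using assms(1) by (rule bounded_cochainE[where n = "min n (Suc m)"]) blast
  obtain D where D: "\<And>xs. length xs = n - m \<Longrightarrow> \<bar>G xs\<bar> \<le> D"
    using assms(2) by (rule bounded_cochainE[where n = "n - m"]) blast
  have "\<bar>cup m F G xs\<bar> \<le> C * D" if "length xs = n" for xs
    unfolding cup_def abs_mult using that by (intro mult_mono C D) auto
  then show "\<exists>C. \<forall>xs. length xs = n \<longrightarrow> \<bar>cup m F G xs\<bar> \<le> C" by blast
qed

lemma bounded_cocycle_cup:
  assumes F: "bounded_cocycle m F" and G: "bounded_cocycle n G"
  shows "bounded_cocycle (m + n) (cup m F G)"
  unfolding bounded_cocycle_def
proof (intro conjI allI impI)
  show "invariant_cochain (cup m F G)"
    using F G by (simp add: bounded_cocycle_def invariant_cochain_def translation_invariant_def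
        bounded_cochain_cup) (simp add: cup_def take_map drop_map)
  fix xs :: "'a list" assume len: "length xs = m + n + 2"
  then have "length (take (m + 2) xs) = m + 2" "length (drop m xs) = n + 2" by auto
  then show "cobound (cup m F G) xs = 0"
    using cobound_cup[of m xs F G] F G len by (simp add: bounded_cocycle_def)
qed

definition normalized :: "('g list \<Rightarrow> real) \<Rightarrow> bool" where
  "normalized F \<longleftrightarrow> (\<forall>l x l'. F (l @ [x, x] @ l') = 0)"

text \<open>Only the lattice path that first runs through all of \<open>xs\<close> survives normalization.\<close>

lemma shuffle_cup:
  assumes r: "\<And>x y. r (e x y) = x" "\<And>x y. r' (e x y) = y" and "normalized F"
  shows "shuffle e (x # xs) (y # ys) (cup (length xs) (\<lambda>l. F (map r l)) (\<lambda>l. G (map r' l)))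
    = F (x # xs) * G (y # ys)"
  using assms(3)
proof (induction xs arbitrary: x F)
  case Nil
  have "map r (map (e x) l) = map (\<lambda>_. x) l" "map r' (map (e x) l) = l" for l
    using r by (simp_all add: comp_def)
  then show ?case unfolding shuffle_single cup_def by (simp add: r)
next
  case (Cons x' xs)
  let ?P = "cup (length (x' # xs)) (\<lambda>l. F (map r l)) (\<lambda>l. G (map r' l))"
  have normalized_tail: "normalized (\<lambda>l. F (x # l))"
    using Cons.prems unfolding normalized_def by (metis append_Cons)
  have tail: "(\<lambda>l. ?P (e x y # l)) = cup (length xs) (\<lambda>l. F (x # map r l)) (\<lambda>l. G (map r' l))"
    by (auto simp: cup_def r)
  have first_path: "shuffle e (x' # xs) (y # ys) (\<lambda>l. ?P (e x y # l)) = F (x # x' # xs) * G (y # ys)"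
    unfolding tail by (rule Cons.IH[OF normalized_tail])
  have other_paths: "shuffle e (x # x' # xs) ys (\<lambda>l. ?P (e x y # l)) = 0"
  proof (cases ys)
    case (Cons y' ys')
    have "F (x # x # l) = 0" for l
      using \<open>normalized F\<close> unfolding normalized_def by (metis append_Cons append_Nil)
    then have "?P (e x y # e x y' # l) = 0" for l by (simp add: cup_def r)
    then show ?thesis unfolding Cons shuffle.simps(3) by simp
  qed simp
  show ?case
    unfolding shuffle.simps(3)[of e x "x' # xs"] first_path other_paths
    by (simp only: mult_zero_right add_0_right)
qed

text \<open>The functional \<open>\<mu>\<close> plays the role of the evaluation on an \<open>n\<close>-cycle of finite norm.\<close>

locale bounded_cycle = linear_functional bounded_cochain \<mu>
  for n :: nat and \<mu> :: "('g::group_add list \<Rightarrow> real) \<Rightarrow> real" +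
  assumes ex_bound: "\<exists>K. \<forall>F C. bounded_cochain F \<longrightarrow>
      (\<forall>l. length l = n + 1 \<longrightarrow> \<bar>F l\<bar> \<le> C) \<longrightarrow> \<bar>\<mu> F\<bar> \<le> K * C"
    and cobound_eq_0: "invariant_cochain F \<Longrightarrow> \<mu> (cobound F) = 0"
begin

lemma boundE:
  obtains K where
    "\<And>F C. bounded_cochain F \<Longrightarrow> (\<And>l. length l = n + 1 \<Longrightarrow> \<bar>F l\<bar> \<le> C) \<Longrightarrow> \<bar>\<mu> F\<bar> \<le> K * C"
proof -
  from ex_bound obtain K where "\<forall>F C. bounded_cochain F \<longrightarrow>
      (\<forall>l. length l = n + 1 \<longrightarrow> \<bar>F l\<bar> \<le> C) \<longrightarrow> \<bar>\<mu> F\<bar> \<le> K * C" ..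
  then show ?thesis by (intro that[of K]) simp
qed

lemma cong:
  assumes "bounded_cochain F" "bounded_cochain G" "\<And>l. length l = n + 1 \<Longrightarrow> F l = G l"
  shows "\<mu> F = \<mu> G"
proof -
  obtain K where "\<And>F C. bounded_cochain F \<Longrightarrow> (\<And>l. length l = n + 1 \<Longrightarrow> \<bar>F l\<bar> \<le> C) \<Longrightarrow> \<bar>\<mu> F\<bar> \<le> K * C"
    by (rule boundE) blast
  from this[OF diff_mem[OF assms(1,2)], of 0] have "\<bar>\<mu> (\<lambda>l. F l - G l)\<bar> \<le> 0"
    using assms(3) by simp
  then show ?thesis using diff[OF assms(1,2)] by simp
qed

lemma bounded_coboundary_eq_0:
  assumes "bounded_coboundary n F" "bounded_cochain F" shows "\<mu> F = 0"
proof -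
  obtain B where B: "invariant_cochain B" "\<And>xs. length xs = n + 1 \<Longrightarrow> F xs = cobound B xs"
    using assms(1) by (auto simp: bounded_coboundary_def)
  have "\<mu> F = \<mu> (cobound B)"
    by (rule cong) (use B assms(2) in \<open>auto simp: invariant_cochain_def bounded_cochain_cobound\<close>)
  then show ?thesis by (simp add: cobound_eq_0[OF B(1)])
qed

end

locale commuting_homs =
  fixes s :: "'g::group_add \<Rightarrow> 'h::group_add" and s' :: "'k::group_add \<Rightarrow> 'h"
  assumes additive_s: "additive s" and additive_s': "additive s'"
    and commute: "s x + s' y = s' y + s x"
begin

abbreviation prod :: "'g \<Rightarrow> 'k \<Rightarrow> 'h" where
  "prod x y \<equiv> s x + s' y"

lemma shuffle_translate_left:
  assumes "translation_invariant P"
  shows "shuffle prod (map ((+) g) xs) ys P = shuffle prod xs ys P"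
proof -
  have "prod (g + x) y = s g + prod x y" for x y
    using additive_s by (simp add: additive_def add.assoc)
  then show ?thesis
    using shuffle_map[of prod "(+) g" xs "\<lambda>y. y" ys P] shuffle_compose[of "(+) (s g)" prod xs ys P] assms
    by (simp add: translation_invariant_def)
qed

lemma shuffle_translate_right:
  assumes "translation_invariant P"
  shows "shuffle prod xs (map ((+) g) ys) P = shuffle prod xs ys P"
proof -
  have "prod x (g + y) = s' g + prod x y" for x y
    using additive_s' commute[of x g] unfolding additive_def by (metis add.assoc)
  then show ?thesis
    using shuffle_map[of prod "\<lambda>x. x" xs "(+) g" ys P] shuffle_compose[of "(+) (s' g)" prod xs ys P] assms
    by (simp add: translation_invariant_def)
qed

lemma shuffle_bound:
  assumes "bounded_cochain P"
  obtains C where "\<And>xs ys. length xs = m \<Longrightarrow> length ys = k \<Longrightarrow> \<bar>shuffle prod xs ys P\<bar> \<le> C"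
proof -
  obtain C where "C \<ge> 0" "\<And>l. length l = m + k - 1 \<Longrightarrow> \<bar>P l\<bar> \<le> C"
    using assms by (rule bounded_cochainE[where n = "m + k - 1"]) blast
  then have "\<bar>shuffle prod xs ys P\<bar> \<le> 2 ^ (m + k) * C" if "length xs = m" "length ys = k" for xs ys
    using shuffle_abs_le[of xs ys P C prod] that by simp
  then show ?thesis by (rule that)
qed

lemma bounded_cochain_shuffle_left:
  assumes "bounded_cochain P" shows "bounded_cochain (\<lambda>xs. shuffle prod xs ys P)"
  unfolding bounded_cochain_def
proof
  fix m
  obtain C where "\<And>xs zs. length xs = m \<Longrightarrow> length zs = length ys \<Longrightarrow> \<bar>shuffle prod xs zs P\<bar> \<le> C"
    using assms by (rule shuffle_bound[where m = m and k = "length ys"]) blast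
  then show "\<exists>C. \<forall>xs. length xs = m \<longrightarrow> \<bar>shuffle prod xs ys P\<bar> \<le> C" by blast
qed

lemma invariant_cochain_shuffle_left:
  "invariant_cochain P \<Longrightarrow> invariant_cochain (\<lambda>xs. shuffle prod xs ys P)"
  using bounded_cochain_shuffle_left shuffle_translate_left
  by (simp add: invariant_cochain_def translation_invariant_def)

end

locale slant_product = bounded_cycle n \<mu> + commuting_homs s s'
  for n :: nat and \<mu> :: "('g::group_add list \<Rightarrow> real) \<Rightarrow> real"
    and s :: "'g \<Rightarrow> 'h::group_add" and s' :: "'k::group_add \<Rightarrow> 'h"
begin

definition slant :: "('h list \<Rightarrow> real) \<Rightarrow> 'k list \<Rightarrow> real" where
  "slant P ys = \<mu> (\<lambda>xs. shuffle prod xs ys P)"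

lemma invariant_cochain_slant:
  assumes P: "invariant_cochain P" shows "invariant_cochain (slant P)"
proof -
  have P_bounded: "bounded_cochain P" using P by (simp add: invariant_cochain_def)
  obtain K where K: "\<And>F C. bounded_cochain F \<Longrightarrow> (\<And>l. length l = n + 1 \<Longrightarrow> \<bar>F l\<bar> \<le> C) \<Longrightarrow> \<bar>\<mu> F\<bar> \<le> K * C"
    by (rule boundE) blast
  have "\<exists>C. \<forall>ys. length ys = k \<longrightarrow> \<bar>slant P ys\<bar> \<le> C" for k
  proof -
    obtain C where "\<And>xs ys. length xs = n + 1 \<Longrightarrow> length ys = k \<Longrightarrow> \<bar>shuffle prod xs ys P\<bar> \<le> C"
      using P_bounded by (rule shuffle_bound[where m = "n + 1" and k = k]) blast
    then have "\<bar>slant P ys\<bar> \<le> K * C" if "length ys = k" for ys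
      unfolding slant_def using that by (intro K[OF bounded_cochain_shuffle_left[OF P_bounded]]) simp
    then show ?thesis by blast
  qed
  then show ?thesis
    using P shuffle_translate_right
    by (simp add: invariant_cochain_def bounded_cochain_def translation_invariant_def slant_def)
qed

lemma cobound_slant:
  assumes P: "invariant_cochain P"
  shows "cobound (slant P) ys = (-1) ^ n * \<mu> (\<lambda>xs. shuffle prod xs ys (cobound P))"
proof -
  let ?F = "\<lambda>xs. shuffle prod xs ys P" and ?G = "\<lambda>xs. cobound (\<lambda>ys. shuffle prod xs ys P) ys"
  have F: "bounded_cochain (\<lambda>xs. shuffle prod xs ys P)"
    "invariant_cochain (\<lambda>xs. shuffle prod xs ys P)" for ys
    using P invariant_cochain_shuffle_left bounded_cochain_shuffle_left
    by (auto simp: invariant_cochain_def)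
  have slant: "cobound (slant P) ys = \<mu> ?G" and G: "bounded_cochain ?G"
    using cobound_commute[of ys "\<lambda>xs ys. shuffle prod xs ys P"] F(1) by (simp_all add: slant_def[abs_def])
  have cobound_F: "bounded_cochain (cobound ?F)" by (rule bounded_cochain_cobound[OF F(1)])
  have shuffle_eq: "shuffle prod xs ys (cobound P) = cobound ?F xs + (- ((-1) ^ length xs)) * ?G xs" for xs
    by (simp add: shuffle_cobound)
  have "bounded_cochain (\<lambda>xs. shuffle prod xs ys (cobound P))"
    using P by (simp add: invariant_cochain_def bounded_cochain_shuffle_left bounded_cochain_cobound)
  then have "\<mu> (\<lambda>xs. shuffle prod xs ys (cobound P)) = \<mu> (\<lambda>xs. cobound ?F xs + (-1) ^ n * ?G xs)"
    by (rule cong) (use add_mem cmult_mem cobound_F G shuffle_eq in auto)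
  also have "\<dots> = (-1) ^ n * \<mu> ?G"
    using add[OF cobound_F cmult_mem[OF G]] cmult[OF G] cobound_eq_0[OF F(2)] by simp
  finally show ?thesis by (simp add: slant flip: power_mult_distrib mult.assoc)
qed

theorem cup_not_bounded_coboundary:
  assumes r: "\<And>x y. r (prod x y) = x" "\<And>x y. r' (prod x y) = y"
    and F: "bounded_cochain F" "normalized F" "\<mu> F \<noteq> 0" and G: "\<not> bounded_coboundary k G"
  shows "\<not> bounded_coboundary (n + k) (cup n (\<lambda>l. F (map r l)) (\<lambda>l. G (map r' l)))"
proof
  let ?cup = "cup n (\<lambda>l. F (map r l)) (\<lambda>l. G (map r' l))"
  assume "bounded_coboundary (n + k) ?cup"
  then obtain P where P: "invariant_cochain P" "\<And>l. length l = n + k + 1 \<Longrightarrow> ?cup l = cobound P l"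
    by (auto simp: bounded_coboundary_def)
  have "cobound (slant P) ys = (-1) ^ n * \<mu> F * G ys" if ys: "length ys = k + 1" for ys
  proof -
    have shuffle_eq: "shuffle prod xs ys (cobound P) = G ys * F xs" if xs: "length xs = n + 1" for xs
    proof -
      obtain x xs' y ys' where "xs = x # xs'" "length xs' = n" "ys = y # ys'"
        using xs ys by (auto simp: length_Suc_conv)
      moreover have "shuffle prod xs ys (cobound P) = shuffle prod xs ys ?cup"
        by (rule shuffle_cong) (use xs ys P(2) in auto)
      ultimately show ?thesis using shuffle_cup[of r prod r' F x xs' y ys' G] r F(2) by simp
    qed
    have "bounded_cochain (\<lambda>xs. shuffle prod xs ys (cobound P))"
      using P(1) by (simp add: invariant_cochain_def bounded_cochain_shuffle_left bounded_cochain_cobound)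
    then have "\<mu> (\<lambda>xs. shuffle prod xs ys (cobound P)) = \<mu> (\<lambda>xs. G ys * F xs)"
      by (rule cong) (use F(1) cmult_mem shuffle_eq in auto)
    then show ?thesis using cobound_slant[OF P(1), of ys] cmult[OF F(1)] by simp
  qed
  then have G_eq: "(-1) ^ n / \<mu> F * cobound (slant P) ys = G ys" if "length ys = k + 1" for ys
    using that F(3) by (simp flip: power_mult_distrib mult.assoc)
  have "bounded_coboundary k (\<lambda>ys. (-1) ^ n / \<mu> F * cobound (slant P) ys)"
    by (intro bounded_coboundary_cmult bounded_coboundary_cobound invariant_cochain_slant P(1))
  then have "bounded_coboundary k G"
    by (rule bounded_coboundary_cong[THEN iffD1, rotated]) (rule G_eq)
  then show False using G by contradiction
qed

end

section \<open>Invariant means for commuting maps\<close>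

definition orbit_mean :: "('x \<Rightarrow> 'x) \<Rightarrow> ('x \<Rightarrow> real) \<Rightarrow> 'x \<Rightarrow> real" where
  "orbit_mean T f x = generalized_limit (\<lambda>N. avg {..N} (\<lambda>k. f ((T ^^ k) x)))"

lemma mean_orbit_mean: "mean (\<lambda>f. orbit_mean T f x)"
  unfolding orbit_mean_def
  by (rule mean_compose[OF mean_generalized_limit, of "\<lambda>N. avg {..N}" "\<lambda>_ k. (T ^^ k) x"])
     (rule mean_avg[where h = "\<lambda>k. k"], auto)

lemma bounded_fun_orbit_mean: "bounded_fun f \<Longrightarrow> bounded_fun (orbit_mean T f)"
  by (auto simp: bounded_fun_iff intro: mean.abs_le[OF mean_orbit_mean])

lemma orbit_mean_cong:
  assumes "x \<in> S" "\<And>x. x \<in> S \<Longrightarrow> T x \<in> S" "\<And>x. x \<in> S \<Longrightarrow> f x = g x"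
  shows "orbit_mean T f x = orbit_mean T g x"
proof -
  have "(T ^^ k) x \<in> S" for k by (induction k) (use assms in auto)
  then show ?thesis by (simp add: orbit_mean_def assms(3))
qed

lemma orbit_mean_commute:
  assumes "\<And>x. R (T x) = T (R x)"
  shows "orbit_mean T (\<lambda>x. f (R x)) = (\<lambda>x. orbit_mean T f (R x))"
proof -
  have "R ((T ^^ k) x) = (T ^^ k) (R x)" for k x by (induction k) (simp_all add: assms)
  then show ?thesis by (simp add: orbit_mean_def fun_eq_iff)
qed

lemma orbit_mean_invariant:
  assumes "bounded_fun f" shows "orbit_mean T (\<lambda>x. f (T x)) = orbit_mean T f"
proof
  fix x
  obtain C where C: "\<And>x. \<bar>f x\<bar> \<le> C" using assms by (auto simp: bounded_fun_iff)
  let ?avg = "\<lambda>f N. avg {..N} (\<lambda>k. f ((T ^^ k) x))"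
  have avg_bounded: "bounded_fun (?avg g)" if "\<And>x. \<bar>g x\<bar> \<le> C" for g
    by (intro bounded_funI[of _ C] avg_abs_le) (auto simp: that)
  have "?avg (\<lambda>x. f (T x)) N - ?avg f N = (f ((T ^^ Suc N) x) - f x) / real (Suc N)" for N
    using sum_lessThan_telescope[of "\<lambda>k. f ((T ^^ k) x)" "Suc N"]
    by (simp add: avg_def sum_subtractf lessThan_Suc_atMost diff_divide_distrib[symmetric]
        del: sum.lessThan_Suc sum.atMost_Suc)
  moreover have "\<bar>f ((T ^^ Suc N) x) - f x\<bar> \<le> 2 * C" for N
    using C[of "(T ^^ Suc N) x"] C[of x] by linarith
  ultimately have bound: "\<bar>?avg (\<lambda>x. f (T x)) N - ?avg f N\<bar> \<le> 2 * C * inverse (real (Suc N))" for N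
    by (simp add: divide_right_mono flip: divide_inverse)
  have "(\<lambda>N. ?avg (\<lambda>x. f (T x)) N - ?avg f N) \<longlonglongrightarrow> 0"
    by (rule Lim_null_comparison[OF always_eventually
          tendsto_mult_right_zero[OF LIMSEQ_inverse_real_of_nat, of "2 * C"]]) (use bound in simp)
  then have "generalized_limit (\<lambda>N. ?avg (\<lambda>x. f (T x)) N - ?avg f N) = 0"
    by (rule generalized_limit_eq)
  then show "orbit_mean T (\<lambda>x. f (T x)) x = orbit_mean T f x"
    using generalized_limit.diff[OF avg_bounded avg_bounded, of "\<lambda>x. f (T x)" f] C
    by (simp add: orbit_mean_def)
qed

primrec iterated_orbit_mean :: "(nat \<Rightarrow> 'x \<Rightarrow> 'x) \<Rightarrow> nat \<Rightarrow> ('x \<Rightarrow> real) \<Rightarrow> 'x \<Rightarrow> real" where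
  "iterated_orbit_mean T 0 f = f"
| "iterated_orbit_mean T (Suc n) f = iterated_orbit_mean T n (orbit_mean (T n) f)"

lemma mean_iterated_orbit_mean: "mean (\<lambda>f. iterated_orbit_mean T n f x)"
proof (induction n)
  case 0
  show ?case by (rule meanI) auto
next
  case (Suc n)
  show ?case
    using mean_compose[OF Suc, where m = "\<lambda>y f. orbit_mean (T n) f y" and h = "\<lambda>_ u. u", OF mean_orbit_mean]
    by simp
qed

lemma iterated_orbit_mean_cong:
  assumes "x \<in> S" "\<And>n x. x \<in> S \<Longrightarrow> T n x \<in> S" "\<And>x. x \<in> S \<Longrightarrow> f x = g x"
  shows "iterated_orbit_mean T n f x = iterated_orbit_mean T n g x"
  using assms(3)
proof (induction n arbitrary: f g)
  case (Suc n)
  have "orbit_mean (T n) f y = orbit_mean (T n) g y" if "y \<in> S" for y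
    by (rule orbit_mean_cong[OF that]) (use assms(2) Suc.prems in auto)
  then show ?case unfolding iterated_orbit_mean.simps by (rule Suc.IH)
qed (use assms(1) in simp)

lemma iterated_orbit_mean_invariant:
  assumes "\<And>i j x. T i (T j x) = T j (T i x)" and "i < n" "bounded_fun f"
  shows "iterated_orbit_mean T n (\<lambda>x. f (T i x)) = iterated_orbit_mean T n f"
  using assms(2,3)
proof (induction n arbitrary: f)
  case (Suc n)
  show ?case
  proof (cases "i = n")
    case True
    then show ?thesis by (simp add: orbit_mean_invariant[OF Suc.prems(2)])
  next
    case False
    then show ?thesis
      using Suc.IH[OF _ bounded_fun_orbit_mean[OF Suc.prems(2)]] Suc.prems(1)
      by (simp add: orbit_mean_commute assms(1))
  qed
qed simp

lemma ex_commuting_invariant_mean: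
  fixes T :: "'i::countable \<Rightarrow> 'x \<Rightarrow> 'x"
  assumes S: "x0 \<in> S" "\<And>i x. x \<in> S \<Longrightarrow> T i x \<in> S" and comm: "\<And>i j x. T i (T j x) = T j (T i x)"
  shows "\<exists>m. mean m \<and> (\<forall>i f. bounded_fun f \<longrightarrow> m (\<lambda>x. f (T i x)) = m f)
    \<and> (\<forall>f g. (\<forall>x\<in>S. f x = g x) \<longrightarrow> m f = m g)"
proof (intro exI conjI allI impI)
  define U where "U n = T (from_nat n)" for n
  define m where "m f = generalized_limit (\<lambda>n. iterated_orbit_mean U n f x0)" for f
  have U_comm: "U i (U j x) = U j (U i x)" for i j x by (simp add: U_def comm)
  show "mean m" unfolding m_def
    using mean_compose[OF mean_generalized_limit, where m = "\<lambda>n f. iterated_orbit_mean U n f x0"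
        and h = "\<lambda>_ u. u", OF mean_iterated_orbit_mean]
    by simp
  have iterated_eq: "iterated_orbit_mean U n f x0 = iterated_orbit_mean U n g x0"
    if "\<forall>x\<in>S. f x = g x" for f g n
    by (rule iterated_orbit_mean_cong[of _ S]) (use S that in \<open>auto simp: U_def\<close>)
  show "m f = m g" if "\<forall>x\<in>S. f x = g x" for f g
    by (simp only: m_def iterated_eq[OF that])
  fix i and f :: "'x \<Rightarrow> real" assume f: "bounded_fun f"
  let ?P = "\<lambda>f n. iterated_orbit_mean U n f x0"
  have P_bounded: "bounded_fun (?P g)" if "bounded_fun g" for g
    using that by (auto simp: bounded_fun_iff intro: mean.abs_le[OF mean_iterated_orbit_mean])
  have "?P (\<lambda>x. f (T i x)) n - ?P f n = 0" if "n > to_nat i" for n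
    using iterated_orbit_mean_invariant[of U, OF U_comm that f] by (simp add: U_def)
  then have "(\<lambda>n. ?P (\<lambda>x. f (T i x)) n - ?P f n) \<longlonglongrightarrow> 0"
    by (intro tendsto_eventually eventually_sequentiallyI[of "Suc (to_nat i)"]) simp
  then have "generalized_limit (\<lambda>n. ?P (\<lambda>x. f (T i x)) n - ?P f n) = 0"
    by (rule generalized_limit_eq)
  then show "m (\<lambda>x. f (T i x)) = m f"
    using generalized_limit.diff[OF P_bounded[OF bounded_fun_compose[OF f, of "T i"]] P_bounded[OF f]]
    by (simp add: m_def)
qed

section \<open>Matrix groups of rank two and their Borel subgroups\<close>

text \<open>The admissible determinants are the positive ones over the rationals and all nonzero ones over the
  Gaussian rationals.\<close>

class det_field = field +
  fixes admissible :: "'a \<Rightarrow> bool"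
  assumes admissible_nonzero: "admissible x \<Longrightarrow> x \<noteq> 0"
    and admissible_1: "admissible 1"
    and admissible_mult: "admissible x \<Longrightarrow> admissible y \<Longrightarrow> admissible (x * y)"
    and admissible_inverse: "admissible x \<Longrightarrow> admissible (inverse x)"

typedef (overloaded) 'k gl2 = "{(a, b, c, d). admissible (a * d - b * c :: 'k::det_field)}"
  morphisms entries Abs_gl2
  by (rule exI[of _ "(1, 0, 0, 1)"]) (simp add: admissible_1)

definition Mat :: "'k::det_field \<Rightarrow> 'k \<Rightarrow> 'k \<Rightarrow> 'k \<Rightarrow> 'k gl2" where
  "Mat a b c d = Abs_gl2 (a, b, c, d)"

definition m11 :: "'k::det_field gl2 \<Rightarrow> 'k" where "m11 x = fst (entries x)"
definition m12 :: "'k::det_field gl2 \<Rightarrow> 'k" where "m12 x = fst (snd (entries x))"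
definition m21 :: "'k::det_field gl2 \<Rightarrow> 'k" where "m21 x = fst (snd (snd (entries x)))"
definition m22 :: "'k::det_field gl2 \<Rightarrow> 'k" where "m22 x = snd (snd (snd (entries x)))"

lemma Mat_entries:
  assumes "admissible (a * d - b * c)"
  shows "m11 (Mat a b c d) = a" "m12 (Mat a b c d) = b" "m21 (Mat a b c d) = c" "m22 (Mat a b c d) = d"
  using assms by (simp_all add: m11_def m12_def m21_def m22_def Mat_def Abs_gl2_inverse)

lemma gl2_eqI: "m11 x = m11 y \<Longrightarrow> m12 x = m12 y \<Longrightarrow> m21 x = m21 y \<Longrightarrow> m22 x = m22 y \<Longrightarrow> x = y"
  unfolding m11_def m12_def m21_def m22_def by (metis prod.collapse entries_inject)

definition gl2_det :: "'k::det_field gl2 \<Rightarrow> 'k" where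
  "gl2_det x = m11 x * m22 x - m12 x * m21 x"

lemma admissible_gl2_det: "admissible (gl2_det x)"
  using entries[of x] by (auto simp: gl2_det_def m11_def m12_def m21_def m22_def)

lemma gl2_det_nonzero: "gl2_det x \<noteq> 0"
  using admissible_gl2_det admissible_nonzero by blast

instantiation gl2 :: (det_field) group_add
begin

definition zero_gl2 :: "'a gl2" where "zero_gl2 = Mat 1 0 0 1"

definition plus_gl2 :: "'a gl2 \<Rightarrow> 'a gl2 \<Rightarrow> 'a gl2" where
  "plus_gl2 x y = Mat (m11 x * m11 y + m12 x * m21 y) (m11 x * m12 y + m12 x * m22 y)
     (m21 x * m11 y + m22 x * m21 y) (m21 x * m12 y + m22 x * m22 y)"

definition uminus_gl2 :: "'a gl2 \<Rightarrow> 'a gl2" where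
  "uminus_gl2 x = (let i = inverse (gl2_det x) in Mat (i * m22 x) (- i * m12 x) (- i * m21 x) (i * m11 x))"

definition minus_gl2 :: "'a gl2 \<Rightarrow> 'a gl2 \<Rightarrow> 'a gl2" where "minus_gl2 x y = x + (- y)"

lemma plus_gl2_entries:
  fixes x y :: "'a gl2"
  shows "m11 (x + y) = m11 x * m11 y + m12 x * m21 y" "m12 (x + y) = m11 x * m12 y + m12 x * m22 y"
    "m21 (x + y) = m21 x * m11 y + m22 x * m21 y" "m22 (x + y) = m21 x * m12 y + m22 x * m22 y"
proof -
  have "admissible (gl2_det x * gl2_det y)"
    by (intro admissible_mult admissible_gl2_det)
  also have "gl2_det x * gl2_det y
      = (m11 x * m11 y + m12 x * m21 y) * (m21 x * m12 y + m22 x * m22 y)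
        - (m11 x * m12 y + m12 x * m22 y) * (m21 x * m11 y + m22 x * m21 y)"
    by (simp add: gl2_det_def algebra_simps)
  finally show "m11 (x + y) = m11 x * m11 y + m12 x * m21 y" "m12 (x + y) = m11 x * m12 y + m12 x * m22 y"
    "m21 (x + y) = m21 x * m11 y + m22 x * m21 y" "m22 (x + y) = m21 x * m12 y + m22 x * m22 y"
    unfolding plus_gl2_def by (simp_all add: Mat_entries)
qed

lemma zero_gl2_entries: "m11 (0 :: 'a gl2) = 1" "m12 (0 :: 'a gl2) = 0" "m21 (0 :: 'a gl2) = 0"
  "m22 (0 :: 'a gl2) = 1"
  by (simp_all add: zero_gl2_def Mat_entries admissible_1)

lemma uminus_gl2_entries:
  fixes x :: "'a gl2"
  defines "i \<equiv> inverse (gl2_det x)"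
  shows "m11 (- x) = i * m22 x" "m12 (- x) = - i * m12 x" "m21 (- x) = - i * m21 x" "m22 (- x) = i * m11 x"
proof -
  have "admissible i" unfolding i_def by (intro admissible_inverse admissible_gl2_det)
  also have "i = i * (i * gl2_det x)" using gl2_det_nonzero[of x] by (simp add: i_def)
  also have "\<dots> = (i * m22 x) * (i * m11 x) - (- i * m12 x) * (- i * m21 x)"
    by (simp add: gl2_det_def algebra_simps)
  finally show "m11 (- x) = i * m22 x" "m12 (- x) = - i * m12 x" "m21 (- x) = - i * m21 x"
    "m22 (- x) = i * m11 x"
    unfolding uminus_gl2_def Let_def i_def by (simp_all only: Mat_entries)
qed

instance
proof
  fix x y z :: "'a gl2"
  show "x + y + z = x + (y + z)" by (rule gl2_eqI) (simp_all add: plus_gl2_entries algebra_simps)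
  show "0 + x = x" "x + 0 = x" by (rule gl2_eqI; simp add: plus_gl2_entries zero_gl2_entries)+
  let ?i = "inverse (gl2_det x)"
  have det: "?i * gl2_det x = 1" using gl2_det_nonzero[of x] by simp
  show "- x + x = 0"
  proof (rule gl2_eqI)
    have "m11 (- x + x) = ?i * gl2_det x" "m22 (- x + x) = ?i * gl2_det x"
      by (simp_all only: plus_gl2_entries uminus_gl2_entries gl2_det_def) (simp_all add: algebra_simps)
    then show "m11 (- x + x) = m11 0" "m22 (- x + x) = m22 0"
      by (simp_all only: det zero_gl2_entries)
  qed (simp_all add: plus_gl2_entries uminus_gl2_entries zero_gl2_entries)
  show "x + - y = x - y" by (simp add: minus_gl2_def)
qed

end

instance gl2 :: ("{det_field, countable}") countable
  by (rule countable_classI[of "to_nat \<circ> entries"]) (simp add: entries_inject)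

text \<open>The first columns of two matrices represent the same point of the projective line if and only if
  their \<open>column_det\<close> vanishes.\<close>

definition column_det :: "'k::det_field gl2 \<Rightarrow> 'k gl2 \<Rightarrow> 'k" where
  "column_det x y = m11 x * m21 y - m21 x * m11 y"

lemma column_det_plus: "column_det (g + x) (g + y) = gl2_det g * column_det x y"
  by (simp add: column_det_def gl2_det_def plus_gl2_entries algebra_simps)

lemma column_det_self [simp]: "column_det x x = 0"
  by (simp add: column_det_def)

lemma column_det_swap: "column_det y x = - column_det x y"
  by (simp add: column_det_def algebra_simps)

lemma column_det_plucker:
  "column_det x y * column_det z w - column_det x z * column_det y w + column_det x w * column_det y z = 0"
  by (simp add: column_det_def algebra_simps)

lemma column_nonzero: "m11 x \<noteq> 0 \<or> m21 x \<noteq> 0"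
  using gl2_det_nonzero[of x] by (auto simp: gl2_det_def)

lemma column_det_0E:
  assumes "column_det x y = 0"
  obtains k where "k \<noteq> 0" "m11 y = k * m11 x" "m21 y = k * m21 x"
proof (cases "m11 x = 0")
  case True
  then have "m21 x \<noteq> 0" using column_nonzero by blast
  moreover from this have "m11 y = 0" using assms True by (simp add: column_det_def)
  moreover from this have "m21 y \<noteq> 0" using column_nonzero by blast
  ultimately show ?thesis using True by (intro that[of "m21 y / m21 x"]) auto
next
  case False
  then have "m21 y = m11 y / m11 x * m21 x" using assms by (simp add: column_det_def field_simps)
  moreover from this have "m11 y \<noteq> 0" using column_nonzero[of y] by auto
  ultimately show ?thesis using False by (intro that[of "m11 y / m11 x"]) auto
qed

lemma m21_minus_plus_eq_0: "m21 (- x + y) = 0 \<longleftrightarrow> column_det x y = 0"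
proof -
  have "m21 (- x + y) = inverse (gl2_det x) * column_det x y"
    by (simp add: plus_gl2_entries uminus_gl2_entries column_det_def algebra_simps)
  then show ?thesis using gl2_det_nonzero[of x] by simp
qed

definition parallel :: "'k::det_field gl2 list \<Rightarrow> 'k gl2 list \<Rightarrow> bool" where
  "parallel l l' \<longleftrightarrow> list_all2 (\<lambda>x y. column_det x y = 0) l l'"

lemma parallel_refl: "parallel l l"
  by (simp add: parallel_def list_all2_refl)

lemma parallel_simps [simp]:
  "parallel [] l' \<longleftrightarrow> l' = []"
  "parallel (x # l) (y # l') \<longleftrightarrow> column_det x y = 0 \<and> parallel l l'"
  by (auto simp: parallel_def)

section \<open>Detecting classes by averaging over a Borel subgroup\<close>

locale borel_mean = group_mean m for m :: "('k::det_field gl2 \<Rightarrow> real) \<Rightarrow> real" +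
  assumes borel_invariant: "m21 b = 0 \<Longrightarrow> bounded_fun f \<Longrightarrow> m (\<lambda>x. f (b + x)) = m f"
    and concentrated: "(\<And>x. m21 x = 0 \<Longrightarrow> f x = c) \<Longrightarrow> m f = c"

lemma ex_translation_invariant_mean:
  "\<exists>m :: ('a::{ab_group_add, countable} \<Rightarrow> real) \<Rightarrow> real.
    mean m \<and> (\<forall>v f. bounded_fun f \<longrightarrow> m (\<lambda>u. f (u + v)) = m f)"
  using ex_commuting_invariant_mean[of 0 UNIV "\<lambda>v u :: 'a. u + v"]
  by (auto simp: ac_simps)

definition torus :: "('k::det_field \<times> 'k) set" where
  "torus = {(a, d). admissible (a * d)}"

lemma ex_torus_invariant_mean:
  "\<exists>m :: ('k::{det_field, countable} \<times> 'k \<Rightarrow> real) \<Rightarrow> real. mean m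
    \<and> (\<forall>a d f. (a, d) \<in> torus \<longrightarrow> bounded_fun f \<longrightarrow> m (\<lambda>(a', d'). f (a * a', d * d')) = m f)
    \<and> (\<forall>f g. (\<forall>q\<in>torus. f q = g q) \<longrightarrow> m f = m g)"
proof -
  define T where "T p q = (if p \<in> torus then (fst p * fst q, snd p * snd q) else q)" for p q :: "'k \<times> 'k"
  have "T p q \<in> torus" if "q \<in> torus" for p q
  proof (cases "p \<in> torus")
    case True
    then have "admissible ((fst p * snd p) * (fst q * snd q))"
      using that admissible_mult[of "fst p * snd p" "fst q * snd q"] by (auto simp: torus_def)
    then show ?thesis using True by (simp add: T_def torus_def mult_ac)
  qed (simp add: T_def that)
  moreover have "(1, 1) \<in> torus" by (simp add: torus_def admissible_1)
  moreover have "T p (T q r) = T q (T p r)" for p q r by (simp add: T_def mult_ac)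
  ultimately obtain m where m: "mean m" "\<And>p f. bounded_fun f \<Longrightarrow> m (\<lambda>q. f (T p q)) = m f"
    "\<And>f g. (\<forall>q\<in>torus. f q = g q) \<Longrightarrow> m f = m g"
    using ex_commuting_invariant_mean[of "(1, 1)" torus T] by blast
  have "m (\<lambda>(a', d'). f (a * a', d * d')) = m f" if "(a, d) \<in> torus" "bounded_fun f" for a d f
    using m(2)[OF that(2), of "(a, d)"] that(1) by (simp add: T_def case_prod_unfold)
  then show ?thesis using m(1,3) by blast
qed

lemma upper_triangular_plus_Mat:
  assumes b: "m21 b = 0" and a: "admissible (a * d)"
  shows "b + Mat a (a * u) 0 d
    = Mat (m11 b * a) ((m11 b * a) * (u + m12 b * d / (m11 b * a))) 0 (m22 b * d)"
proof -
  have b_diag: "admissible (m11 b * m22 b)" using admissible_gl2_det[of b] b by (simp add: gl2_det_def)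
  have "m11 b \<noteq> 0" "a \<noteq> 0" using admissible_nonzero[OF b_diag] admissible_nonzero[OF a] by auto
  moreover have "admissible ((m11 b * a) * (m22 b * d))"
    using admissible_mult[OF b_diag a] by (simp add: mult_ac)
  ultimately show ?thesis
    by (intro gl2_eqI) (use a b in \<open>simp_all add: plus_gl2_entries Mat_entries distrib_left\<close>)
qed

definition unipotent_mean :: "(('k::det_field \<Rightarrow> real) \<Rightarrow> real) \<Rightarrow> ('k gl2 \<Rightarrow> real) \<Rightarrow> 'k \<times> 'k \<Rightarrow> real" where
  "unipotent_mean M f q = M (\<lambda>u. f (Mat (fst q) (fst q * u) 0 (snd q)))"

lemma unipotent_mean_left_translate:
  assumes M: "\<And>v f. bounded_fun f \<Longrightarrow> M (\<lambda>u. f (u + v)) = M f"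
    and b: "m21 b = 0" and f: "bounded_fun f" and q: "q \<in> torus"
  shows "unipotent_mean M (\<lambda>x. f (b + x)) q = unipotent_mean M f (m11 b * fst q, m22 b * snd q)"
proof -
  have "admissible (fst q * snd q)" using q by (auto simp: torus_def)
  then show ?thesis
    unfolding unipotent_mean_def upper_triangular_plus_Mat[OF b \<open>admissible (fst q * snd q)\<close>]
    using M[OF bounded_fun_compose[OF f]] by simp
qed

lemma ex_borel_mean: "\<exists>m :: ('k::{det_field, countable} gl2 \<Rightarrow> real) \<Rightarrow> real. borel_mean m"
proof -
  obtain M :: "('k \<Rightarrow> real) \<Rightarrow> real"
    where M: "mean M" "\<And>v f. bounded_fun f \<Longrightarrow> M (\<lambda>u. f (u + v)) = M f"
    using ex_translation_invariant_mean by blast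
  obtain N :: "('k \<times> 'k \<Rightarrow> real) \<Rightarrow> real"
    where N: "mean N" "\<And>f g. (\<And>q. q \<in> torus \<Longrightarrow> f q = g q) \<Longrightarrow> N f = N g"
      "\<And>a d f. (a, d) \<in> torus \<Longrightarrow> bounded_fun f \<Longrightarrow> N (\<lambda>(a', d'). f (a * a', d * d')) = N f"
    using ex_torus_invariant_mean by blast
  have "mean (\<lambda>f. N (unipotent_mean M f))"
    unfolding unipotent_mean_def[abs_def]
    by (rule mean_compose[OF N(1), of "\<lambda>_. M"]) (rule M(1))
  moreover have "N (unipotent_mean M (\<lambda>x. f (b + x))) = N (unipotent_mean M f)"
    if b: "m21 b = 0" and f: "bounded_fun f" for b f
  proof -
    have bounded: "bounded_fun (unipotent_mean M f)"
      using f by (auto simp: bounded_fun_iff unipotent_mean_def intro: mean.abs_le[OF M(1)])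
    have "N (unipotent_mean M (\<lambda>x. f (b + x))) = N (\<lambda>(a', d'). unipotent_mean M f (m11 b * a', m22 b * d'))"
      using unipotent_mean_left_translate[where M = M, OF M(2) b f]
      by (intro N(2)) (auto simp: case_prod_unfold)
    also have "\<dots> = N (unipotent_mean M f)"
      using admissible_gl2_det[of b] b by (intro N(3) bounded) (simp add: torus_def gl2_det_def)
    finally show ?thesis .
  qed
  moreover have "N (unipotent_mean M f) = c" if f: "\<And>x. m21 x = 0 \<Longrightarrow> f x = c" for f c
  proof -
    have "unipotent_mean M f q = c" if "q \<in> torus" for q
      using that f mean.const[OF M(1)] by (auto simp: unipotent_mean_def torus_def Mat_entries)
    then have "N (unipotent_mean M f) = N (\<lambda>_. c)" by (rule N(2))
    then show ?thesis by (simp add: mean.const[OF N(1)])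
  qed
  ultimately have "borel_mean (\<lambda>f. N (unipotent_mean M f))"
    by (simp add: borel_mean_def group_mean_def borel_mean_axioms_def)
  then show ?thesis by blast
qed

context borel_mean
begin

lemma imean_parallel_translate:
  assumes F: "invariant_cochain F" and l: "parallel (map ((+) g) l) l'"
  shows "imean m l' F = imean m l F"
proof -
  let ?bs = "map2 (\<lambda>x y. - (g + x) + y) l l'"
  have inv: "translation_invariant F" "bounded_cochain F" using F by (auto simp: invariant_cochain_def)
  have len: "length l = length l'" using l by (auto simp: parallel_def dest: list_all2_lengthD)
  have "imean m (map2 (+) (map ((+) g) l) ?bs) F = imean m (map ((+) g) l) F"
  proof (rule imean_right_translate[where B = "{b. m21 b = 0}"])
    show "set ?bs \<subseteq> {b. m21 b = 0}"
      using l len by (auto simp: parallel_def list_all2_conv_all_nth set_zip m21_minus_plus_eq_0)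
  qed (use len inv borel_invariant in auto)
  moreover have "map2 (+) (map ((+) g) l) ?bs = l'"
    using len by (intro nth_equalityI) (auto simp: add.assoc[symmetric])
  ultimately show ?thesis by (simp add: imean_invariant[OF inv(1)])
qed

lemma imean_parallel_invariant:
  assumes "\<And>l l'. parallel l l' \<Longrightarrow> F l = F l'" shows "imean m gs F = F gs"
  using assms
proof (induction gs arbitrary: F)
  case (Cons g gs)
  have "imean m gs (\<lambda>l. F (z # l)) = F (z # gs)" for z
    by (rule Cons.IH) (simp add: Cons.prems)
  moreover have "m (\<lambda>x. F ((g + x) # gs)) = F (g # gs)"
  proof (rule concentrated)
    fix x :: "'k gl2" assume "m21 x = 0"
    then have "parallel ((g + x) # gs) (g # gs)"
      by (simp add: parallel_refl column_det_def plus_gl2_entries)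
    then show "F ((g + x) # gs) = F (g # gs)" by (rule Cons.prems)
  qed
  ultimately show ?case by simp
qed (simp only: imean.simps)

lemma bounded_cycle_imean_diff:
  assumes len: "length gs = n + 1" "length hs = n + 1"
    and faces: "\<And>F i. invariant_cochain F \<Longrightarrow> i \<le> n \<Longrightarrow> imean m (delete_nth i gs) F = imean m fs F"
      "\<And>F i. invariant_cochain F \<Longrightarrow> i \<le> n \<Longrightarrow> imean m (delete_nth i hs) F = imean m fs F"
  shows "bounded_cycle n (\<lambda>F. imean m gs F - imean m hs F)"
proof
  show "\<exists>K. \<forall>F C. bounded_cochain F \<longrightarrow> (\<forall>l. length l = n + 1 \<longrightarrow> \<bar>F l\<bar> \<le> C)
      \<longrightarrow> \<bar>imean m gs F - imean m hs F\<bar> \<le> K * C"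
  proof (intro exI[of _ 2] allI impI)
    fix F :: "'k gl2 list \<Rightarrow> real" and C assume "\<forall>l. length l = n + 1 \<longrightarrow> \<bar>F l\<bar> \<le> C"
    then have "\<bar>imean m gs F\<bar> \<le> C" "\<bar>imean m hs F\<bar> \<le> C"
      using imean_abs_le[of gs F C] imean_abs_le[of hs F C] len by auto
    then show "\<bar>imean m gs F - imean m hs F\<bar> \<le> 2 * C" by linarith
  qed
  fix F :: "'k gl2 list \<Rightarrow> real" assume F: "invariant_cochain F"
  then have bounded: "bounded_cochain F" by (simp add: invariant_cochain_def)
  have "imean m gs (cobound F) = (\<Sum>i<n + 1. (-1) ^ i * imean m fs F)"
    unfolding imean_cobound[OF bounded] cobound_eq_sum len by (rule sum.cong) (use faces(1)[OF F] in auto)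
  moreover have "imean m hs (cobound F) = (\<Sum>i<n + 1. (-1) ^ i * imean m fs F)"
    unfolding imean_cobound[OF bounded] cobound_eq_sum len by (rule sum.cong) (use faces(2)[OF F] in auto)
  ultimately show "imean m gs (cobound F) - imean m hs (cobound F) = 0" by simp
qed (auto simp: imean.add imean.cmult bounded_cochain_const bounded_cochain_add bounded_cochain_cmult
    algebra_simps)

end

section \<open>Alternating cochains on the projective line\<close>

definition alternating :: "('g list \<Rightarrow> real) \<Rightarrow> bool" where
  "alternating F \<longleftrightarrow> (\<forall>l x y l'. F (l @ [y, x] @ l') = - F (l @ [x, y] @ l'))"

definition parallel_invariant :: "('k::det_field gl2 list \<Rightarrow> real) \<Rightarrow> bool" where
  "parallel_invariant F \<longleftrightarrow> (\<forall>l l'. parallel l l' \<longrightarrow> F l = F l')"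

lemma alternatingD: "alternating F \<Longrightarrow> F (l @ [y, x] @ l') = - F (l @ [x, y] @ l')"
  unfolding alternating_def by blast

lemma alternating_Cons: "alternating F \<Longrightarrow> alternating (\<lambda>l. F (x # l))"
  unfolding alternating_def by (metis append_Cons)

lemma alternating_cobound: assumes "alternating F" shows "alternating (cobound F)"
  unfolding alternating_def
proof (intro allI)
  fix l x y l'
  show "cobound F (l @ [y, x] @ l') = - cobound F (l @ [x, y] @ l')"
    using assms
  proof (induction l arbitrary: F)
    case Nil
    have "F (y # x # m) = - F (x # y # m)" for m
      using alternatingD[OF Nil, of "[]" y x m] by simp
    then show ?case by (simp add: cobound_minus)
  next
    case (Cons z l)
    then show ?case
      using alternatingD[OF Cons.prems, of l y x l']
        Cons.IH[OF alternating_Cons[OF Cons.prems, of z]] by simp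
  qed
qed

lemma parallel_invariant_Cons:
  "parallel_invariant F \<Longrightarrow> parallel_invariant (\<lambda>l. F (x # l))"
  unfolding parallel_invariant_def by simp

lemma parallel_invariant_cobound:
  assumes "parallel_invariant F" shows "parallel_invariant (cobound F)"
  unfolding parallel_invariant_def parallel_def
proof (intro allI impI)
  fix l l' :: "'a gl2 list" assume "list_all2 (\<lambda>x y. column_det x y = 0) l l'"
  then show "cobound F l = cobound F l'"
    using assms
  proof (induction arbitrary: F rule: list_all2_induct)
    case (Cons x l x' l')
    have "F (x # m) = F (x' # m)" for m
      using Cons.prems Cons.hyps(1) parallel_refl[of m] by (simp add: parallel_invariant_def)
    moreover have "F l = F l'"
      using Cons.prems Cons.hyps(2) by (simp add: parallel_invariant_def parallel_def)
    moreover have "cobound (\<lambda>m. F (x # m)) l = cobound (\<lambda>m. F (x # m)) l'"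
      by (rule Cons.IH[OF parallel_invariant_Cons[OF Cons.prems]])
    ultimately show ?case by simp
  qed simp
qed

lemma alternating_adjacent_parallel_eq_0:
  assumes "alternating F" "parallel_invariant F" "column_det x y = 0"
  shows "F (l @ [x, y] @ l') = 0"
proof -
  have "column_det y x = 0" using assms(3) by (simp add: column_det_swap[of x y])
  then have "parallel (l @ [x, y] @ l') (l @ [y, x] @ l')"
    using assms(3) parallel_refl[of l] parallel_refl[of l']
    by (simp add: parallel_def list_all2_appendI)
  then have "F (l @ [x, y] @ l') = F (l @ [y, x] @ l')"
    using assms(2) by (simp add: parallel_invariant_def)
  also have "\<dots> = - F (l @ [x, y] @ l')" by (rule alternatingD[OF assms(1)])
  finally show ?thesis by simp
qed

lemma normalized_alternating: "alternating F \<Longrightarrow> parallel_invariant F \<Longrightarrow> normalized F"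
  by (simp only: normalized_def alternating_adjacent_parallel_eq_0 column_det_self) simp

lemma alternating_parallel_eq_0:
  assumes "alternating F" "parallel_invariant F" "column_det x y = 0"
  shows "F (l @ x # m @ y # r) = 0"
proof (induction m arbitrary: l)
  case Nil
  show ?case using alternating_adjacent_parallel_eq_0[OF assms, of l r] by simp
next
  case (Cons z m)
  have "F (l @ [x, z] @ m @ y # r) = - F (l @ [z, x] @ m @ y # r)" by (rule alternatingD[OF assms(1)])
  then show ?case using Cons[of "l @ [z]"] by simp
qed

definition pairwise_nonparallel :: "'k::det_field gl2 list \<Rightarrow> bool" where
  "pairwise_nonparallel = sorted_wrt (\<lambda>x y. column_det x y \<noteq> 0)"

lemma not_pairwise_nonparallelE:
  assumes "\<not> pairwise_nonparallel xs"
  obtains l x m y r where "xs = l @ x # m @ y # r" "column_det x y = 0"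
  using assms
proof (induction xs arbitrary: thesis)
  case (Cons z xs)
  show ?case
  proof (cases "pairwise_nonparallel xs")
    case True
    then obtain y where "y \<in> set xs" "column_det z y = 0"
      using Cons.prems(2) by (auto simp: pairwise_nonparallel_def)
    then show ?thesis using Cons.prems(1)[of "[]" z _ y] by (auto simp: in_set_conv_decomp)
  next
    case False
    then obtain l x m y r where "xs = l @ x # m @ y # r" "column_det x y = 0"
      using Cons.IH by blast
    then show ?thesis using Cons.prems(1)[of "z # l" x m y r] by simp
  qed
qed (simp add: pairwise_nonparallel_def)

lemma cobound_alternating_eq_0:
  assumes "alternating F" "parallel_invariant F"
    and "pairwise_nonparallel xs \<Longrightarrow> cobound F xs = 0"
  shows "cobound F xs = 0"
proof (cases "pairwise_nonparallel xs")
  case False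
  then obtain l x m y r where "xs = l @ x # m @ y # r" "column_det x y = 0"
    by (rule not_pairwise_nonparallelE)
  then show ?thesis
    using alternating_parallel_eq_0[OF alternating_cobound[OF assms(1)]
        parallel_invariant_cobound[OF assms(2)]]
    by simp
qed (rule assms(3))

text \<open>The point \<open>(t : 1)\<close> of the projective line; the point \<open>(1 : 0)\<close> is represented by \<open>0\<close>.\<close>

definition point :: "'k::det_field \<Rightarrow> 'k gl2" where
  "point t = Mat t (-1) 1 0"

lemma point_entries [simp]: "m11 (point t) = t" "m21 (point t) = 1"
  by (simp_all add: point_def Mat_entries admissible_1)

lemma column_det_points [simp]:
  "column_det 0 (point t) = 1" "column_det (point t) 0 = -1" "column_det (point s) (point t) = s - t"
  by (simp_all add: column_det_def zero_gl2_entries)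

definition frame :: "'k::det_field \<Rightarrow> 'k \<Rightarrow> 'k gl2 \<Rightarrow> 'k gl2 \<Rightarrow> 'k gl2" where
  "frame s t x y = Mat (s * m11 x) (t * m11 y) (s * m21 x) (t * m21 y)"

lemma column_det_frame:
  assumes "admissible (s * t * column_det x y)"
  shows "column_det (frame s t x y + w) z = s * m11 w * column_det x z + t * m21 w * column_det y z"
proof -
  have "admissible ((s * m11 x) * (t * m21 y) - (t * m11 y) * (s * m21 x))"
    using assms by (simp add: column_det_def algebra_simps)
  then show ?thesis
    by (simp add: frame_def column_det_def plus_gl2_entries Mat_entries algebra_simps)
qed

lemma parallel_frame:
  assumes "admissible (s * t * column_det x y)"
  shows "parallel (map ((+) (frame s t x y)) [0, point 0]) [x, y]"
  using column_det_frame[OF assms, of 0] column_det_frame[OF assms, of "point 0"]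
  by (simp add: zero_gl2_entries)

lemma parallel_frame_triple:
  fixes x y z :: "'k::det_field gl2"
  assumes "admissible (column_det z y * column_det x z * column_det x y)"
  shows "parallel (map ((+) (frame (column_det z y) (column_det x z) x y)) [0, point 0, point 1]) [x, y, z]"
  using column_det_frame[OF assms, of 0] column_det_frame[OF assms, of "point 0"]
    column_det_frame[OF assms, of "point 1"]
  by (simp add: zero_gl2_entries column_det_swap[of y z])

section \<open>A bounded class of degree two: the orientation cocycle\<close>

instantiation rat :: det_field
begin

definition admissible_rat :: "rat \<Rightarrow> bool" where "admissible_rat x \<longleftrightarrow> x > 0"

instance by standard (auto simp: admissible_rat_def)

end

fun orientation :: "rat gl2 list \<Rightarrow> real" where
  "orientation [x, y, z] = real_of_rat (sgn (column_det x y) * sgn (column_det y z) * sgn (column_det z x))"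
| "orientation _ = 0"

lemma orientation_eq_0_if_length: "length l \<noteq> 3 \<Longrightarrow> orientation l = 0"
  by (cases l rule: orientation.cases) auto

lemma alternating_orientation: "alternating orientation"
  unfolding alternating_def
proof (intro allI)
  fix l x y and l' :: "rat gl2 list"
  show "orientation (l @ [y, x] @ l') = - orientation (l @ [x, y] @ l')"
  proof (cases "length l + length l' = 1")
    case True
    then consider (first) z where "l = []" "l' = [z]" | (second) z where "l = [z]" "l' = []"
      by (cases l; cases l') auto
    then show ?thesis
    proof cases
      case (first z)
      then show ?thesis
        by (simp add: column_det_swap[of x y] column_det_swap[of y z] column_det_swap[of z x]
            sgn_minus of_rat_minus)
    next
      case (second z)
      then show ?thesis
        by (simp add: column_det_swap[of x y] column_det_swap[of y z] column_det_swap[of z x]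
            sgn_minus of_rat_minus)
    qed
  qed (simp add: orientation_eq_0_if_length)
qed

lemma parallel_invariant_orientation: "parallel_invariant orientation"
  unfolding parallel_invariant_def
proof (intro allI impI)
  fix l l' :: "rat gl2 list" assume par: "parallel l l'"
  show "orientation l = orientation l'"
  proof (cases l rule: orientation.cases)
    case (1 x y z)
    then obtain x' y' z' where l': "l' = [x', y', z']"
      and cols: "column_det x x' = 0" "column_det y y' = 0" "column_det z z' = 0"
      using par by (auto simp: parallel_def list_all2_Cons1)
    obtain a where a: "a \<noteq> 0" "m11 x' = a * m11 x" "m21 x' = a * m21 x"
      using column_det_0E[OF cols(1)] by blast
    obtain b where b: "b \<noteq> 0" "m11 y' = b * m11 y" "m21 y' = b * m21 y"
      using column_det_0E[OF cols(2)] by blast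
    obtain c where c: "c \<noteq> 0" "m11 z' = c * m11 z" "m21 z' = c * m21 z"
      using column_det_0E[OF cols(3)] by blast
    have scaled: "column_det x' y' = (a * b) * column_det x y" "column_det y' z' = (b * c) * column_det y z"
      "column_det z' x' = (c * a) * column_det z x"
      using a b c by (simp_all add: column_det_def algebra_simps)
    have "sgn (column_det x' y') * sgn (column_det y' z') * sgn (column_det z' x')
      = (sgn a * sgn a) * (sgn b * sgn b) * (sgn c * sgn c)
        * (sgn (column_det x y) * sgn (column_det y z) * sgn (column_det z x))"
      unfolding scaled sgn_mult by (simp only: mult_ac)
    moreover have "sgn a * sgn a = 1" "sgn b * sgn b = 1" "sgn c * sgn c = 1"
      using a b c by (auto simp: sgn_if)
    ultimately show ?thesis using 1 l' by simp
  qed (use par in \<open>auto simp: parallel_def list_all2_Cons1\<close>)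
qed

text \<open>By the Pluecker relation the three products of signs of complementary determinants cannot violate
  the cocycle identity.\<close>

lemma cobound_orientation: assumes "length xs = 4" shows "cobound orientation xs = 0"
proof (rule cobound_alternating_eq_0[OF alternating_orientation parallel_invariant_orientation])
  assume nonparallel: "pairwise_nonparallel xs"
  obtain x y z w where xs: "xs = [x, y, z, w]"
    using assms by (auto simp: numeral_eq_Suc length_Suc_conv)
  let ?p = "column_det x y * column_det z w" and ?q = "column_det x z * column_det y w"
    and ?r = "column_det x w * column_det y z"
  have "\<not> (?p > 0 \<and> ?q < 0 \<and> ?r > 0)" "\<not> (?p < 0 \<and> ?q > 0 \<and> ?r < 0)"
    using column_det_plucker[of x y z w] by linarith+
  then have consistent: "\<not> (sgn ?p = 1 \<and> sgn ?q = -1 \<and> sgn ?r = 1)"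
    "\<not> (sgn ?p = -1 \<and> sgn ?q = 1 \<and> sgn ?r = -1)"
    by (simp_all add: sgn_1_pos sgn_1_neg)
  have "sgn a = 1 \<or> sgn a = -1" if "a \<noteq> 0" for a :: rat using that by (auto simp: sgn_if)
  then have signs: "sgn (column_det x y) = 1 \<or> sgn (column_det x y) = -1"
    "sgn (column_det x z) = 1 \<or> sgn (column_det x z) = -1"
    "sgn (column_det x w) = 1 \<or> sgn (column_det x w) = -1"
    "sgn (column_det y z) = 1 \<or> sgn (column_det y z) = -1"
    "sgn (column_det y w) = 1 \<or> sgn (column_det y w) = -1"
    "sgn (column_det z w) = 1 \<or> sgn (column_det z w) = -1"
    using nonparallel unfolding xs pairwise_nonparallel_def by simp_all
  define c where "c x y z = sgn (column_det x y) * sgn (column_det y z) * sgn (column_det z x)"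
    for x y z :: "rat gl2"
  have "c y z w - c x z w + c x y w - c x y z = 0"
    using signs consistent
    unfolding c_def sgn_mult column_det_swap[of x z] column_det_swap[of y w] column_det_swap[of x w]
      column_det_swap[of z w] sgn_minus
    by (elim disjE) simp_all
  moreover have "cobound orientation xs = real_of_rat (c y z w - c x z w + c x y w - c x y z)"
    unfolding xs c_def by (simp add: of_rat_diff of_rat_add)
  ultimately show "cobound orientation xs = 0" by simp
qed

lemma bounded_cochain_orientation: "bounded_cochain orientation"
proof (rule bounded_cochainI)
  fix xs show "\<bar>orientation xs\<bar> \<le> (\<lambda>_. 1) (length xs)"
    by (cases xs rule: orientation.cases) (auto simp: sgn_if)
qed

lemma bounded_cocycle_orientation: "bounded_cocycle 2 orientation"
proof -
  have "orientation (map ((+) g) xs) = orientation xs" for g xs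
  proof -
    have "sgn (gl2_det g) = 1" using admissible_gl2_det[of g] by (simp add: admissible_rat_def)
    then show ?thesis
      by (cases xs rule: orientation.cases) (auto simp: column_det_plus sgn_mult)
  qed
  then show ?thesis
    using cobound_orientation bounded_cochain_orientation
    by (simp add: bounded_cocycle_def invariant_cochain_def translation_invariant_def)
qed

text \<open>Since the group is 2-transitive on the projective line, all faces of the triples
  \<open>(\<infinity>, 0, 1)\<close> and \<open>(0, \<infinity>, 1)\<close> are averaged in the same way, but their orientations differ.\<close>

lemma ex_bounded_cycle_orientation: "\<exists>\<mu>. bounded_cycle 2 \<mu> \<and> \<mu> orientation \<noteq> 0"
proof -
  obtain m :: "(rat gl2 \<Rightarrow> real) \<Rightarrow> real" where "borel_mean m" using ex_borel_mean by blast
  then interpret borel_mean m .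
  let ?T = "[0, point 0, point 1]" and ?T' = "[point 0, 0, point 1]"
  have pair: "imean m [x, y] F = imean m [0, point 0] F"
    if "column_det x y \<noteq> 0" "invariant_cochain F" for x y F
  proof -
    have "admissible (1 * sgn (column_det x y) * column_det x y)"
      using that(1) by (auto simp: admissible_rat_def sgn_if)
    from parallel_frame[OF this] show ?thesis by (rule imean_parallel_translate[OF that(2)])
  qed
  have "bounded_cycle 2 (\<lambda>F. imean m ?T F - imean m ?T' F)"
  proof (rule bounded_cycle_imean_diff[where fs = "[0, point 0]"])
    fix F :: "rat gl2 list \<Rightarrow> real" and i :: nat assume F: "invariant_cochain F" and "i \<le> 2"
    then have i: "i = 0 \<or> i = Suc 0 \<or> i = Suc (Suc 0)" by auto
    show "imean m (delete_nth i ?T) F = imean m [0, point 0] F"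
      "imean m (delete_nth i ?T') F = imean m [0, point 0] F"
      using i by (elim disjE; simp only: delete_nth_0 delete_nth_Suc; intro pair F refl; simp)+
  qed simp_all
  moreover have "imean m l orientation = orientation l" for l
    using parallel_invariant_orientation
    by (intro imean_parallel_invariant) (simp add: parallel_invariant_def)
  then have "imean m ?T orientation - imean m ?T' orientation \<noteq> 0" by (simp only:) simp
  ultimately show ?thesis by blast
qed

section \<open>The dilogarithm on the unit circle\<close>

text \<open>The summand for \<open>n = 0\<close> vanishes since \<open>1 / 0 = 0\<close>.\<close>

definition Li2 :: "complex \<Rightarrow> complex" where
  "Li2 u = suminf (\<lambda>n. 1 / of_nat n ^ 2 * u ^ n)"

lemma summable_inverse_square: "summable (\<lambda>n. 1 / real n ^ 2)"
  using inverse_power_summable[of 2, where 'a = real] by (simp add: inverse_eq_divide)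

lemma norm_Li2_summand_le:
  "norm u \<le> 1 \<Longrightarrow> norm (1 / of_nat n ^ 2 * u ^ n :: complex) \<le> 1 / real n ^ 2"
  by (simp add: norm_mult norm_divide norm_power divide_right_mono power_le_one)

lemma summable_Li2: "norm u \<le> 1 \<Longrightarrow> summable (\<lambda>n. 1 / of_nat n ^ 2 * u ^ n :: complex)"
  by (rule summable_comparison_test'[OF summable_inverse_square]) (rule norm_Li2_summand_le)

lemma norm_Li2_le: "norm u \<le> 1 \<Longrightarrow> norm (Li2 u) \<le> suminf (\<lambda>n. 1 / real n ^ 2)"
  unfolding Li2_def by (rule norm_suminf_le[OF norm_Li2_summand_le summable_inverse_square])

lemma Li2_cnj: "norm u \<le> 1 \<Longrightarrow> Li2 (cnj u) = cnj (Li2 u)"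
  using sums_cnj[of "\<lambda>n. 1 / of_nat n ^ 2 * u ^ n" "Li2 u"] summable_Li2[of u]
  by (simp add: Li2_def sums_iff summable_sums)

lemma Im_Li2_real: assumes "norm u \<le> 1" "u \<in> \<real>" shows "Im (Li2 u) = 0"
proof -
  have "cnj u = u" using assms(2) by (simp add: Reals_cnj_iff)
  then have "Li2 u = cnj (Li2 u)" using Li2_cnj[OF assms(1)] by simp
  then show ?thesis by (simp add: complex_eq_iff)
qed

lemma continuous_on_Li2: "continuous_on (cball 0 1) Li2"
proof -
  have "uniform_limit (cball 0 1) (\<lambda>n u. \<Sum>k<n. 1 / of_nat k ^ 2 * u ^ k) Li2 sequentially"
    unfolding Li2_def
    by (rule Weierstrass_m_test[OF _ summable_inverse_square]) (use norm_Li2_summand_le in simp)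
  then show ?thesis
  proof (rule uniform_limit_theorem[rotated])
    show "eventually (\<lambda>n. continuous_on (cball 0 1) (\<lambda>u::complex. \<Sum>k<n. 1 / of_nat k ^ 2 * u ^ k))
      sequentially"
      by (intro always_eventually allI continuous_intros)
  qed simp
qed

definition Li2_deriv :: "complex \<Rightarrow> complex" where
  "Li2_deriv z = (if z = 0 then 1 else - Ln (1 - z) / z)"

lemma Li2_has_field_derivative:
  assumes "norm z < 1" shows "(Li2 has_field_derivative Li2_deriv z) (at z)"
proof -
  let ?c = "\<lambda>n. 1 / of_nat n ^ 2 :: complex" and ?D = "suminf (\<lambda>n. diffs (\<lambda>n. 1 / of_nat n ^ 2) n * z ^ n)"
  have diffs: "diffs ?c n = 1 / of_nat (Suc n)" for n
    by (simp add: diffs_def power2_eq_square del: of_nat_Suc)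
  have "(Li2 has_field_derivative ?D) (at z)"
    unfolding Li2_def by (rule termdiffs_strong'[of 1]) (use assms summable_Li2[OF less_imp_le] in simp_all)
  moreover have "?D = Li2_deriv z"
  proof (cases "z = 0")
    case True
    then show ?thesis using powser_zero[of "diffs ?c"] by (simp add: Li2_deriv_def diffs)
  next
    case False
    have "(\<lambda>n. - (z ^ n / of_nat n)) sums Ln (1 - z)" using Ln_series'[of "- z"] assms by simp
    then have "(\<lambda>n. z ^ n / of_nat n) sums - Ln (1 - z)" using sums_minus by fastforce
    then have "(\<lambda>n. z ^ Suc n / of_nat (Suc n)) sums - Ln (1 - z)" by (subst sums_Suc_iff) simp
    moreover have "summable (\<lambda>n. diffs ?c n * z ^ n)"
      by (rule termdiff_converges[of z 1]) (use assms summable_Li2[OF less_imp_le] in simp_all)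
    then have "(\<lambda>n. z * (diffs ?c n * z ^ n)) sums (z * ?D)" by (intro sums_mult summable_sums)
    then have "(\<lambda>n. z ^ Suc n / of_nat (Suc n)) sums (z * ?D)"
      by (simp add: diffs field_simps del: of_nat_Suc)
    ultimately have "z * ?D = - Ln (1 - z)" using sums_unique2 by blast
    then show ?thesis using False by (simp add: Li2_deriv_def field_simps)
  qed
  ultimately show ?thesis by simp
qed

definition slit_plane :: "complex set" where
  "slit_plane = {z. 1 - z \<notin> \<real>\<^sub>\<le>\<^sub>0}"

lemma mem_slit_plane: "norm z \<le> 1 \<Longrightarrow> z \<noteq> 1 \<Longrightarrow> z \<in> slit_plane"
proof -
  assume z: "norm z \<le> 1" "z \<noteq> 1"
  have "Re z \<le> 1" using complex_Re_le_cmod[of z] z(1) by linarith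
  then show ?thesis using z(2) by (auto simp: slit_plane_def complex_nonpos_Reals_iff complex_eq_iff)
qed

lemma open_slit_plane: "open slit_plane"
proof -
  have "closed ((\<lambda>z. 1 - z) -` \<real>\<^sub>\<le>\<^sub>0 :: complex set)"
    by (intro closed_vimage closed_nonpos_Reals_complex continuous_intros)
  then show ?thesis unfolding slit_plane_def by (simp add: closed_def vimage_def Collect_neg_eq)
qed

lemma of_real_mult_mem_slit_plane:
  assumes z: "z \<in> slit_plane" and u: "0 \<le> u" "u \<le> 1"
  shows "of_real u * z \<in> slit_plane"
proof (rule ccontr)
  assume "of_real u * z \<notin> slit_plane"
  then have w: "1 \<le> u * Re z" "u * Im z = 0" by (auto simp: slit_plane_def complex_nonpos_Reals_iff)
  then have "0 < u * Re z" by linarith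
  then have "0 \<le> Re z" and "Im z = 0" using w(2) u(1) by (auto simp: zero_less_mult_iff)
  moreover from this have "u * Re z \<le> 1 * Re z" using u(2) by (intro mult_right_mono)
  ultimately show False using z w(1) by (auto simp: slit_plane_def complex_nonpos_Reals_iff)
qed

lemma starlike_slit_plane: "starlike slit_plane"
  unfolding starlike_def
proof (intro bexI[of _ 0] ballI subsetI)
  fix z w assume "z \<in> slit_plane" "w \<in> closed_segment 0 z"
  then show "w \<in> slit_plane"
    by (auto simp: in_segment scaleR_conv_of_real intro: of_real_mult_mem_slit_plane)
qed (simp add: slit_plane_def)

lemma holomorphic_Li2_deriv: "Li2_deriv holomorphic_on slit_plane"
proof -
  have "Li2 holomorphic_on ball 0 1"
    using Li2_has_field_derivative by (subst holomorphic_on_open) fastforce+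
  then have "deriv Li2 holomorphic_on ball 0 1" by (intro holomorphic_deriv) auto
  then have "Li2_deriv holomorphic_on ball 0 1"
    by (rule holomorphic_transform) (simp add: DERIV_imp_deriv[OF Li2_has_field_derivative])
  moreover have "(\<lambda>z. - Ln (1 - z) / z) holomorphic_on slit_plane - {0}"
    by (intro holomorphic_intros) (auto simp: slit_plane_def)
  then have "Li2_deriv holomorphic_on slit_plane - {0}"
    by (rule holomorphic_transform) (simp add: Li2_deriv_def)
  ultimately have "Li2_deriv holomorphic_on ball 0 1 \<union> (slit_plane - {0})"
    by (intro holomorphic_on_Un open_delete open_slit_plane) auto
  then show ?thesis by (rule holomorphic_on_subset) auto
qed

lemma Li2_primitive_eq:
  assumes F: "\<And>z. z \<in> slit_plane \<Longrightarrow> (F has_field_derivative Li2_deriv z) (at z)"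
  obtains C where "\<And>z. norm z \<le> 1 \<Longrightarrow> z \<noteq> 1 \<Longrightarrow> F z - Li2 z = C"
proof -
  have "((\<lambda>z. F z - Li2 z) has_field_derivative 0) (at z within ball 0 1)" if "z \<in> ball 0 1" for z
  proof -
    have "norm z < 1" using that by simp
    moreover from this have "z \<in> slit_plane" by (intro mem_slit_plane) auto
    ultimately show ?thesis
      using DERIV_diff[OF F Li2_has_field_derivative] has_field_derivative_at_within by fastforce
  qed
  then obtain C where C: "\<And>z. norm z < 1 \<Longrightarrow> F z - Li2 z = C"
    using has_field_derivative_zero_constant[OF convex_ball, of 0 1 "\<lambda>z. F z - Li2 z"] by auto
  have "continuous_on slit_plane F"
    using F by (intro continuous_at_imp_continuous_on ballI DERIV_isCont) blast
  have "F z - Li2 z = C" if z: "norm z \<le> 1" "z \<noteq> 1" for z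
  proof -
    let ?f = "\<lambda>r::real. F (of_real r * z) - Li2 (of_real r * z)"
    have "of_real r * z \<in> slit_plane" "norm (of_real r * z) \<le> 1" if "r \<in> {0..1}" for r
      using that of_real_mult_mem_slit_plane[OF mem_slit_plane[OF z], of r] mult_le_one[of r "norm z"] z(1)
      by (simp_all add: norm_mult)
    then have "continuous_on {0..1} ?f"
      by (intro continuous_on_diff continuous_on_compose2[OF \<open>continuous_on slit_plane F\<close>]
          continuous_on_compose2[OF continuous_on_Li2] continuous_intros) auto
    moreover have "?f r = C" if "r \<in> {0..<1}" for r
    proof (rule C)
      have "norm (of_real r * z) \<le> r"
        using that z(1) mult_left_le[of "norm z" r] by (simp add: norm_mult)
      then show "norm (of_real r * z) < 1" using that by simp
    qed
    ultimately show ?thesis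
      using continuous_constant_on_closure[of "{0..<1 :: real}" ?f C 1] by simp
  qed
  then show ?thesis by (rule that)
qed

text \<open>The analytic continuation of \<open>Li2\<close> gives access to its derivative along the unit circle, where
  the power series can no longer be differentiated.\<close>

lemma ex_Li2_continuation:
  "\<exists>G. (\<forall>z\<in>slit_plane. (G has_field_derivative Li2_deriv z) (at z)) \<and>
    (\<forall>z. norm z \<le> 1 \<longrightarrow> z \<noteq> 1 \<longrightarrow> G z = Li2 z)"
proof -
  have "\<exists>F. \<forall>z\<in>slit_plane. (F has_field_derivative Li2_deriv z) (at z)"
    using holomorphic_Li2_deriv open_slit_plane starlike_slit_plane
    by (intro holomorphic_starlike_primitive[of _ _ "{}"])
       (auto intro: holomorphic_on_imp_continuous_on holomorphic_on_imp_differentiable_at)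
  then obtain F where F: "\<And>z. z \<in> slit_plane \<Longrightarrow> (F has_field_derivative Li2_deriv z) (at z)" by blast
  then obtain C where C: "\<And>z. norm z \<le> 1 \<Longrightarrow> z \<noteq> 1 \<Longrightarrow> F z - Li2 z = C"
    using Li2_primitive_eq by blast
  have "((\<lambda>z. F z - C) has_field_derivative Li2_deriv z) (at z)" if "z \<in> slit_plane" for z
    using DERIV_diff[OF F[OF that] DERIV_const[of C]] by simp
  then show ?thesis
    using C by (intro exI[of _ "\<lambda>z. F z - C"]) (auto simp: algebra_simps)
qed

lemma Im_Li2_i_pos: "Im (Li2 \<i>) > 0"
proof -
  let ?f = "\<lambda>n. Im (1 / of_nat n ^ 2 * \<i> ^ n)" and ?g = "\<lambda>n. 1 / (real n + 2) - 1 / (real n + 3)"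
  have summable: "summable (\<lambda>n. 1 / of_nat n ^ 2 * \<i> ^ n)" by (rule summable_Li2) simp
  have "Im (Li2 \<i>) = suminf ?f" unfolding Li2_def by (rule Im_suminf[OF summable])
  also have "\<dots> = suminf (\<lambda>n. ?f (n + 3)) + (\<Sum>n<3. ?f n)"
    by (rule suminf_split_initial_segment[OF summable_Im[OF summable]])
  also have "(\<Sum>n<3. ?f n) = 1" by (simp add: numeral_eq_Suc)
  finally have split: "Im (Li2 \<i>) = suminf (\<lambda>n. ?f (n + 3)) + 1" .
  have "(\<lambda>n. 1 / real (n + 2)) \<longlonglongrightarrow> 0"
    using LIMSEQ_ignore_initial_segment[OF lim_1_over_n, of 2] by simp
  then have "(\<lambda>n. 1 / (real n + 2)) \<longlonglongrightarrow> 0" by (simp add: add.commute)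
  from telescope_sums'[OF this] have g: "?g sums (1 / 2)" by (simp add: add.commute add.left_commute)
  have "norm (?f (n + 3)) \<le> ?g n" for n
  proof -
    have "norm (?f (n + 3)) \<le> norm (1 / of_nat (n + 3) ^ 2 * \<i> ^ (n + 3))"
      unfolding real_norm_def by (rule abs_Im_le_cmod)
    also have "\<dots> \<le> 1 / (real (n + 3))\<^sup>2" by (rule norm_Li2_summand_le) simp
    also have "\<dots> \<le> 1 / ((real n + 2) * (real n + 3))"
      by (intro divide_left_mono) (auto simp: power2_eq_square intro!: mult_mono)
    also have "\<dots> = ?g n" by (simp add: field_simps)
    finally show ?thesis .
  qed
  then have "norm (suminf (\<lambda>n. ?f (n + 3))) \<le> suminf ?g" by (rule norm_suminf_le) (rule sums_summable[OF g])
  then show ?thesis using split sums_unique[OF g] by simp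
qed

text \<open>This is the Lobachevsky function \<open>\<theta> \<mapsto> Im (Li2 (cis (2 * \<theta>))) / 2\<close>, evaluated at the argument of \<open>w\<close>.\<close>

definition lobachevsky :: "complex \<Rightarrow> real" where
  "lobachevsky w = Im (Li2 (w / cnj w)) / 2"

lemma norm_div_cnj_le: "norm (w / cnj w) \<le> 1"
  by (cases "w = 0") (simp_all add: norm_divide)

lemma abs_lobachevsky_le: "\<bar>lobachevsky w\<bar> \<le> suminf (\<lambda>n. 1 / real n ^ 2)"
proof -
  have "\<bar>Im (Li2 (w / cnj w))\<bar> \<le> suminf (\<lambda>n. 1 / real n ^ 2)"
    using abs_Im_le_cmod norm_Li2_le[OF norm_div_cnj_le] order_trans by blast
  then show ?thesis unfolding lobachevsky_def by (simp add: abs_divide)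
qed

lemma lobachevsky_inverse: "lobachevsky (inverse w) = - lobachevsky w"
proof -
  have "inverse w / cnj (inverse w) = cnj (w / cnj w)" by (simp add: field_simps)
  then show ?thesis unfolding lobachevsky_def using Li2_cnj[OF norm_div_cnj_le[of w]] by simp
qed

lemma lobachevsky_divide_swap: "lobachevsky (w / z) = - lobachevsky (z / w)"
  using lobachevsky_inverse[of "z / w"] by (simp add: field_simps)

lemma lobachevsky_of_real_mult: "r \<noteq> 0 \<Longrightarrow> lobachevsky (of_real r * w) = lobachevsky w"
  by (simp add: lobachevsky_def)

lemma lobachevsky_real: assumes "Im w = 0" shows "lobachevsky w = 0"
proof -
  have "cnj w = w" using assms by (simp add: complex_eq_iff)
  then show ?thesis
    using Im_Li2_real[OF norm_div_cnj_le[of w]] by (cases "w = 0") (simp_all add: lobachevsky_def)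
qed

lemma continuous_on_lobachevsky: "continuous_on (- {0}) lobachevsky"
proof -
  have "continuous_on (- {0}) (\<lambda>w. w / cnj w)" by (intro continuous_intros) auto
  then have "continuous_on (- {0}) (\<lambda>w. Li2 (w / cnj w))"
    by (rule continuous_on_compose2[OF continuous_on_Li2]) (use norm_div_cnj_le in auto)
  then show ?thesis unfolding lobachevsky_def by (intro continuous_intros) auto
qed

lemma has_vector_derivative_divide:
  fixes A B :: "real \<Rightarrow> complex"
  assumes "(A has_vector_derivative A') (at t)" "(B has_vector_derivative B') (at t)" "B t \<noteq> 0"
  shows "((\<lambda>t. A t / B t) has_vector_derivative (A' * B t - A t * B') / (B t * B t)) (at t)"
proof -
  have "((\<lambda>t. A t / B t) has_derivative (\<lambda>h. ((h *\<^sub>R A') * B t - A t * (h *\<^sub>R B')) / (B t * B t))) (at t)"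
    by (rule has_derivative_divide') (use assms in \<open>auto simp: has_vector_derivative_def\<close>)
  moreover have "(\<lambda>h. ((h *\<^sub>R A') * B t - A t * (h *\<^sub>R B')) / (B t * B t))
      = (\<lambda>h. h *\<^sub>R ((A' * B t - A t * B') / (B t * B t)))"
    by (auto simp: scaleR_conv_of_real diff_divide_distrib algebra_simps)
  ultimately show ?thesis by (simp add: has_vector_derivative_def)
qed

lemma has_vector_derivative_div_cnj:
  assumes "(w has_vector_derivative w') (at t)" "w t \<noteq> 0"
  shows "((\<lambda>t. w t / cnj (w t)) has_vector_derivative
    w t / cnj (w t) * (2 * \<i> * of_real (Im (w' / w t)))) (at t)"
proof -
  have "((\<lambda>t. w t / cnj (w t)) has_vector_derivative
      (w' * cnj (w t) - w t * cnj w') / (cnj (w t) * cnj (w t))) (at t)"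
    by (intro has_vector_derivative_divide has_vector_derivative_cnj assms) (simp add: assms)
  moreover have "(w' * cnj (w t) - w t * cnj w') / (cnj (w t) * cnj (w t))
      = w t / cnj (w t) * (w' / w t - cnj (w' / w t))"
    using assms(2) by (simp add: field_simps)
  moreover have "w' / w t - cnj (w' / w t) = 2 * \<i> * of_real (Im (w' / w t))"
    by (simp add: complex_eq_iff del: complex_cnj_divide)
  ultimately show ?thesis by simp
qed

lemma norm_one_minus_div_cnj:
  assumes "w \<noteq> 0" shows "norm (1 - w / cnj w) = 2 * \<bar>Im w\<bar> / norm w"
proof -
  have "1 - w / cnj w = (cnj w - w) / cnj w" using assms by (simp add: field_simps)
  moreover have "norm (cnj w - w) = 2 * \<bar>Im w\<bar>"
    by (simp add: cmod_def power2_eq_square real_sqrt_mult abs_mult)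
  ultimately show ?thesis by (simp add: norm_divide)
qed

lemma lobachevsky_has_real_derivative:
  assumes w: "(w has_vector_derivative w') (at t)" and not_real: "Im (w t) \<noteq> 0"
  shows "((\<lambda>t. lobachevsky (w t)) has_real_derivative
    - ln (2 * \<bar>Im (w t)\<bar> / norm (w t)) * Im (w' / w t)) (at t)"
proof -
  let ?u = "\<lambda>t. w t / cnj (w t)" and ?k = "Im (w' / w t)"
  obtain G where G: "\<And>z. z \<in> slit_plane \<Longrightarrow> (G has_field_derivative Li2_deriv z) (at z)"
    "\<And>z. norm z \<le> 1 \<Longrightarrow> z \<noteq> 1 \<Longrightarrow> G z = Li2 z"
    using ex_Li2_continuation by blast
  have nonzero: "w t \<noteq> 0" using not_real by auto
  have u_neq_1: "w s / cnj (w s) \<noteq> 1" if "Im (w s) \<noteq> 0" for s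
    using norm_one_minus_div_cnj[of "w s"] that by auto
  have u: "?u t \<in> slit_plane" by (rule mem_slit_plane[OF norm_div_cnj_le u_neq_1[OF not_real]])
  have "((\<lambda>t. G (?u t)) has_vector_derivative (?u t * (2 * \<i> * of_real ?k)) * Li2_deriv (?u t)) (at t)"
    using field_vector_diff_chain_at[OF has_vector_derivative_div_cnj[OF w nonzero] G(1)[OF u]]
    by (simp add: comp_def)
  moreover have "(?u t * (2 * \<i> * of_real ?k)) * Li2_deriv (?u t) = - (2 * \<i> * of_real ?k * Ln (1 - ?u t))"
    using nonzero by (simp add: Li2_deriv_def)
  ultimately have "((\<lambda>t. G (?u t)) has_vector_derivative - (2 * \<i> * of_real ?k * Ln (1 - ?u t))) (at t)"
    by simp
  from bounded_linear.has_vector_derivative[OF bounded_linear_Im this]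
  have "((\<lambda>t. Im (G (?u t))) has_real_derivative - (2 * ?k * Re (Ln (1 - ?u t)))) (at t)"
    by (simp add: has_real_derivative_iff_has_vector_derivative)
  from DERIV_cdivide[OF this, of 2]
  have "((\<lambda>t. Im (G (?u t)) / 2) has_real_derivative - (?k * Re (Ln (1 - ?u t)))) (at t)"
    by simp
  moreover have "Re (Ln (1 - ?u t)) = ln (2 * \<bar>Im (w t)\<bar> / norm (w t))"
    using u_neq_1[OF not_real] by (simp add: Re_Ln norm_one_minus_div_cnj[OF nonzero])
  ultimately have deriv: "((\<lambda>t. Im (G (?u t)) / 2) has_real_derivative
      - ln (2 * \<bar>Im (w t)\<bar> / norm (w t)) * ?k) (at t)"
    by (simp add: mult.commute)
  have "continuous (at t) (\<lambda>t. Im (w t))"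
    by (rule bounded_linear.continuous[OF bounded_linear_Im has_vector_derivative_continuous[OF w]])
  then obtain \<epsilon> where \<epsilon>: "\<epsilon> > 0" "\<And>s. dist t s < \<epsilon> \<Longrightarrow> Im (w s) \<noteq> 0"
    using continuous_at_avoid not_real by blast
  show ?thesis
    by (rule has_field_derivative_transform_within[OF deriv \<epsilon>(1)])
       (use \<epsilon>(2) G(2)[OF norm_div_cnj_le u_neq_1] in \<open>auto simp: dist_commute lobachevsky_def\<close>)
qed

section \<open>Ideal tetrahedra and the five-term relation\<close>

text \<open>For \<open>A - B + C = 0\<close> this is the oriented hyperbolic volume of the ideal tetrahedron over the
  Euclidean triangle with sides \<open>A\<close>, \<open>B\<close>, \<open>C\<close>, whose dihedral angles are the angles of the triangle.\<close>

definition ideal_volume :: "complex \<Rightarrow> complex \<Rightarrow> complex \<Rightarrow> real" where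
  "ideal_volume A B C = lobachevsky (A / B) + lobachevsky (B / C) + lobachevsky (C / A)"

lemma ideal_volume_mult: "k \<noteq> 0 \<Longrightarrow> ideal_volume (k * A) (k * B) (k * C) = ideal_volume A B C"
  by (simp add: ideal_volume_def)

lemma ideal_volume_rotate: "ideal_volume B C A = ideal_volume A B C"
  by (simp add: ideal_volume_def)

lemma ideal_volume_of_real_mult:
  assumes "r \<noteq> 0" shows "ideal_volume (of_real r * A) B C = ideal_volume A B C"
proof -
  have "lobachevsky (of_real r * A / B) = lobachevsky (A / B)" for B
    using lobachevsky_of_real_mult[OF assms, of "A / B"] by simp
  then show ?thesis
    by (simp add: ideal_volume_def lobachevsky_divide_swap[of C "of_real r * A"]
        lobachevsky_divide_swap[of C A])
qed

lemma ideal_volume_minus_left: "ideal_volume (- A) B C = ideal_volume A B C"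
  using ideal_volume_of_real_mult[of "-1" A B C] by simp

lemma ideal_volume_minus_right: "ideal_volume A B (- C) = ideal_volume A B C"
  using ideal_volume_minus_left[of C A B] by (simp only: ideal_volume_rotate[of A B])

lemma ideal_volume_swap: "ideal_volume B A C = - ideal_volume A B C"
  by (simp add: ideal_volume_def lobachevsky_divide_swap[of B A] lobachevsky_divide_swap[of A C]
      lobachevsky_divide_swap[of C B])

lemma ideal_volume_degenerate: "ideal_volume A B B = 0"
  using ideal_volume_swap[of B A B] ideal_volume_rotate[of B A B] ideal_volume_rotate[of B B A] by linarith

lemma abs_ideal_volume_le: "\<bar>ideal_volume A B C\<bar> \<le> 3 * suminf (\<lambda>n. 1 / real n ^ 2)"
  using abs_lobachevsky_le[of "A / B"] abs_lobachevsky_le[of "B / C"] abs_lobachevsky_le[of "C / A"]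
  unfolding ideal_volume_def by linarith

lemma continuous_on_ideal_volume:
  assumes "continuous_on S A" "continuous_on S B" "continuous_on S C"
    and "\<And>t. t \<in> S \<Longrightarrow> A t \<noteq> 0" "\<And>t. t \<in> S \<Longrightarrow> B t \<noteq> 0" "\<And>t. t \<in> S \<Longrightarrow> C t \<noteq> 0"
  shows "continuous_on S (\<lambda>t. ideal_volume (A t) (B t) (C t))"
proof -
  have "continuous_on S (\<lambda>t. lobachevsky (P t / Q t))"
    if "continuous_on S P" "continuous_on S Q" "\<And>t. t \<in> S \<Longrightarrow> P t \<noteq> 0" "\<And>t. t \<in> S \<Longrightarrow> Q t \<noteq> 0" for P Q
    by (rule continuous_on_compose2[OF continuous_on_lobachevsky])
       (use that in \<open>auto intro!: continuous_on_divide\<close>)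
  then show ?thesis unfolding ideal_volume_def by (intro continuous_on_add) (use assms in auto)
qed

lemma Im_divide_cnj: "Im (w / z) = Im (w * cnj z) / (norm z)\<^sup>2"
  by (metis Im_divide_of_real complex_div_cnj of_real_power)

lemma Im_mult_cnj_triangle:
  assumes "A - B + C = 0"
  shows "Im (B * cnj C) = Im (A * cnj B)" "Im (C * cnj A) = - Im (A * cnj B)"
proof -
  have "C = B - A" using assms by (simp add: algebra_simps)
  then show "Im (B * cnj C) = Im (A * cnj B)" "Im (C * cnj A) = - Im (A * cnj B)"
    by (simp_all only:) (simp_all add: algebra_simps)
qed

lemma ideal_volume_flat:
  assumes "A - B + C = 0" "Im (A * cnj B) = 0" shows "ideal_volume A B C = 0"
  unfolding ideal_volume_def
  using Im_mult_cnj_triangle[OF assms(1)] assms(2) by (simp add: lobachevsky_real Im_divide_cnj)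

lemma lobachevsky_quotient_has_real_derivative:
  assumes A: "(A has_vector_derivative A') (at t)" and B: "(B has_vector_derivative B') (at t)"
    and nonzero: "A t \<noteq> 0" "B t \<noteq> 0" and not_parallel: "Im (A t * cnj (B t)) \<noteq> 0"
  shows "((\<lambda>t. lobachevsky (A t / B t)) has_real_derivative
    - (ln (2 * \<bar>Im (A t * cnj (B t))\<bar>) - ln (norm (A t)) - ln (norm (B t)))
      * (Im (A' / A t) - Im (B' / B t))) (at t)"
proof -
  have "Im (A t / B t) \<noteq> 0" using not_parallel nonzero by (simp add: Im_divide_cnj)
  note deriv = lobachevsky_has_real_derivative[OF has_vector_derivative_divide[OF A B nonzero(2)] this]
  have "2 * \<bar>Im (A t / B t)\<bar> / norm (A t / B t) = 2 * \<bar>Im (A t * cnj (B t))\<bar> / (norm (A t) * norm (B t))"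
    unfolding Im_divide_cnj using nonzero by (simp add: norm_divide power2_eq_square field_simps abs_divide)
  then have "ln (2 * \<bar>Im (A t / B t)\<bar> / norm (A t / B t))
      = ln (2 * \<bar>Im (A t * cnj (B t))\<bar>) - ln (norm (A t)) - ln (norm (B t))"
    using not_parallel nonzero by (simp add: ln_div ln_mult)
  moreover have "(A' * B t - A t * B') / (B t * B t) / (A t / B t) = A' / A t - B' / B t"
    using nonzero by (simp add: field_simps)
  ultimately show ?thesis using deriv by simp
qed

text \<open>The variation of the volume, in the form of Schlaefli's formula for ideal polyhedra.\<close>

definition schlaefli :: "complex \<Rightarrow> complex \<Rightarrow> complex \<Rightarrow> complex \<Rightarrow> complex \<Rightarrow> complex \<Rightarrow> real" where
  "schlaefli A B C A' B' C' = Im (A' / A) * (ln (norm B) - ln (norm C))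
    + Im (B' / B) * (ln (norm C) - ln (norm A)) + Im (C' / C) * (ln (norm A) - ln (norm B))"

lemma ideal_volume_has_real_derivative:
  assumes deriv: "(A has_vector_derivative A') (at t)" "(B has_vector_derivative B') (at t)"
    "(C has_vector_derivative C') (at t)"
    and sum: "A t - B t + C t = 0" and nonzero: "A t \<noteq> 0" "B t \<noteq> 0" "C t \<noteq> 0"
    and not_flat: "Im (A t * cnj (B t)) \<noteq> 0"
  shows "((\<lambda>t. ideal_volume (A t) (B t) (C t)) has_real_derivative
    schlaefli (A t) (B t) (C t) A' B' C') (at t)"
proof -
  let ?L = "ln (2 * \<bar>Im (A t * cnj (B t))\<bar>)"
  note area = Im_mult_cnj_triangle[OF sum]
  have "((\<lambda>t. lobachevsky (B t / C t)) has_real_derivative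
      - (?L - ln (norm (B t)) - ln (norm (C t))) * (Im (B' / B t) - Im (C' / C t))) (at t)"
    using lobachevsky_quotient_has_real_derivative[OF deriv(2,3) nonzero(2,3)] not_flat
    by (simp only: area not_False_eq_True)
  moreover have "((\<lambda>t. lobachevsky (C t / A t)) has_real_derivative
      - (?L - ln (norm (C t)) - ln (norm (A t))) * (Im (C' / C t) - Im (A' / A t))) (at t)"
    using lobachevsky_quotient_has_real_derivative[OF deriv(3,1) nonzero(3,1)] not_flat
    by (simp only: area neg_equal_0_iff_equal abs_minus_cancel not_False_eq_True)
  ultimately show ?thesis
    unfolding ideal_volume_def
    by (rule DERIV_cong[OF DERIV_add[OF DERIV_add[OF
        lobachevsky_quotient_has_real_derivative[OF deriv(1,2) nonzero(1,2) not_flat]]]])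
       (simp add: schlaefli_def algebra_simps)
qed

lemma parallel_paths_log_derivative:
  fixes P Q :: "real \<Rightarrow> complex"
  assumes P: "(P has_vector_derivative P') (at t)" and Q: "(Q has_vector_derivative Q') (at t)"
    and nonzero: "P t \<noteq> 0" "Q t \<noteq> 0" and parallel: "\<And>t. Im (P t * cnj (Q t)) = 0"
  shows "Im (P' / P t) = Im (Q' / Q t)"
proof -
  have "((\<lambda>t. Im (P t * cnj (Q t))) has_vector_derivative Im (P t * cnj Q' + P' * cnj (Q t))) (at t)"
    by (intro bounded_linear.has_vector_derivative[OF bounded_linear_Im] has_vector_derivative_mult P
          bounded_linear.has_vector_derivative[OF bounded_linear_cnj] Q)
  moreover have "((\<lambda>t. Im (P t * cnj (Q t))) has_vector_derivative 0) (at t)" unfolding parallel by simp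
  ultimately have deriv: "Im (P t * cnj Q' + P' * cnj (Q t)) = 0" by (rule vector_derivative_unique_at)
  obtain r where r: "P t * cnj (Q t) = of_real r"
    using parallel[of t] by (metis complex_is_Real_iff Reals_cases)
  have "r \<noteq> 0" using r nonzero by (metis complex_cnj_zero_iff mult_eq_0_iff of_real_0)
  have "P t * cnj Q' + P' * cnj (Q t) = of_real r * (cnj (Q' / Q t) + P' / P t)"
    unfolding r[symmetric] using nonzero by (simp add: field_simps)
  moreover have "Im (of_real r * (cnj v + u)) = r * (Im u - Im v)" for u v by simp
  ultimately have "r * (Im (P' / P t) - Im (Q' / Q t)) = 0" using deriv by metis
  then show ?thesis using \<open>r \<noteq> 0\<close> by simp
qed

definition affine_path :: "(real \<Rightarrow> complex) \<Rightarrow> complex \<Rightarrow> bool" where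
  "affine_path A A' \<longleftrightarrow> (\<forall>t. A t = A 0 + of_real t * A')"

lemma affine_path_has_vector_derivative:
  assumes "affine_path A A'" shows "(A has_vector_derivative A') (at t)"
proof -
  have "((\<lambda>t. A 0 + t *\<^sub>R A') has_vector_derivative A') (at t)"
    by (auto intro!: derivative_eq_intros simp: has_vector_derivative_def)
  moreover have "A = (\<lambda>t. A 0 + t *\<^sub>R A')"
    unfolding scaleR_conv_of_real by (rule ext) (use assms in \<open>unfold affine_path_def, blast\<close>)
  ultimately show ?thesis by (rule ssubst[rotated])
qed

lemma quadratic_zeros:
  fixes f :: "real \<Rightarrow> real"
  assumes "\<And>t. f t = p * t\<^sup>2 + q * t + r"
  shows "(\<forall>t. f t = 0) \<or> finite {t. f t = 0}"
proof (cases "[:r, q, p:] = 0")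
  case False
  have "f t = poly [:r, q, p:] t" for t using assms by (simp add: algebra_simps power2_eq_square)
  then show ?thesis using poly_roots_finite[OF False] by simp
qed (use assms in simp)

lemma affine_paths_parallel_times:
  assumes A: "affine_path A A'" and B: "affine_path B B'"
  shows "(\<forall>t. Im (A t * cnj (B t)) = 0) \<or> finite {t. Im (A t * cnj (B t)) = 0}"
proof (rule quadratic_zeros)
  fix t
  have "A t * cnj (B t) = (A 0 + of_real t * A') * cnj (B 0 + of_real t * B')"
    using A B unfolding affine_path_def by metis
  then show "Im (A t * cnj (B t)) = Im (A' * cnj B') * t\<^sup>2 + Im (A 0 * cnj B' + A' * cnj (B 0)) * t
    + Im (A 0 * cnj (B 0))"
    by (simp add: algebra_simps power2_eq_square)
qed

lemma ideal_volume_affine_derivative: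
  assumes affine: "affine_path A A'" "affine_path B B'" "affine_path C C'"
    and sum: "\<And>t. A t - B t + C t = 0"
  shows "\<forall>\<^sub>\<infinity>t. A t \<noteq> 0 \<and> B t \<noteq> 0 \<and> C t \<noteq> 0 \<longrightarrow>
    ((\<lambda>t. ideal_volume (A t) (B t) (C t)) has_real_derivative schlaefli (A t) (B t) (C t) A' B' C') (at t)"
proof (cases "\<forall>t. Im (A t * cnj (B t)) = 0")
  case False
  then have "finite {t. Im (A t * cnj (B t)) = 0}"
    using affine_paths_parallel_times[OF affine(1,2)] by blast
  then have "\<forall>\<^sub>\<infinity>t. Im (A t * cnj (B t)) \<noteq> 0" by (simp only: eventually_cofinite not_not)
  then show ?thesis
    by (rule eventually_mono)
       (intro impI ideal_volume_has_real_derivative affine[THEN affine_path_has_vector_derivative]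
          sum; simp)
next
  case True
  have "((\<lambda>t. ideal_volume (A t) (B t) (C t)) has_real_derivative
    schlaefli (A t) (B t) (C t) A' B' C') (at t)"
    if "A t \<noteq> 0" "B t \<noteq> 0" "C t \<noteq> 0" for t
  proof -
    note deriv = affine[THEN affine_path_has_vector_derivative]
    have "Im (A' / A t) = Im (B' / B t)"
      by (rule parallel_paths_log_derivative[OF deriv(1,2) that(1,2)]) (use True in blast)
    moreover have "Im (B' / B t) = Im (C' / C t)"
      by (rule parallel_paths_log_derivative[OF deriv(2,3) that(2,3)])
         (use True Im_mult_cnj_triangle(1)[OF sum] in metis)
    ultimately have "schlaefli (A t) (B t) (C t) A' B' C' = 0" by (simp add: schlaefli_def algebra_simps)
    moreover have "(\<lambda>t. ideal_volume (A t) (B t) (C t)) = (\<lambda>_. 0)"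
      using True ideal_volume_flat[OF sum] by blast
    ultimately show ?thesis by simp
  qed
  then show ?thesis by (intro always_eventually) blast
qed

lemma schlaefli_five_term:
  assumes "a \<noteq> 0" "b \<noteq> 0" "c \<noteq> 0" "b \<noteq> c" "z \<noteq> 0" "z \<noteq> b" "z \<noteq> c" "Im (a / z) = 0"
  shows "schlaefli (z * (b - c)) (b * (z - c)) (c * (z - b)) (a * (b - c)) (b * a) (c * a)
    - schlaefli (b - c) (z - c) (z - b) 0 a a
    - schlaefli (z - c) (- c) (- z) a 0 (- a) + schlaefli (z - b) (- b) (- z) a 0 (- a) = 0"
proof -
  have "Im (a * (b - c) / (z * (b - c))) = 0" "Im (- a / - z) = 0"
    "Im (b * a / (b * (z - c))) = Im (a / (z - c))" "Im (c * a / (c * (z - b))) = Im (a / (z - b))"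
    using assms by simp_all
  moreover have "ln (norm (z * (b - c))) = ln (norm z) + ln (norm (b - c))"
    "ln (norm (b * (z - c))) = ln (norm b) + ln (norm (z - c))"
    "ln (norm (c * (z - b))) = ln (norm c) + ln (norm (z - b))"
    using assms by (simp_all add: norm_mult ln_mult)
  ultimately show ?thesis
    by (simp only: schlaefli_def norm_minus_cancel) (simp add: algebra_simps)
qed

text \<open>The proof of the five-term relation moves \<open>a\<close> along a segment to \<open>0\<close>. Since \<open>a\<close> is the shortest of the
  three numbers, the segment does not meet \<open>b\<close> and \<open>c\<close>.\<close>

locale five_term_path =
  fixes a b c :: complex
  assumes nonzero: "a \<noteq> 0" "b \<noteq> 0" "c \<noteq> 0" and distinct: "a \<noteq> b" "a \<noteq> c" "b \<noteq> c"
    and shortest: "norm a \<le> norm b" "norm a \<le> norm c"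
begin

definition ray :: "real \<Rightarrow> complex" where
  "ray t = of_real t * a"

text \<open>Here \<open>a\<close> is not replaced by \<open>ray t\<close> where it only occurs as a factor, which makes the sum continuous
  at \<open>t = 0\<close>.\<close>

definition volume_sum :: "real \<Rightarrow> real" where
  "volume_sum t = ideal_volume (a * (b - c)) (b * (ray t - c)) (c * (ray t - b))
    - ideal_volume (b - c) (ray t - c) (ray t - b) + ideal_volume (b - c) (- c) (- b)
    - ideal_volume (ray t - c) (- c) (- a) + ideal_volume (ray t - b) (- b) (- a)"

lemma ray_neq:
  assumes t: "t \<in> {0..1}" and u: "u \<noteq> a" "norm a \<le> norm u" shows "ray t \<noteq> u"
proof
  assume "ray t = u"
  then have u_eq: "u = of_real t * a" by (simp add: ray_def)
  then have "norm u = t * norm a" using t by (simp add: norm_mult)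
  then have "t \<ge> 1" using u(2) nonzero by (simp add: mult_le_cancel_right1)
  then have "t = 1" using t by simp
  then show False using u_eq u(1) by simp
qed

lemma ray_minus_nonzero: "t \<in> {0..1} \<Longrightarrow> ray t - b \<noteq> 0" "t \<in> {0..1} \<Longrightarrow> ray t - c \<noteq> 0"
  using ray_neq distinct shortest by auto

lemma volume_sum_eq:
  assumes "t \<noteq> 0"
  shows "volume_sum t = ideal_volume (ray t * (b - c)) (b * (ray t - c)) (c * (ray t - b))
    - ideal_volume (b - c) (ray t - c) (ray t - b) + ideal_volume (b - c) (- c) (- b)
    - ideal_volume (ray t - c) (- c) (- ray t) + ideal_volume (ray t - b) (- b) (- ray t)"
proof -
  have "ideal_volume (ray t * k) A B = ideal_volume (a * k) A B" for k A B
    using ideal_volume_of_real_mult[OF assms, of "a * k"] by (simp add: ray_def mult.assoc)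
  moreover have "ideal_volume A B (- ray t) = ideal_volume A B (- a)" for A B
    using ideal_volume_of_real_mult[OF assms, of "- a" A B]
    by (simp add: ray_def ideal_volume_rotate[of A B])
  ultimately show ?thesis by (simp only: volume_sum_def)
qed

lemma continuous_on_volume_sum: "continuous_on {0..1} volume_sum"
proof -
  have "continuous_on {0..1} ray" unfolding ray_def by (intro continuous_intros)
  then show ?thesis
    unfolding volume_sum_def
    by (intro continuous_on_add continuous_on_diff continuous_on_ideal_volume continuous_on_mult
        continuous_on_const)
       (use ray_minus_nonzero nonzero distinct in auto)
qed

lemma volume_sum_0: "volume_sum 0 = 0"
  using ideal_volume_degenerate[of "a * (b - c)" "- (b * c)"] ideal_volume_degenerate[of "- a" "- c"]
    ideal_volume_degenerate[of "- a" "- b"]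
  by (simp add: volume_sum_def ray_def ideal_volume_rotate[of "- c" "- c"]
      ideal_volume_rotate[of "- b" "- b"] mult.commute)

lemma volume_sum_has_derivative_0:
  "\<forall>\<^sub>\<infinity>t. t \<in> {0..1} \<longrightarrow> (volume_sum has_real_derivative 0) (at t)"
proof -
  have affine: "affine_path (\<lambda>t. ray t * (b - c)) (a * (b - c))" "affine_path (\<lambda>t. b * (ray t - c)) (b * a)"
    "affine_path (\<lambda>t. c * (ray t - b)) (c * a)" "affine_path (\<lambda>t. - ray t) (- a)"
    by (simp_all add: affine_path_def ray_def algebra_simps)
  have affine_edge: "affine_path (\<lambda>t. b - c) 0" "affine_path (\<lambda>t. ray t - u) a"
    "affine_path (\<lambda>t. - u) 0" for u
    by (simp_all add: affine_path_def ray_def)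
  have triangle: "ray t * (b - c) - b * (ray t - c) + c * (ray t - b) = 0"
    "(b - c) - (ray t - c) + (ray t - b) = 0" "(ray t - u) - (- u) + (- ray t) = 0" for t u
    by (simp_all add: algebra_simps)
  note face_derivatives =
    ideal_volume_affine_derivative[OF affine(1-3) triangle(1)]
    ideal_volume_affine_derivative[OF affine_edge(1) affine_edge(2)[of c] affine_edge(2)[of b] triangle(2)]
    ideal_volume_affine_derivative[OF affine_edge(2)[of c] affine_edge(3)[of c] affine(4) triangle(3)]
    ideal_volume_affine_derivative[OF affine_edge(2)[of b] affine_edge(3)[of b] affine(4) triangle(3)]
  have "\<forall>\<^sub>\<infinity>t. t \<noteq> (0 :: real)" by (simp add: eventually_cofinite)
  with face_derivatives show ?thesis
  proof eventually_elim
    case (elim t)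
    show ?case
    proof
      assume t: "t \<in> {0..1}"
      then have "t > 0" "ray t \<noteq> 0" "Im (a / ray t) = 0" using nonzero elim(5) by (auto simp: ray_def)
      moreover have "ray t \<noteq> b" "ray t \<noteq> c" using ray_minus_nonzero t by auto
      ultimately have "((\<lambda>t. ideal_volume (ray t * (b - c)) (b * (ray t - c)) (c * (ray t - b))
          - ideal_volume (b - c) (ray t - c) (ray t - b) + ideal_volume (b - c) (- c) (- b)
          - ideal_volume (ray t - c) (- c) (- ray t) + ideal_volume (ray t - b) (- b) (- ray t))
        has_real_derivative 0) (at t)"
        using nonzero distinct
        by (intro DERIV_cong[OF DERIV_add[OF DERIV_diff[OF DERIV_add[OF DERIV_diff[OF elim(1,2)[THEN mp]]
              DERIV_const] elim(3)[THEN mp]] elim(4)[THEN mp]]])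
           (auto simp: schlaefli_five_term)
      then show "(volume_sum has_real_derivative 0) (at t)"
        by (rule has_field_derivative_transform_within_open[OF _ open_greaterThan[of 0]])
           (use \<open>t > 0\<close> volume_sum_eq in auto)
    qed
  qed
qed

lemma volume_sum_1: "volume_sum 1 = 0"
proof -
  let ?S = "{t. \<not> (t \<in> {0..1} \<longrightarrow> (volume_sum has_real_derivative 0) (at t))}"
  have "finite ?S" using volume_sum_has_derivative_0 by (simp only: eventually_cofinite)
  moreover have "(volume_sum has_derivative (\<lambda>h. 0)) (at t within {0..1})" if "t \<in> {0..1} - ?S" for t
    using that by (auto simp: has_field_derivative_def lambda_zero intro: has_derivative_at_withinI)
  ultimately show ?thesis
    by (rule has_derivative_zero_unique_strong_interval[OF _ continuous_on_volume_sum volume_sum_0]) auto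
qed

lemma five_term:
  "ideal_volume (a * (b - c)) (b * (a - c)) (c * (a - b)) - ideal_volume (b - c) (a - c) (a - b)
    + ideal_volume (b - c) (- c) (- b) - ideal_volume (a - c) (- c) (- a)
    + ideal_volume (a - b) (- b) (- a) = 0"
  using volume_sum_1 by (simp add: volume_sum_def ray_def)

end

section \<open>A bounded class of degree three: the volume cocycle\<close>

typedef gauss_rat = "{z :: complex. Re z \<in> \<rat> \<and> Im z \<in> \<rat>}" morphisms to_complex Abs_gauss_rat
  by (rule exI[of _ 0]) simp

setup_lifting type_definition_gauss_rat

instantiation gauss_rat :: field
begin

lift_definition zero_gauss_rat :: gauss_rat is 0 by simp
lift_definition one_gauss_rat :: gauss_rat is 1 by simp
lift_definition plus_gauss_rat :: "gauss_rat \<Rightarrow> gauss_rat \<Rightarrow> gauss_rat" is "(+)" by simp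
lift_definition minus_gauss_rat :: "gauss_rat \<Rightarrow> gauss_rat \<Rightarrow> gauss_rat" is "(-)" by simp
lift_definition uminus_gauss_rat :: "gauss_rat \<Rightarrow> gauss_rat" is uminus by simp
lift_definition times_gauss_rat :: "gauss_rat \<Rightarrow> gauss_rat \<Rightarrow> gauss_rat" is "(*)" by simp
lift_definition inverse_gauss_rat :: "gauss_rat \<Rightarrow> gauss_rat" is inverse by simp
lift_definition divide_gauss_rat :: "gauss_rat \<Rightarrow> gauss_rat \<Rightarrow> gauss_rat" is "(/)"
  by (simp add: Re_divide Im_divide)

instance
  by standard (transfer; simp add: algebra_simps divide_inverse)+

end

instantiation gauss_rat :: det_field
begin

definition admissible_gauss_rat :: "gauss_rat \<Rightarrow> bool" where "admissible_gauss_rat x \<longleftrightarrow> x \<noteq> 0"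

instance by standard (auto simp: admissible_gauss_rat_def)

end

instance gauss_rat :: countable
proof
  have "\<forall>x. \<exists>p q. to_complex x = Complex (of_rat p) (of_rat q)"
  proof
    fix x
    have "Re (to_complex x) \<in> \<rat>" "Im (to_complex x) \<in> \<rat>" using to_complex[of x] by simp_all
    then show "\<exists>p q. to_complex x = Complex (of_rat p) (of_rat q)"
      by (elim Rats_cases) (auto simp: complex_eq_iff)
  qed
  then obtain p q where "\<And>x. to_complex x = Complex (of_rat (p x)) (of_rat (q x))" by metis
  then have "inj (\<lambda>x. to_nat (p x, q x))"
    by (intro injI) (metis to_complex_inject from_nat_to_nat prod.inject)
  then show "\<exists>to_nat :: gauss_rat \<Rightarrow> nat. inj to_nat" by blast
qed

lemma to_complex_simps [simp]:
  "to_complex 0 = 0" "to_complex 1 = 1" "to_complex (x + y) = to_complex x + to_complex y"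
  "to_complex (x - y) = to_complex x - to_complex y"
  "to_complex (- x) = - to_complex x" "to_complex (x * y) = to_complex x * to_complex y"
  by (transfer, simp)+

lemma to_complex_eq_0_iff [simp]: "to_complex x = 0 \<longleftrightarrow> x = 0"
  by transfer simp

fun volume_cochain :: "gauss_rat gl2 list \<Rightarrow> real" where
  "volume_cochain [x, y, z, w] = ideal_volume (to_complex (column_det x y * column_det z w))
     (to_complex (column_det x z * column_det y w)) (to_complex (column_det x w * column_det y z))"
| "volume_cochain _ = 0"

lemma volume_cochain_eq_0_if_length: "length l \<noteq> 4 \<Longrightarrow> volume_cochain l = 0"
  by (cases l rule: volume_cochain.cases) auto

lemma volume_cochain_swap:
  "volume_cochain [y, x, z, w] = - volume_cochain [x, y, z, w]"
  "volume_cochain [x, z, y, w] = - volume_cochain [x, y, z, w]"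
  "volume_cochain [x, y, w, z] = - volume_cochain [x, y, z, w]"
proof -
  have swap_right: "ideal_volume A C B = - ideal_volume A B C" for A B C
    using ideal_volume_rotate[of A C B] ideal_volume_swap[of B A C] by linarith
  show "volume_cochain [y, x, z, w] = - volume_cochain [x, y, z, w]"
    by (simp add: column_det_swap[of y x] ideal_volume_minus_left mult.commute
        swap_right[of _ "to_complex (column_det x z) * _"])
  show "volume_cochain [x, y, w, z] = - volume_cochain [x, y, z, w]"
    by (simp add: column_det_swap[of w z] ideal_volume_minus_left
        swap_right[of _ "to_complex (column_det x z) * _"])
  show "volume_cochain [x, z, y, w] = - volume_cochain [x, y, z, w]"
    by (simp add: column_det_swap[of z y] ideal_volume_minus_right
        ideal_volume_swap[of "to_complex (column_det x z) * _"])
qed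

lemma alternating_volume_cochain: "alternating volume_cochain"
  unfolding alternating_def
proof (intro allI)
  fix l x y and l' :: "gauss_rat gl2 list"
  show "volume_cochain (l @ [y, x] @ l') = - volume_cochain (l @ [x, y] @ l')"
  proof (cases "length l + length l' = 2")
    case True
    then consider z w where "l = []" "l' = [z, w]" | z w where "l = [z]" "l' = [w]"
      | z w where "l = [z, w]" "l' = []"
      by (cases l; cases l'; cases "tl l"; cases "tl l'") auto
    then show ?thesis
      by cases (simp_all only: append_Cons append_Nil volume_cochain_swap(1)[of y x]
          volume_cochain_swap(2)[of _ y x] volume_cochain_swap(3)[of _ _ y x])
  qed (simp add: volume_cochain_eq_0_if_length)
qed

lemma parallel_invariant_volume_cochain: "parallel_invariant volume_cochain"
  unfolding parallel_invariant_def
proof (intro allI impI)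
  fix l l' :: "gauss_rat gl2 list" assume par: "parallel l l'"
  show "volume_cochain l = volume_cochain l'"
  proof (cases l rule: volume_cochain.cases)
    case (1 x y z w)
    then obtain x' y' z' w' where l': "l' = [x', y', z', w']"
      and cols: "column_det x x' = 0" "column_det y y' = 0" "column_det z z' = 0" "column_det w w' = 0"
      using par by (auto simp: parallel_def list_all2_Cons1)
    obtain a where a: "a \<noteq> 0" "m11 x' = a * m11 x" "m21 x' = a * m21 x"
      using column_det_0E[OF cols(1)] by blast
    obtain b where b: "b \<noteq> 0" "m11 y' = b * m11 y" "m21 y' = b * m21 y"
      using column_det_0E[OF cols(2)] by blast
    obtain c where c: "c \<noteq> 0" "m11 z' = c * m11 z" "m21 z' = c * m21 z"
      using column_det_0E[OF cols(3)] by blast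
    obtain d where d: "d \<noteq> 0" "m11 w' = d * m11 w" "m21 w' = d * m21 w"
      using column_det_0E[OF cols(4)] by blast
    define k where "k = a * b * c * d"
    have "column_det x' y' * column_det z' w' = k * (column_det x y * column_det z w)"
      "column_det x' z' * column_det y' w' = k * (column_det x z * column_det y w)"
      "column_det x' w' * column_det y' z' = k * (column_det x w * column_det y z)"
      unfolding column_det_def k_def a b c d by (simp_all add: algebra_simps)
    moreover have "to_complex k \<noteq> 0" using a b c d by (simp add: k_def)
    ultimately show ?thesis using ideal_volume_mult[of "to_complex k"] unfolding 1 l' by simp
  qed (use par in \<open>auto simp: parallel_def list_all2_Cons1\<close>)
qed

text \<open>The affine coordinate of a point of the projective line in which \<open>p\<close> is \<open>\<infinity>\<close> and \<open>q\<close> is \<open>0\<close>.\<close>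

definition affine_coordinate :: "gauss_rat gl2 \<Rightarrow> gauss_rat gl2 \<Rightarrow> gauss_rat gl2 \<Rightarrow> complex" where
  "affine_coordinate p q i = - to_complex (column_det q i) / to_complex (column_det p i)"

context
  fixes p q :: "gauss_rat gl2" and a P
  assumes base: "column_det p q \<noteq> 0"
  defines "a \<equiv> affine_coordinate p q" and "P \<equiv> \<lambda>i. to_complex (column_det p i)"
begin

lemma to_complex_column_det_base:
  assumes "column_det p i \<noteq> 0" shows "to_complex (column_det q i) = - (a i * P i)"
  using assms by (simp add: a_def P_def affine_coordinate_def)

lemma to_complex_column_det_eq:
  assumes i: "column_det p i \<noteq> 0" and j: "column_det p j \<noteq> 0"
  shows "to_complex (column_det i j) = P i * P j / to_complex (column_det p q) * (a i - a j)"
proof -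
  have "to_complex (column_det p q * column_det i j - column_det p i * column_det q j
    + column_det p j * column_det q i) = 0"
    unfolding column_det_plucker by simp
  then have "to_complex (column_det p q) * to_complex (column_det i j)
      = P i * to_complex (column_det q j) - P j * to_complex (column_det q i)"
    by (simp add: P_def algebra_simps)
  also have "\<dots> = P i * P j * (a i - a j)"
    by (simp add: to_complex_column_det_base i j algebra_simps)
  finally show ?thesis using base by (simp add: field_simps)
qed

lemma volume_cochain_both_base_points:
  assumes i: "column_det p i \<noteq> 0" and j: "column_det p j \<noteq> 0"
  shows "volume_cochain [p, q, i, j] = ideal_volume (a i - a j) (- a j) (- a i)"
proof -
  have "P i * P j \<noteq> 0" using i j by (simp add: P_def)
  moreover have "to_complex (column_det p q * column_det i j) = (P i * P j) * (a i - a j)"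
    using base by (simp add: to_complex_column_det_eq i j)
  moreover have "to_complex (column_det p i * column_det q j) = (P i * P j) * (- a j)"
    by (simp add: to_complex_column_det_base j P_def)
  moreover have "to_complex (column_det p j * column_det q i) = (P i * P j) * (- a i)"
    by (simp add: to_complex_column_det_base i P_def)
  ultimately show ?thesis by (simp only: volume_cochain.simps ideal_volume_mult not_False_eq_True)
qed

lemma volume_cochain_one_base_point:
  assumes i: "column_det p i \<noteq> 0" and j: "column_det p j \<noteq> 0" and k: "column_det p k \<noteq> 0"
  shows "volume_cochain [p, i, j, k] = ideal_volume (a j - a k) (a i - a k) (a i - a j)"
    "volume_cochain [q, i, j, k] = ideal_volume (a i * (a j - a k)) (a j * (a i - a k)) (a k * (a i - a j))"
proof -
  let ?k = "P i * P j * P k / to_complex (column_det p q)"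
  have "?k \<noteq> 0" using base i j k by (simp add: P_def)
  moreover have "to_complex (column_det p i * column_det j k) = ?k * (a j - a k)"
    "to_complex (column_det p j * column_det i k) = ?k * (a i - a k)"
    "to_complex (column_det p k * column_det i j) = ?k * (a i - a j)"
    by (simp_all add: to_complex_column_det_eq i j k P_def)
  ultimately show "volume_cochain [p, i, j, k] = ideal_volume (a j - a k) (a i - a k) (a i - a j)"
    by (simp only: volume_cochain.simps ideal_volume_mult not_False_eq_True)
  have "- ?k \<noteq> 0" using \<open>?k \<noteq> 0\<close> by simp
  moreover have "to_complex (column_det q i * column_det j k) = - ?k * (a i * (a j - a k))"
    "to_complex (column_det q j * column_det i k) = - ?k * (a j * (a i - a k))"
    "to_complex (column_det q k * column_det i j) = - ?k * (a k * (a i - a j))"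
    by (simp_all add: to_complex_column_det_eq to_complex_column_det_base i j k)
  ultimately show "volume_cochain [q, i, j, k]
      = ideal_volume (a i * (a j - a k)) (a j * (a i - a k)) (a k * (a i - a j))"
    by (simp only: volume_cochain.simps ideal_volume_mult not_False_eq_True)
qed

lemma cobound_volume_cochain_shortest:
  assumes nonparallel: "pairwise_nonparallel [p, q, r, s, u]"
    and shortest: "norm (a r) \<le> norm (a s)" "norm (a r) \<le> norm (a u)"
  shows "cobound volume_cochain [p, q, r, s, u] = 0"
proof -
  have p: "column_det p r \<noteq> 0" "column_det p s \<noteq> 0" "column_det p u \<noteq> 0"
    and rest: "column_det q r \<noteq> 0" "column_det q s \<noteq> 0" "column_det q u \<noteq> 0"
      "column_det r s \<noteq> 0" "column_det r u \<noteq> 0" "column_det s u \<noteq> 0"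
    using nonparallel by (simp_all add: pairwise_nonparallel_def)
  have "a i \<noteq> 0" if "column_det q i \<noteq> 0" "column_det p i \<noteq> 0" for i
    using that by (simp add: a_def affine_coordinate_def)
  moreover have "a i \<noteq> a j" if "column_det i j \<noteq> 0" "column_det p i \<noteq> 0" "column_det p j \<noteq> 0" for i j
    using to_complex_column_det_eq[OF that(2,3)] that(1) by auto
  ultimately have "five_term_path (a r) (a s) (a u)"
    using p rest shortest by unfold_locales auto
  from five_term_path.five_term[OF this] show ?thesis
    by (simp only: cobound.simps volume_cochain_both_base_points volume_cochain_one_base_point p
        not_False_eq_True)
qed

end

lemma cobound_volume_cochain: assumes "length xs = 5" shows "cobound volume_cochain xs = 0"
proof (rule cobound_alternating_eq_0[OF alternating_volume_cochain parallel_invariant_volume_cochain])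
  assume nonparallel: "pairwise_nonparallel xs"
  obtain p q r s u where xs: "xs = [p, q, r, s, u]"
    using assms by (auto simp: numeral_eq_Suc length_Suc_conv)
  let ?n = "\<lambda>i. norm (affine_coordinate p q i)"
  note nonparallel = nonparallel[unfolded xs pairwise_nonparallel_def, simplified]
  note alternatingD[OF alternating_cobound[OF alternating_volume_cochain]]
  then have swap: "cobound volume_cochain [p, q, s, r, u] = - cobound volume_cochain [p, q, r, s, u]"
    "cobound volume_cochain [p, q, r, u, s] = - cobound volume_cochain [p, q, r, s, u]" for r s u
    by (metis append_Cons append_Nil)+
  have nonzero_swap: "column_det s r \<noteq> 0" "column_det u r \<noteq> 0" "column_det u s \<noteq> 0"
    using nonparallel by (auto simp: column_det_swap[of r s] column_det_swap[of r u]
        column_det_swap[of s u])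
  consider (r_shortest) "?n r \<le> ?n s" "?n r \<le> ?n u" | (s_shortest) "?n s \<le> ?n r" "?n s \<le> ?n u"
    | (u_shortest) "?n u \<le> ?n r" "?n u \<le> ?n s"
    by linarith
  then have "cobound volume_cochain [p, q, r, s, u] = 0"
  proof cases
    case r_shortest
    then show ?thesis
      by (intro cobound_volume_cochain_shortest)
         (use nonparallel in \<open>simp_all add: pairwise_nonparallel_def\<close>)
  next
    case s_shortest
    then have "cobound volume_cochain [p, q, s, r, u] = 0"
      by (intro cobound_volume_cochain_shortest)
         (use nonparallel nonzero_swap in \<open>simp_all add: pairwise_nonparallel_def\<close>)
    then show ?thesis using swap(1)[of r s u] by linarith
  next
    case u_shortest
    then have "cobound volume_cochain [p, q, u, r, s] = 0"
      by (intro cobound_volume_cochain_shortest)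
         (use nonparallel nonzero_swap in \<open>simp_all add: pairwise_nonparallel_def\<close>)
    then show ?thesis using swap(1)[of r u s] swap(2)[of r s u] by linarith
  qed
  then show "cobound volume_cochain xs = 0" by (simp only: xs)
qed

lemma bounded_cochain_volume_cochain: "bounded_cochain volume_cochain"
proof (rule bounded_cochainI)
  fix xs
  have "0 \<le> 3 * suminf (\<lambda>n. 1 / real n ^ 2)" using abs_ideal_volume_le[of 0 0 0] by linarith
  then show "\<bar>volume_cochain xs\<bar> \<le> (\<lambda>_. 3 * suminf (\<lambda>n. 1 / real n ^ 2)) (length xs)"
    by (cases xs rule: volume_cochain.cases) (auto simp: abs_ideal_volume_le)
qed

lemma bounded_cocycle_volume_cochain: "bounded_cocycle 3 volume_cochain"
proof -
  have "volume_cochain (map ((+) g) xs) = volume_cochain xs" for g xs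
  proof (cases xs rule: volume_cochain.cases)
    case (1 x y z w)
    let ?k = "to_complex (gl2_det g * gl2_det g)"
    have "?k \<noteq> 0" using gl2_det_nonzero[of g] by simp
    moreover have "to_complex (column_det (g + x) (g + y) * column_det (g + z) (g + w))
        = ?k * to_complex (column_det x y * column_det z w)" for x y z w
      by (simp add: column_det_plus mult_ac)
    ultimately show ?thesis
      unfolding 1 list.map volume_cochain.simps by (simp only: ideal_volume_mult not_False_eq_True)
  qed auto
  then show ?thesis
    using cobound_volume_cochain bounded_cochain_volume_cochain
    by (simp add: bounded_cocycle_def invariant_cochain_def translation_invariant_def)
qed

lemma ideal_volume_regular: "ideal_volume (1 - \<i>) (- \<i>) (- 1) = Im (Li2 \<i>)"
proof -
  have "(1 - \<i>) / (- \<i>) = 1 + \<i>" "- 1 / (1 - \<i>) = of_real (- 1 / 2) * (1 + \<i>)"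
    by (simp_all add: complex_eq_iff Re_divide Im_divide)
  moreover have "\<i> / cnj \<i> = - 1" by (simp add: complex_eq_iff Re_divide Im_divide)
  then have "lobachevsky \<i> = 0" using Im_Li2_real[of "- 1"] by (simp add: lobachevsky_def)
  moreover have "(1 + \<i>) / cnj (1 + \<i>) = \<i>" by (simp add: complex_eq_iff Re_divide Im_divide)
  then have "lobachevsky (1 + \<i>) = Im (Li2 \<i>) / 2" by (simp add: lobachevsky_def)
  ultimately show ?thesis
    by (simp only: ideal_volume_def lobachevsky_of_real_mult) simp
qed

lemma not_bounded_coboundary_volume_cochain: "\<not> bounded_coboundary 3 volume_cochain"
proof
  assume coboundary: "bounded_coboundary 3 volume_cochain"
  obtain m :: "(gauss_rat gl2 \<Rightarrow> real) \<Rightarrow> real" where "borel_mean m" using ex_borel_mean by blast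
  then interpret borel_mean m .
  define j where "j = Abs_gauss_rat \<i>"
  have j: "to_complex j = \<i>" by (simp add: j_def Abs_gauss_rat_inverse)
  then have "j \<noteq> 0" "j \<noteq> 1"
    by (metis to_complex_simps(1) complex_i_not_zero, metis to_complex_simps(2) complex_i_not_one)
  let ?T = "[0, point 0, point 1, point j]" and ?T' = "[point 0, 0, point 1, point j]"
  have triple: "imean m [x, y, z] F = imean m [0, point 0, point 1] F"
    if "column_det x y \<noteq> 0" "column_det x z \<noteq> 0" "column_det z y \<noteq> 0" "invariant_cochain F" for x y z F
  proof -
    have "admissible (column_det z y * column_det x z * column_det x y)"
      using that by (simp add: admissible_gauss_rat_def)
    from parallel_frame_triple[OF this] show ?thesis by (rule imean_parallel_translate[OF that(4)])
  qed
  have "bounded_cycle 3 (\<lambda>F. imean m ?T F - imean m ?T' F)"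
  proof (rule bounded_cycle_imean_diff[where fs = "[0, point 0, point 1]"])
    fix F :: "gauss_rat gl2 list \<Rightarrow> real" and i :: nat assume F: "invariant_cochain F" and "i \<le> 3"
    then have i: "i = 0 \<or> i = Suc 0 \<or> i = Suc (Suc 0) \<or> i = Suc (Suc (Suc 0))" by auto
    show "imean m (delete_nth i ?T) F = imean m [0, point 0, point 1] F"
      "imean m (delete_nth i ?T') F = imean m [0, point 0, point 1] F"
      using i by (elim disjE; simp only: delete_nth_0 delete_nth_Suc; intro triple F refl;
          simp add: \<open>j \<noteq> 0\<close> \<open>j \<noteq> 1\<close>)+
  qed simp_all
  then have "imean m ?T volume_cochain - imean m ?T' volume_cochain = 0"
    by (rule bounded_cycle.bounded_coboundary_eq_0[OF _ coboundary bounded_cochain_volume_cochain])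
  moreover have "imean m l volume_cochain = volume_cochain l" for l
    using parallel_invariant_volume_cochain
    by (intro imean_parallel_invariant) (simp add: parallel_invariant_def)
  ultimately have "volume_cochain ?T = volume_cochain ?T'" by (simp only: right_minus_eq)
  moreover have "volume_cochain ?T = Im (Li2 \<i>)" using ideal_volume_regular by (simp add: j)
  ultimately show False
    using Im_Li2_i_pos volume_cochain_swap(1)[of "point 0" 0 "point 1" "point j"] by linarith
qed

section \<open>Nontrivial classes of groups of lamps\<close>

definition nontrivial_cocycle :: "nat \<Rightarrow> ('g::group_add list \<Rightarrow> real) \<Rightarrow> bool" where
  "nontrivial_cocycle n F \<longleftrightarrow> bounded_cocycle n F \<and> \<not> bounded_coboundary n F"

lemma nontrivial_cocycle_retract:
  assumes "additive r" "additive s" "\<And>a. r (s a) = a" "nontrivial_cocycle n F"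
  shows "nontrivial_cocycle n (\<lambda>xs. F (map r xs))"
  using assms(4) bounded_cocycle_pullback[OF assms(1)] not_bounded_coboundary_retract[OF assms(2,3)]
  by (auto simp: nontrivial_cocycle_def)

definition pull_lamps :: "(nat \<Rightarrow> nat) \<Rightarrow> 'g::group_add lamps \<Rightarrow> 'g lamps" where
  "pull_lamps h x = Abs_lamps (\<lambda>j. lamp x (h j))"

definition push_lamps :: "(nat \<Rightarrow> nat) \<Rightarrow> 'g::group_add lamps \<Rightarrow> 'g lamps" where
  "push_lamps h x = Abs_lamps (\<lambda>i. if i \<in> range h then lamp x (inv_into UNIV h i) else 0)"

lemma lamp_pull_lamps: assumes "inj h" shows "lamp (pull_lamps h x) j = lamp x (h j)"
proof -
  have "{j. lamp x (h j) \<noteq> 0} = h -` {i. lamp x i \<noteq> 0}" by auto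
  then have "finite {j. lamp x (h j) \<noteq> 0}" using finite_vimageI[OF finite_lamp assms] by simp
  then show ?thesis by (simp add: pull_lamps_def lamp_Abs_lamps)
qed

lemma lamp_push_lamps:
  assumes "inj h" shows "lamp (push_lamps h x) i = (if i \<in> range h then lamp x (inv_into UNIV h i) else 0)"
proof -
  have "{i. (if i \<in> range h then lamp x (inv_into UNIV h i) else 0) \<noteq> 0} \<subseteq> h ` {i. lamp x i \<noteq> 0}"
    using assms by (auto simp: inv_f_f split: if_splits)
  then have "finite {i. (if i \<in> range h then lamp x (inv_into UNIV h i) else 0) \<noteq> 0}"
    by (rule finite_subset[OF _ finite_imageI[OF finite_lamp]])
  then show ?thesis by (simp add: push_lamps_def lamp_Abs_lamps)
qed

lemma pull_push_lamps: "inj h \<Longrightarrow> pull_lamps h (push_lamps h x) = x"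
  by (rule lamps_eqI) (simp add: lamp_pull_lamps lamp_push_lamps inv_f_f)

lemma pull_push_lamps_disjoint:
  "inj h \<Longrightarrow> inj h' \<Longrightarrow> range h \<inter> range h' = {} \<Longrightarrow> pull_lamps h (push_lamps h' x) = 0"
  by (rule lamps_eqI) (auto simp: lamp_pull_lamps lamp_push_lamps)

lemma additive_pull_lamps: "inj h \<Longrightarrow> additive (pull_lamps h)"
  by (auto simp: additive_def lamp_pull_lamps intro!: lamps_eqI)

lemma additive_push_lamps: "inj h \<Longrightarrow> additive (push_lamps h)"
  by (auto simp: additive_def lamp_push_lamps intro!: lamps_eqI)

lemma additive_single: assumes "additive s" shows "additive (\<lambda>a. single i (s a))"
proof -
  have "s 0 + 0 = s 0 + s 0" using assms unfolding additive_def by (metis add_0_right)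
  then have "0 = s 0" by (rule add_left_imp_eq)
  then show ?thesis using assms by (auto simp: additive_def lamp_single intro!: lamps_eqI)
qed

lemma additive_lamp: "additive r \<Longrightarrow> additive (\<lambda>x. r (lamp x i))"
  by (simp add: additive_def)

lemma nontrivial_cocycle_lamp:
  assumes "additive r" "additive s" "\<And>a. r (s a) = a" "nontrivial_cocycle n F"
  shows "nontrivial_cocycle n (\<lambda>xs. F (map (\<lambda>x. r (lamp x i)) xs))"
  by (rule nontrivial_cocycle_retract[OF additive_lamp additive_single])
     (use assms in \<open>auto simp: lamp_single\<close>)

text \<open>The first lamp and the remaining lamps are commuting subgroups, so that the cup product of a class
  of the first lamp that is detected by a cycle with a class of the remaining lamps can be detected.\<close>

lemma nontrivial_cocycle_lamps_cup:
  fixes r :: "'g::group_add \<Rightarrow> 'k::group_add"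
  assumes rs: "additive r" "additive s" "\<And>a. r (s a) = a"
    and "bounded_cycle m \<mu>" and F: "bounded_cocycle m F" "normalized F" "\<mu> F \<noteq> 0"
    and G: "nontrivial_cocycle n G"
  shows "nontrivial_cocycle (m + n)
    (cup m (\<lambda>xs. F (map (\<lambda>x. r (lamp x 0)) xs)) (\<lambda>xs. G (map (pull_lamps Suc) xs)))"
proof -
  interpret bounded_cycle m \<mu> by fact
  have others: "lamp (push_lamps Suc y) 0 = 0" for y :: "'g lamps" by (auto simp: lamp_push_lamps)
  interpret slant_product m \<mu> "\<lambda>a. single 0 (s a)" "push_lamps Suc"
  proof
    fix a and y :: "'g lamps"
    show "single 0 (s a) + push_lamps Suc y = push_lamps Suc y + single 0 (s a)"
    proof (rule lamps_eqI)
      fix j show "lamp (single 0 (s a) + push_lamps Suc y) j = lamp (push_lamps Suc y + single 0 (s a)) j"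
        using others[of y] by (cases j) (simp_all add: lamp_single)
    qed
  qed (auto intro: additive_single rs additive_push_lamps)
  have "pull_lamps Suc (single 0 (s a) + push_lamps Suc y) = y" for a y
    by (rule lamps_eqI) (simp add: lamp_pull_lamps lamp_single lamp_push_lamps inv_f_f)
  moreover have "r (lamp (single 0 (s a) + push_lamps Suc y) 0) = a" for a y
    using others rs(3) by (simp add: lamp_single)
  moreover have "bounded_cochain F" using F(1) by (simp add: bounded_cocycle_def invariant_cochain_def)
  ultimately have "\<not> bounded_coboundary (m + n)
      (cup m (\<lambda>xs. F (map (\<lambda>x. r (lamp x 0)) xs)) (\<lambda>xs. G (map (pull_lamps Suc) xs)))"
    using G F(2,3) by (intro cup_not_bounded_coboundary) (auto simp: nontrivial_cocycle_def)
  then show ?thesis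
    using F(1) G by (auto simp: nontrivial_cocycle_def intro!: bounded_cocycle_cup bounded_cocycle_pullback
        additive_lamp rs(1) additive_pull_lamps)
qed

theorem ex_nontrivial_cocycle:
  "n \<ge> 2 \<Longrightarrow> \<exists>F :: (rat gl2 \<times> gauss_rat gl2) lamps list \<Rightarrow> real. nontrivial_cocycle n F"
proof (induction n rule: less_induct)
  case (less n)
  have additive: "additive fst" "additive (\<lambda>a. (a, 0))" "additive snd" "additive (\<lambda>b. (0, b))"
    by (simp_all add: additive_def)
  obtain \<mu> where \<mu>: "bounded_cycle 2 \<mu>" "\<mu> orientation \<noteq> 0" using ex_bounded_cycle_orientation by blast
  consider (two) "n = 2" | (three) "n = 3" | (large) "n \<ge> 4" using less.prems by linarith
  then show ?case
  proof cases
    case two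
    have "\<not> bounded_coboundary 2 orientation"
      using bounded_cycle.bounded_coboundary_eq_0[OF \<mu>(1) _ bounded_cochain_orientation] \<mu>(2) by blast
    then have "nontrivial_cocycle 2 orientation"
      by (simp add: nontrivial_cocycle_def bounded_cocycle_orientation)
    then show ?thesis using nontrivial_cocycle_lamp[OF additive(1,2)] two by fastforce
  next
    case three
    have "nontrivial_cocycle 3 volume_cochain"
      by (simp add: nontrivial_cocycle_def bounded_cocycle_volume_cochain
          not_bounded_coboundary_volume_cochain)
    then show ?thesis using nontrivial_cocycle_lamp[OF additive(3,4)] three by fastforce
  next
    case large
    have "\<exists>G :: (rat gl2 \<times> gauss_rat gl2) lamps list \<Rightarrow> real. nontrivial_cocycle (n - 2) G"
      by (rule less.IH) (use large in auto)
    then obtain G :: "(rat gl2 \<times> gauss_rat gl2) lamps list \<Rightarrow> real" where "nontrivial_cocycle (n - 2) G" ..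
    moreover have "normalized orientation"
      by (intro normalized_alternating alternating_orientation parallel_invariant_orientation)
    moreover have "fst (a, 0) = a" for a :: "rat gl2" by simp
    ultimately have "\<exists>F :: (rat gl2 \<times> gauss_rat gl2) lamps list \<Rightarrow> real. nontrivial_cocycle (2 + (n - 2)) F"
      using nontrivial_cocycle_lamps_cup[OF additive(1,2) _ \<mu>(1) bounded_cocycle_orientation _ \<mu>(2)]
      by blast
    moreover have "2 + (n - 2) = n" using large by simp
    ultimately show ?thesis by (simp only:)
  qed
qed

section \<open>A continuum of linearly independent classes\<close>

definition abel_mean :: "real \<Rightarrow> (nat \<Rightarrow> real) \<Rightarrow> real" where
  "abel_mean t f = (1 - t) * suminf (\<lambda>i. t ^ i * f i)"

lemma summable_geometric_mult:
  fixes t :: real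
  assumes t: "0 < t" "t < 1" and "bounded_fun f" shows "summable (\<lambda>i. t ^ i * f i)"
proof -
  obtain C where C: "\<And>i. \<bar>f i\<bar> \<le> C" using assms(3) by (auto simp: bounded_fun_iff)
  have "summable (\<lambda>i. t ^ i * C)" using t by (intro summable_mult2 summable_geometric) auto
  then show ?thesis
    by (rule summable_comparison_test') (use C t in \<open>auto simp: abs_mult intro!: mult_left_mono\<close>)
qed

lemma mean_abel_mean: assumes t: "0 < t" "t < 1" shows "mean (abel_mean t)"
proof (rule meanI)
  note summable = summable_geometric_mult[OF t]
  have sum_const: "(1 - t) * suminf (\<lambda>i. t ^ i * C) = C" for C
    using t by (simp add: suminf_mult2[symmetric] summable_geometric suminf_geometric)
  then show "abel_mean t (\<lambda>_. C) = C" for C by (simp add: abel_mean_def)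
  fix f :: "nat \<Rightarrow> real"
  {
    fix g :: "nat \<Rightarrow> real" assume "bounded_fun f" "bounded_fun g"
    from suminf_add[OF this[THEN summable]]
    have "suminf (\<lambda>i. t ^ i * (f i + g i)) = suminf (\<lambda>i. t ^ i * f i) + suminf (\<lambda>i. t ^ i * g i)"
      by (simp add: distrib_left)
    then show "abel_mean t (\<lambda>i. f i + g i) = abel_mean t f + abel_mean t g"
      by (simp only: abel_mean_def distrib_left)
  next
    fix C assume "bounded_fun f"
    from suminf_mult[OF summable[OF this], of C] show "abel_mean t (\<lambda>i. C * f i) = C * abel_mean t f"
      by (simp add: abel_mean_def mult_ac)
  next
    fix C assume f: "\<And>i. \<bar>f i\<bar> \<le> C"
    have "\<bar>suminf (\<lambda>i. t ^ i * f i)\<bar> \<le> suminf (\<lambda>i. t ^ i * C)"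
      unfolding real_norm_def[symmetric]
      by (rule norm_suminf_le[OF _ summable[OF bounded_fun_const]])
         (use f t in \<open>auto simp: abs_mult intro!: mult_left_mono\<close>)
    then have "(1 - t) * \<bar>suminf (\<lambda>i. t ^ i * f i)\<bar> \<le> (1 - t) * suminf (\<lambda>i. t ^ i * C)"
      using t by (intro mult_left_mono) auto
    then show "\<bar>abel_mean t f\<bar> \<le> C" using t by (simp add: abel_mean_def abs_mult sum_const)
  }
qed

lemma abel_mean_single: "abel_mean t (\<lambda>i. if i = k then v else 0) = (1 - t) * t ^ k * v"
  using suminf_finite[of "{k}" "\<lambda>i. t ^ i * (if i = k then v else 0)"] by (simp add: abel_mean_def)

lemma (in mean) bounded_cocycle_mean:
  assumes r: "\<And>i. additive (r i)" and F: "bounded_cocycle n F"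
  shows "bounded_cocycle n (\<lambda>xs. m (\<lambda>i. F (map (r i) xs)))"
proof -
  have cocycle: "bounded_cocycle n (\<lambda>xs. F (map (r i) xs))" for i
    by (rule bounded_cocycle_pullback[OF r F])
  have bounded: "\<exists>C. \<forall>xs i. length xs = k \<longrightarrow> \<bar>F (map (r i) xs)\<bar> \<le> C" for k
    using F unfolding bounded_cocycle_def invariant_cochain_def bounded_cochain_def by (metis length_map)
  then have "\<exists>C. \<forall>xs. length xs = k \<longrightarrow> \<bar>m (\<lambda>i. F (map (r i) xs))\<bar> \<le> C" for k
    by (meson abs_le)
  moreover have "cobound (\<lambda>xs. m (\<lambda>i. F (map (r i) xs))) xs = 0" if "length xs = n + 2" for xs
  proof -
    have "bounded_fun (\<lambda>i. F (map (r i) l))" for l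
      using bounded[of "length l"] by (auto simp: bounded_fun_iff)
    then have "cobound (\<lambda>xs. m (\<lambda>i. F (map (r i) xs))) xs = m (\<lambda>i. cobound (\<lambda>xs. F (map (r i) xs)) xs)"
      using cobound_commute[of xs "\<lambda>i xs. F (map (r i) xs)"] by blast
    then show ?thesis using cocycle that zero by (simp add: bounded_cocycle_def)
  qed
  ultimately show ?thesis
    using cocycle by (simp add: bounded_cocycle_def invariant_cochain_def translation_invariant_def
        bounded_cochain_def)
qed

definition copy :: "nat \<Rightarrow> nat \<Rightarrow> nat" where
  "copy i j = prod_encode (i, j)"

lemma inj_copy: "inj (copy i)"
  by (auto simp: inj_on_def copy_def)

lemma disjoint_range_copy: "i \<noteq> k \<Longrightarrow> range (copy i) \<inter> range (copy k) = {}"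
  by (auto simp: copy_def)

definition mixture :: "('g::group_add lamps list \<Rightarrow> real) \<Rightarrow> real \<Rightarrow> 'g lamps list \<Rightarrow> real" where
  "mixture F t xs = abel_mean t (\<lambda>i. F (map (pull_lamps (copy i)) xs))"

lemma bounded_cocycle_mixture:
  "bounded_cocycle n F \<Longrightarrow> 0 < t \<Longrightarrow> t < 1 \<Longrightarrow> bounded_cocycle n (mixture F t)"
  unfolding mixture_def[abs_def]
  by (intro mean.bounded_cocycle_mean mean_abel_mean additive_pull_lamps inj_copy)

lemma mixture_push:
  fixes F :: "'g::group_add lamps list \<Rightarrow> real"
  assumes t: "0 < t" "t < 1"
  shows "mixture F t (map (push_lamps (copy k)) xs)
    = (1 - t) * t ^ k * F xs + (1 - (1 - t) * t ^ k) * F (replicate (length xs) 0)"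
proof -
  interpret mean "abel_mean t" by (rule mean_abel_mean[OF t])
  let ?z = "replicate (length xs) (0 :: 'g lamps)"
  have "map (pull_lamps (copy i)) (map (push_lamps (copy k)) xs) = (if i = k then xs else ?z)" for i
    using disjoint_range_copy[of i k]
    by (auto simp: comp_def pull_push_lamps inj_copy pull_push_lamps_disjoint map_replicate_const)
  then have "mixture F t (map (push_lamps (copy k)) xs)
      = abel_mean t (\<lambda>i. F ?z + (if i = k then F xs - F ?z else 0))"
    unfolding mixture_def by (intro arg_cong[of _ _ "abel_mean t"] ext) simp
  also have "\<dots> = F ?z + abel_mean t (\<lambda>i. if i = k then F xs - F ?z else 0)"
    by (subst add) (auto simp: const intro!: bounded_funI[of _ "\<bar>F xs - F ?z\<bar>"])
  finally show ?thesis unfolding abel_mean_single by (simp add: algebra_simps)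
qed

lemma bounded_cocycle_replicate_eq_0:
  assumes "bounded_cocycle n F" "odd n" shows "F (replicate (n + 1) x) = 0"
proof -
  have "cobound F (map (\<lambda>_. x) (replicate (n + 2) x))
    = cobound (\<lambda>_. F (replicate (n + 1) x)) (replicate (n + 2) x)"
    unfolding cobound_map by (rule cobound_cong) (simp add: map_replicate_const)
  also have "\<dots> = F (replicate (n + 1) x)" using assms(2) unfolding cobound_const by simp
  finally have "cobound F (replicate (n + 2) x) = F (replicate (n + 1) x)" unfolding map_replicate .
  moreover have "cobound F (replicate (n + 2) x) = 0"
    using assms(1) by (simp only: bounded_cocycle_def length_replicate)
  ultimately show ?thesis by (simp only:)
qed

lemma power_sums_eq_0_imp_eq_0:
  fixes u :: "'a::idom \<Rightarrow> 'a"
  assumes "finite T" "\<And>k. (\<Sum>t\<in>T. u t * t ^ k) = 0" "s \<in> T"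
  shows "u s = 0"
proof -
  define p where "p = (\<Prod>t\<in>T - {s}. [:- t, 1:])"
  have "(\<Sum>t\<in>T. u t * poly p t) = (\<Sum>t\<in>T. \<Sum>k\<le>degree p. coeff p k * (u t * t ^ k))"
    by (simp add: poly_altdef sum_distrib_left mult_ac)
  also have "\<dots> = (\<Sum>k\<le>degree p. coeff p k * (\<Sum>t\<in>T. u t * t ^ k))"
    by (subst sum.swap) (simp add: sum_distrib_left)
  also have "\<dots> = 0" using assms(2) by simp
  finally have "(\<Sum>t\<in>T. u t * poly p t) = 0" .
  moreover have "poly p t = 0" if "t \<in> T - {s}" for t using that assms(1) by (auto simp: p_def poly_prod)
  then have "(\<Sum>t\<in>T. u t * poly p t) = u s * poly p s"
    using sum.remove[OF assms(1,3), of "\<lambda>t. u t * poly p t"] by simp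
  moreover have "poly p s \<noteq> 0" using assms(1) by (auto simp: p_def poly_prod)
  ultimately show ?thesis by simp
qed

theorem mixtures_independent:
  assumes F: "nontrivial_cocycle n F" and T: "finite T" "T \<subseteq> {0<..<1}"
    and coboundary: "bounded_coboundary n (\<lambda>xs. \<Sum>t\<in>T. u t * mixture F t xs)" and s: "s \<in> T"
  shows "u s = 0"
proof -
  have "(\<Sum>t\<in>T. (u t * (1 - t)) * t ^ k) = 0" for k
  proof (rule ccontr)
    let ?a = "\<Sum>t\<in>T. (u t * (1 - t)) * t ^ k"
      and ?K = "(\<Sum>t\<in>T. u t * (1 - (1 - t) * t ^ k)) * F (replicate (n + 1) 0)"
    have "bounded_coboundary n (\<lambda>xs. \<Sum>t\<in>T. u t * mixture F t (map (push_lamps (copy k)) xs))"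
      by (rule bounded_coboundary_pullback[OF additive_push_lamps[OF inj_copy] coboundary])
    moreover have "(\<Sum>t\<in>T. u t * mixture F t (map (push_lamps (copy k)) xs)) = ?a * F xs + ?K"
      if "length xs = n + 1" for xs
    proof -
      have "u t * mixture F t (map (push_lamps (copy k)) xs)
          = (u t * (1 - t)) * t ^ k * F xs + u t * (1 - (1 - t) * t ^ k) * F (replicate (n + 1) 0)"
        if "t \<in> T" for t
      proof -
        have "0 < t" "t < 1" using that T(2) by auto
        then show ?thesis
          unfolding mixture_push[OF \<open>0 < t\<close> \<open>t < 1\<close>] \<open>length xs = n + 1\<close>
          by (simp only: distrib_left mult.assoc)
      qed
      then show ?thesis by (simp add: sum.distrib sum_distrib_right)
    qed
    ultimately have "bounded_coboundary n (\<lambda>xs. ?a * F xs + ?K)"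
      by (rule bounded_coboundary_cong[THEN iffD1, rotated])
    moreover have "bounded_coboundary n (\<lambda>_. - ?K)"
      using F bounded_cocycle_replicate_eq_0[of n F 0]
      by (intro bounded_coboundary_const) (simp add: nontrivial_cocycle_def)
    ultimately have "bounded_coboundary n (\<lambda>xs. ?a * F xs + ?K + - ?K)" by (rule bounded_coboundary_add)
    then have coboundary_a: "bounded_coboundary n (\<lambda>xs. ?a * F xs)" by simp
    assume "?a \<noteq> 0"
    then have "bounded_coboundary n F" using bounded_coboundary_cmult[OF coboundary_a, of "1 / ?a"] by simp
    then show False using F by (simp add: nontrivial_cocycle_def)
  qed
  then have "u s * (1 - s) = 0" by (rule power_sums_eq_0_imp_eq_0[OF T(1) _ s])
  then show ?thesis using s T(2) by auto
qed

section \<open>Dimension count\<close>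

definition independent_modulo :: "('a list \<Rightarrow> real) set \<Rightarrow> ('a list \<Rightarrow> real) set \<Rightarrow> bool" where
  "independent_modulo B S \<longleftrightarrow> (\<forall>T c. finite T \<and> T \<subseteq> S \<and> lincomb c T \<in> B \<longrightarrow> (\<forall>t\<in>T. c t = 0))"

lemma lincomb_remove:
  "finite T \<Longrightarrow> z \<in> T \<Longrightarrow> lincomb c T xs = c z * z xs + lincomb c (T - {z}) xs"
  unfolding lincomb_def by (rule sum.remove)

lemma lincomb_single: "lincomb (\<lambda>_. 1) {z} = z"
  by (simp add: lincomb_def)

lemma ex_maximal_independent_modulo:
  assumes "S0 \<subseteq> Z" "independent_modulo B S0"
  obtains S where "S0 \<subseteq> S" "S \<subseteq> Z" "independent_modulo B S"
    "\<And>z. z \<in> Z \<Longrightarrow> z \<notin> S \<Longrightarrow> \<not> independent_modulo B (insert z S)"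
proof -
  define A where "A = {S. S0 \<subseteq> S \<and> S \<subseteq> Z \<and> independent_modulo B S}"
  have "\<exists>S\<in>A. \<forall>U\<in>A. S \<subseteq> U \<longrightarrow> U = S"
  proof (rule subset_Zorn_nonempty)
    show "A \<noteq> {}" using assms by (auto simp: A_def)
    fix C assume C: "C \<noteq> {}" "subset.chain A C"
    have CA: "C \<subseteq> A" using C(2) by (auto simp: subset.chain_def)
    have "independent_modulo B (\<Union>C)" unfolding independent_modulo_def
    proof (intro allI impI)
      fix T c assume T: "finite T \<and> T \<subseteq> \<Union>C \<and> lincomb c T \<in> B"
      obtain U where "U \<in> C" "T \<subseteq> U"
        using finite_subset_Union_chain[of T C A] T C by blast
      then show "\<forall>t\<in>T. c t = 0" using CA T unfolding A_def independent_modulo_def by blast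
    qed
    then show "\<Union>C \<in> A" using CA C(1) unfolding A_def by blast
  qed
  then obtain S where S: "S \<in> A" "\<And>U. U \<in> A \<Longrightarrow> S \<subseteq> U \<Longrightarrow> U = S" by blast
  show ?thesis
  proof (rule that[of S])
    fix z assume "z \<in> Z" "z \<notin> S"
    then show "\<not> independent_modulo B (insert z S)" using S(1) S(2)[of "insert z S"] by (auto simp: A_def)
  qed (use S(1) in \<open>auto simp: A_def\<close>)
qed

lemma spanned_if_not_independent_insert:
  assumes B: "\<And>b k. b \<in> B \<Longrightarrow> (\<lambda>x. k * b x) \<in> B"
    and S: "independent_modulo B S" and dependent: "\<not> independent_modulo B (insert z S)"
  shows "\<exists>T c b. finite T \<and> T \<subseteq> S \<and> b \<in> B \<and> z = (\<lambda>xs. lincomb c T xs + b xs)"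
proof -
  obtain T c t where T: "finite T" "T \<subseteq> insert z S" "lincomb c T \<in> B" "t \<in> T" "c t \<noteq> 0"
    using dependent unfolding independent_modulo_def by blast
  have z: "z \<in> T"
  proof (rule ccontr)
    assume "z \<notin> T"
    then have "T \<subseteq> S" using T(2) by blast
    then show False using S T unfolding independent_modulo_def by blast
  qed
  have "c z \<noteq> 0"
  proof
    assume cz: "c z = 0"
    have "lincomb c T = lincomb c (T - {z})" by (rule ext) (simp add: lincomb_remove[OF T(1) z] cz)
    then have "finite (T - {z})" "T - {z} \<subseteq> S" "lincomb c (T - {z}) \<in> B" using T by auto
    then have "\<forall>t\<in>T - {z}. c t = 0" using S unfolding independent_modulo_def by blast
    then show False using T(4,5) cz by blast
  qed
  let ?c = "\<lambda>t. - c t / c z" and ?b = "\<lambda>xs. (1 / c z) * lincomb c T xs"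
  have "z xs = lincomb ?c (T - {z}) xs + ?b xs" for xs
  proof -
    have "lincomb ?c (T - {z}) xs = - lincomb c (T - {z}) xs / c z"
      by (simp add: lincomb_def sum_negf sum_divide_distrib)
    then show ?thesis using lincomb_remove[OF T(1) z, of c xs] \<open>c z \<noteq> 0\<close> by (simp add: field_simps)
  qed
  moreover have "?b \<in> B" by (rule B[OF T(3)])
  moreover have "finite (T - {z})" "T - {z} \<subseteq> S" using T by auto
  ultimately show ?thesis by blast
qed

lemma independent_modulo_image:
  assumes zero: "(\<lambda>_. 0) \<in> B"
    and independent: "\<And>T k t. finite T \<Longrightarrow> T \<subseteq> I \<Longrightarrow> (\<lambda>xs. \<Sum>t\<in>T. k t * f t xs) \<in> B \<Longrightarrow> t \<in> T \<Longrightarrow> k t = 0"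
  shows "inj_on f I" "independent_modulo B (f ` I)"
proof -
  show inj: "inj_on f I"
  proof (rule inj_onI, rule ccontr)
    fix s t assume st: "s \<in> I" "t \<in> I" "f s = f t" "s \<noteq> t"
    have "(\<lambda>xs. \<Sum>r\<in>{s, t}. (if r = s then 1 else -1) * f r xs) = (\<lambda>_. 0)" using st by auto
    then have "(\<lambda>xs. \<Sum>r\<in>{s, t}. (if r = s then 1 else -1) * f r xs) \<in> B" using zero by simp
    from independent[OF _ _ this, of s] show False using st by simp
  qed
  show "independent_modulo B (f ` I)" unfolding independent_modulo_def
  proof (intro allI impI ballI)
    fix T k x assume T: "finite T \<and> T \<subseteq> f ` I \<and> lincomb k T \<in> B" and "x \<in> T"
    obtain U where U: "U \<subseteq> I" "T = f ` U" "finite U"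
      using T finite_subset_image[of T f I] by auto
    have "lincomb k T = (\<lambda>xs. \<Sum>t\<in>U. k (f t) * f t xs)"
      unfolding lincomb_def U(2) using inj_on_subset[OF inj U(1)] by (simp add: sum.reindex)
    then have "(\<lambda>xs. \<Sum>t\<in>U. k (f t) * f t xs) \<in> B" using T by simp
    from independent[OF U(3,1) this] show "k x = 0" using \<open>x \<in> T\<close> U(2) by auto
  qed
qed

lemma real_sequences_lepoll_reals: "(UNIV :: (nat \<Rightarrow> real) set) \<lesssim> (UNIV :: real set)"
proof -
  obtain g :: "real \<Rightarrow> nat set" where g: "inj g"
    using nat_sets_eqpoll_reals by (meson eqpoll_imp_lepoll eqpoll_sym lepoll_def)
  let ?code = "\<lambda>f. {prod_encode (i, j) | i j. j \<in> g (f i)}"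
  have mem: "prod_encode (i, j) \<in> ?code f \<longleftrightarrow> j \<in> g (f i)" for i j f by (auto simp: prod_encode_eq)
  have "inj ?code"
  proof (rule injI, rule ext)
    fix f f' i assume "?code f = ?code f'"
    then have "g (f i) = g (f' i)" using mem by blast
    then show "f i = f' i" using g by (auto simp: inj_on_def)
  qed
  then have "(UNIV :: (nat \<Rightarrow> real) set) \<lesssim> (UNIV :: nat set set)" unfolding lepoll_def by blast
  then show ?thesis using nat_sets_eqpoll_reals by (metis lepoll_trans2)
qed

lemma bcochain_lepoll_reals:
  assumes "countable (carrier G)" shows "bcochain G n \<lesssim> (UNIV :: real set)"
proof -
  let ?L = "lists (carrier G)" and ?h = "\<lambda>f :: 'a list \<Rightarrow> real. \<lambda>k. f (from_nat_into (lists (carrier G)) k)"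
  have "inj_on ?h (bcochain G n)"
  proof (rule inj_onI, rule ext)
    fix f f' xs assume f: "f \<in> bcochain G n" "f' \<in> bcochain G n" "?h f = ?h f'"
    show "f xs = f' xs"
    proof (cases "xs \<in> ?L")
      case True
      then obtain k where "xs = from_nat_into ?L k"
        using countable_lists[OF assms] by (metis from_nat_into_surj)
      then show ?thesis using fun_cong[OF f(3), of k] by simp
    next
      case False
      then have "\<not> set xs \<subseteq> carrier G" by auto
      then have "f xs = 0" "f' xs = 0" using f unfolding bcochain_def by blast+
      then show ?thesis by simp
    qed
  qed
  then have "bcochain G n \<lesssim> (UNIV :: (nat \<Rightarrow> real) set)" unfolding lepoll_def by blast
  then show ?thesis using real_sequences_lepoll_reals by (rule lepoll_trans)
qed

lemma bcoboundaries_cmult: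
  assumes "b \<in> bcoboundaries G n" shows "(\<lambda>x. k * b x) \<in> bcoboundaries G n"
proof (cases n)
  case (Suc m)
  then obtain f where f: "f \<in> bcochain G m" "b = bcobound G m f"
    using assms by (auto simp: bcoboundaries_def)
  obtain C where C: "\<And>xs. \<bar>f xs\<bar> \<le> C" using f(1) by (auto simp: bcochain_def)
  have "(\<lambda>x. k * f x) \<in> bcochain G m"
    using f(1) C by (auto simp: bcochain_def abs_mult intro!: exI[of _ "\<bar>k\<bar> * C"] mult_left_mono)
  moreover have "(\<lambda>x. k * b x) = bcobound G m (\<lambda>x. k * f x)"
    unfolding f(2) by (auto simp: bcobound_def algebra_simps sum_distrib_left)
  ultimately show ?thesis by (auto simp: bcoboundaries_def Suc)
qed (use assms in \<open>simp add: bcoboundaries_def\<close>)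

lemma zero_in_bcoboundaries: "(\<lambda>_. 0) \<in> bcoboundaries G n"
proof (cases n)
  case (Suc m)
  have "(\<lambda>_. 0) \<in> bcochain G m" by (auto simp: bcochain_def)
  moreover have "bcobound G m (\<lambda>_. 0) = (\<lambda>_. 0)" by (auto simp: bcobound_def)
  ultimately show ?thesis unfolding bcoboundaries_def Suc by (metis image_eqI nat.simps(5))
qed (simp add: bcoboundaries_def)

lemma bcoh_dim_eqpoll_realsI:
  assumes countable: "countable (carrier G)"
    and f: "\<And>t. t \<in> {0<..<1 :: real} \<Longrightarrow> f t \<in> bcocycles G n"
    and independent: "\<And>T k t. finite T \<Longrightarrow> T \<subseteq> {0<..<1} \<Longrightarrow>
      (\<lambda>xs. \<Sum>t\<in>T. k t * f t xs) \<in> bcoboundaries G n \<Longrightarrow> t \<in> T \<Longrightarrow> k t = 0"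
  shows "bcoh_dim_eqpoll G n (UNIV :: real set)"
proof -
  let ?I = "{0<..<1 :: real}" and ?B = "bcoboundaries G n"
  have inj: "inj_on f ?I" by (rule independent_modulo_image(1)[OF zero_in_bcoboundaries]) (rule independent)
  have image: "independent_modulo ?B (f ` ?I)"
    by (rule independent_modulo_image(2)[OF zero_in_bcoboundaries]) (rule independent)
  have "f ` ?I \<subseteq> bcocycles G n" using f by auto
  then obtain S where S: "f ` ?I \<subseteq> S" "S \<subseteq> bcocycles G n" "independent_modulo ?B S"
    and maximal: "\<And>z. z \<in> bcocycles G n \<Longrightarrow> z \<notin> S \<Longrightarrow> \<not> independent_modulo ?B (insert z S)"
    using image by (rule ex_maximal_independent_modulo) blast
  have "\<exists>T c b. finite T \<and> T \<subseteq> S \<and> b \<in> ?B \<and> z = (\<lambda>xs. lincomb c T xs + b xs)"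
    if "z \<in> bcocycles G n" for z
  proof (cases "z \<in> S")
    case True
    then show ?thesis using zero_in_bcoboundaries[of G n]
      by (intro exI[of _ "{z}"] exI[of _ "\<lambda>_. 1"] exI[of _ "\<lambda>_. 0"]) (simp add: lincomb_single)
  next
    case False
    then show ?thesis
      using spanned_if_not_independent_insert[OF bcoboundaries_cmult S(3) maximal[OF that]] by blast
  qed
  moreover have "S \<approx> (UNIV :: real set)"
  proof (rule lepoll_antisym)
    have "S \<subseteq> bcochain G n" using S(2) by (auto simp: bcocycles_def)
    then show "S \<lesssim> (UNIV :: real set)"
      using bcochain_lepoll_reals[OF countable] by (meson lepoll_trans subset_imp_lepoll)
    have "(UNIV :: real set) \<approx> ?I" using open_interval_eqpoll_reals[of 0 1] eqpoll_sym by auto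
    moreover have "?I \<lesssim> S" unfolding lepoll_def using inj S(1) by blast
    ultimately show "(UNIV :: real set) \<lesssim> S" by (meson eqpoll_imp_lepoll lepoll_trans)
  qed
  ultimately show ?thesis
    unfolding bcoh_dim_eqpoll_def using S(2) S(3)[unfolded independent_modulo_def] by blast
qed

lemma invariant_cochain_sum:
  "finite T \<Longrightarrow> (\<And>t. t \<in> T \<Longrightarrow> invariant_cochain (F t)) \<Longrightarrow> invariant_cochain (\<lambda>xs. \<Sum>t\<in>T. F t xs)"
  by (induction T rule: finite_induct) (simp_all add: invariant_cochain_const invariant_cochain_add)

lemma (in additive_iso) inhomogeneous_in_bcoboundaries_iff:
  assumes "invariant_cochain F"
  shows "inhomogeneous \<theta> G (Suc m) F \<in> bcoboundaries G (Suc m) \<longleftrightarrow> bounded_coboundary (Suc m) F"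
proof -
  have F: "translation_invariant F" "bounded_cochain F" using assms by (auto simp: invariant_cochain_def)
  have "bounded_coboundary (Suc m) (homogeneous \<theta> (inhomogeneous \<theta> G (Suc m) F))
    \<longleftrightarrow> bounded_coboundary (Suc m) F"
    by (rule bounded_coboundary_cong) (rule homogeneous_inhomogeneous[OF F(1)])
  then show ?thesis using bcoboundaries_iff_homogeneous[OF inhomogeneous_in_bcochain[OF F(2)]] by blast
qed

lemma ex_inj_to_nat_if_finite_support:
  fixes val :: "'x \<Rightarrow> 'i::countable \<Rightarrow> 'b::countable"
  assumes ext: "\<And>x y. (\<And>i. val x i = val y i) \<Longrightarrow> x = y" and finite: "\<And>x. finite {i. val x i \<noteq> d i}"
  shows "\<exists>f :: 'x \<Rightarrow> nat. inj f"
proof -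
  define graph where "graph x = (\<lambda>i. (i, val x i)) ` {i. val x i \<noteq> d i}" for x
  have val_eq: "val x i = (if \<exists>v. (i, v) \<in> graph x then THE v. (i, v) \<in> graph x else d i)" for x i
    by (auto simp: graph_def image_iff)
  have "inj graph" by (rule injI, rule ext) (simp add: val_eq)
  moreover have "countable (range graph)"
    by (rule countable_subset[OF _ countable_Collect_finite]) (auto simp: graph_def finite)
  ultimately have "countable (UNIV :: 'x set)" by (rule countable_image_inj_on[rotated])
  then show ?thesis by (simp add: countable_def)
qed

instance lamps :: ("{group_add, countable}") countable
  by (intro_classes, rule ex_inj_to_nat_if_finite_support[of lamp "\<lambda>_. 0"])
     (auto intro: lamps_eqI simp: finite_lamp)

theorem bcoh_dim_lamps:
  fixes \<theta> :: "'g::{group_add, countable} lamps \<Rightarrow> 'a" and F :: "'g lamps list \<Rightarrow> real"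
  assumes "additive_iso \<theta> G" and n: "n \<ge> 1" and F: "nontrivial_cocycle n F"
  shows "bcoh_dim_eqpoll G n (UNIV :: real set)"
proof (rule bcoh_dim_eqpoll_realsI)
  interpret additive_iso \<theta> G by fact
  show "countable (carrier G)" using bij countable_image[of UNIV \<theta>] by (simp add: bij_betw_def)
  have mixture: "bounded_cocycle n (mixture F t)" if "t \<in> {0<..<1}" for t
    using F that by (intro bounded_cocycle_mixture) (auto simp: nontrivial_cocycle_def)
  then show "inhomogeneous \<theta> G n (mixture F t) \<in> bcocycles G n" if "t \<in> {0<..<1}" for t
    using that by (intro inhomogeneous_in_bcocycles)
  fix T k t assume T: "finite T" "T \<subseteq> {0<..<1}" "t \<in> T"
    and coboundary: "(\<lambda>xs. \<Sum>t\<in>T. k t * inhomogeneous \<theta> G n (mixture F t) xs) \<in> bcoboundaries G n"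
  let ?M = "\<lambda>xs. \<Sum>t\<in>T. k t * mixture F t xs"
  have "invariant_cochain ?M"
    using T(1,2) mixture
    by (intro invariant_cochain_sum invariant_cochain_cmult) (auto simp: bounded_cocycle_def)
  moreover have "inhomogeneous \<theta> G n ?M = (\<lambda>xs. \<Sum>t\<in>T. k t * inhomogeneous \<theta> G n (mixture F t) xs)"
  proof
    fix ys
    show "inhomogeneous \<theta> G n ?M ys = (\<Sum>t\<in>T. k t * inhomogeneous \<theta> G n (mixture F t) ys)"
      by (cases "length ys = n \<and> set ys \<subseteq> carrier G")
         (simp_all only: inhomogeneous_def simp_thms if_True if_False mult_zero_right sum.neutral_const)
  qed
  ultimately have "bounded_coboundary n ?M"
    using coboundary n inhomogeneous_in_bcoboundaries_iff[of ?M "n - 1"] by simp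
  from mixtures_independent[OF F T(1,2) this T(3)] show "k t = 0" .
qed

section \<open>The group and its normal subgroup\<close>

instance perm :: (countable) countable
proof (intro_classes, rule ex_inj_to_nat_if_finite_support[of "apply"])
  show "finite {i. apply s i \<noteq> i}" for s :: "'a perm"
    by (rule finite_subset[OF _ finite_affected[of s]]) (auto simp: in_affected)
qed (auto intro: perm_eqI)

instance wreath :: ("{group_add, countable}") countable
  by (rule countable_classI[of "\<lambda>w. to_nat (lamps_of w, perm_of w)"]) (auto intro: wreath.expand)

locale group_extension = additive_iso \<theta> \<Gamma>
  for \<theta> :: "'g::group_add \<Rightarrow> 'a" and \<Gamma> :: "'a monoid" +
  fixes s :: "'k::group_add \<Rightarrow> 'g" and r :: "'g \<Rightarrow> 'h::group_add"
  assumes group: "group \<Gamma>"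
    and additive_s: "additive s" and inj_s: "inj s" and additive_r: "additive r" and surj_r: "surj r"
    and range_s: "range s = {x. r x = 0}"
begin

definition kernel_subgroup :: "'a set" where
  "kernel_subgroup = \<theta> ` range s"

definition projection :: "'a \<Rightarrow> 'h" where
  "projection = r \<circ> the_inv_into UNIV \<theta>"

lemma carrier_eq: "carrier \<Gamma> = range \<theta>"
  using bij by (simp add: bij_betw_def)

lemma projection_apply: "projection (\<theta> x) = r x"
  by (simp add: projection_def)

lemma group_hom_projection: "group_hom \<Gamma> additive_group projection"
proof -
  have "projection \<in> hom \<Gamma> additive_group"
    using additive_r by (auto simp: hom_def carrier_eq projection_apply additive_def simp flip: add)
  then show ?thesis using group group_additive_group by (simp add: group_hom_def group_hom_axioms_def)
qed

lemma kernel_projection: "kernel \<Gamma> additive_group projection = kernel_subgroup"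
  by (auto simp: kernel_def kernel_subgroup_def range_s carrier_eq projection_apply)

lemma normal_kernel_subgroup: "kernel_subgroup \<lhd> \<Gamma>"
  using group_hom.normal_kernel[OF group_hom_projection] by (simp only: kernel_projection)

lemma boundedly_acyclic_quotient:
  assumes "\<And>n F. n \<ge> 1 \<Longrightarrow> bounded_cocycle n F \<Longrightarrow> bounded_coboundary n (F :: 'h list \<Rightarrow> real)"
  shows "boundedly_acyclic (\<Gamma> Mod kernel_subgroup)"
proof -
  have quotient: "group (\<Gamma> Mod kernel_subgroup)"
    by (rule normal.factorgroup_is_group[OF normal_kernel_subgroup])
  have "projection ` carrier \<Gamma> = carrier additive_group"
    using surj_r by (simp add: carrier_eq image_comp projection_apply comp_def)
  from group_hom.FactGroup_iso_set[OF group_hom_projection this]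
  have "(\<lambda>C. the_elem (projection ` C)) \<in> iso (\<Gamma> Mod kernel_subgroup) additive_group"
    by (simp only: kernel_projection)
  from group.iso_set_sym[OF quotient this]
  obtain q :: "'h \<Rightarrow> 'a set" where "additive_iso q (\<Gamma> Mod kernel_subgroup)"
    by (auto simp: additive_iso_def)
  then show ?thesis using assms by (rule additive_iso.boundedly_acyclicI[OF _ quotient])
qed

lemma additive_iso_subgroup: "additive_iso (\<theta> \<circ> s) (\<Gamma>\<lparr>carrier := kernel_subgroup\<rparr>)"
  using additive_s inj_s inj
  by (auto simp: additive_iso_def iso_def hom_def bij_betw_def inj_compose kernel_subgroup_def
      additive_def image_comp add)

end

lemma surj_perm_of: "surj perm_of"
  by (rule surjI[of _ "Wreath 0"]) simp

lemma range_base: "range base = {w. perm_of w = 0}"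
  by (auto simp: image_iff) (metis wreath.collapse)

theorem theorem4p5:
  shows "\<exists>(\<Gamma> :: real set monoid) H.
           boundedly_acyclic \<Gamma> \<and> H \<lhd> \<Gamma> \<and> boundedly_acyclic (\<Gamma> Mod H)
           \<and> (\<forall>n\<ge>2. bcoh_dim_eqpoll (\<Gamma>\<lparr>carrier := H\<rparr>) n (UNIV :: real set))"
proof -
  let ?e = "\<lambda>w :: (rat gl2 \<times> gauss_rat gl2) wreath. {real (to_nat w)}"
  let ?\<Gamma> = "image_group ?e additive_group"
  have inj: "inj_on ?e (carrier additive_group)" by (simp add: inj_on_def)
  interpret group_extension ?e ?\<Gamma> base perm_of
  proof (intro group_extension.intro additive_iso.intro group_extension_axioms.intro)
    show "?e \<in> iso additive_group ?\<Gamma>" by (rule inj_imp_image_group_iso[OF inj])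
    show "group ?\<Gamma>" by (rule group.inj_imp_image_group_is_group[OF group_additive_group inj])
  qed (auto simp: additive_base additive_perm_of inj_on_def surj_perm_of range_base)
  have "boundedly_acyclic ?\<Gamma>"
    by (rule boundedly_acyclicI[OF group]) (rule bounded_coboundary_wreath[OF surj_from_nat])
  moreover have "boundedly_acyclic (?\<Gamma> Mod kernel_subgroup)"
    by (rule boundedly_acyclic_quotient) (rule bounded_coboundary_perm)
  moreover have "bcoh_dim_eqpoll (?\<Gamma>\<lparr>carrier := kernel_subgroup\<rparr>) n (UNIV :: real set)" if "n \<ge> 2" for n
    using ex_nontrivial_cocycle[OF that] that by (auto intro: bcoh_dim_lamps[OF additive_iso_subgroup])
  ultimately show ?thesis using normal_kernel_subgroup by blast
qed

end
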